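(* Let $M$ be a sequentially generalized Cohen-Macaulay module with a generalized Cohen-Macaulay filtration $\mathcal F: M_0\subset M_1\subset\ldots\subset M_t=M$, and let $\underline x=(x_1,\ldots,x_d)$ be a good system of parameters of $M$ with respect to $\mathcal F$. Then $I_{\mathcal F,M}(x_1^{n_1},\ldots,x_d^{n_d})$ is a constant for all $n_1,\ldots,n_d$ large enough.
   Context: $(R,\mathfrak m)$ is a commutative Noetherian local ring and $M$ is a finitely generated $R$-module of dimension $d$. $\ell$ denotes length and $e(\underline y;N)$ denotes the Serre multiplicity of a finitely generated module $N$ relative to a system of parameters $\underline y$ of $N$. The zero module has dimension $-1$. A filtration $\mathcal F: M_0\subset M_1\subset\cdots\subset M_t=M$ of submodules of $M$ satisfies the dimension condition if $\dim M_0<\dim M_1<\cdots<\dim M_t$; put $d_i=\dim M_i$. A system of parameters $\underline x=(x_1,\ldots,x_d)$ of $M$ is good with respect to $\mathcal F$ if $M_i\cap(x_{d_i+1},\ldots,x_d)M=0$ for $i=0,\ldots,t-1$ (for $M_0=0$ the condition on $M_0$ is vacuous). Then $(x_1,\ldots,x_{d_i})$ is a system of parameters of $M_i$, the powers $(x_1^{n_1},\ldots,x_d^{n_d})$ again form a good system of parameters with respect to $\mathcal F$, and $$I_{\mathcal F,M}(\underline x)=\ell(M/\underline xM)-\sum_{i=0}^t e(x_1,\ldots,x_{d_i};M_i),$$ where the summand for $i=0$ is $\ell(M_0)$ if $\dim M_0=0$ and is $0$ if $M_0=0$. A finitely generated module $N$ is generalized Cohen-Macaulay if $I(N)=\sup_{\underline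 y}\{\ell(N/\underline yN)-e(\underline y;N)\}<\infty$, the supremum being over all systems of parameters $\underline y$ of $N$. A filtration $\mathcal F$ is a generalized Cohen-Macaulay filtration if it satisfies the dimension condition, $\dim M_0\le 0$, and $M_1/M_0,\ldots,M_t/M_{t-1}$ are generalized Cohen-Macaulay; moreover, by convention, only generalized Cohen-Macaulay filtrations with $\dim M_1>0$ are considered. $M$ is sequentially generalized Cohen-Macaulay if it has a generalized Cohen-Macaulay filtration. *)

theory Defs
  imports "HOL-Algebra.Module" "HOL-Algebra.Ring_Divisibility" "HOL-Library.Extended_Real"
begin

locale noetherian_local_ring = cring R + noetherian_ring R
  for R (structure) +
  fixes \<mm> :: "'a set"
  assumes maximal: "maximalideal \<mm> R"
    and unique_maximal: "maximalideal J R \<Longrightarrow> J = \<mm>"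

section \<open>Submodules and quotient modules\<close>

text \<open>For a submodule \<open>N\<close> of \<open>M\<close>, the module \<open>N\<close> itself is \<open>M\<lparr>carrier := N\<rparr>\<close>.\<close>

definition gen_submodule ::
    "('a, 'r) ring_scheme \<Rightarrow> ('a, 'b, 'm) module_scheme \<Rightarrow> 'b set \<Rightarrow> 'b set" where
  "gen_submodule R M A = \<Inter> {N. submodule N R M \<and> A \<subseteq> N}"

definition fin_gen_module :: "('a, 'r) ring_scheme \<Rightarrow> ('a, 'b, 'm) module_scheme \<Rightarrow> bool" where
  "fin_gen_module R M \<longleftrightarrow>
     module R M \<and> (\<exists>A \<subseteq> carrier M. finite A \<and> gen_submodule R M A = carrier M)"

text \<open>The submodule \<open>(x\<^sub>1, \<dots>, x\<^sub>n)M\<close>.\<close>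

definition seq_smult ::
    "('a, 'r) ring_scheme \<Rightarrow> ('a, 'b, 'm) module_scheme \<Rightarrow> 'a list \<Rightarrow> 'b set" where
  "seq_smult R M xs = gen_submodule R M {x \<odot>\<^bsub>M\<^esub> m | x m. x \<in> set xs \<and> m \<in> carrier M}"

text \<open>The record type of modules inherits the fields \<open>mult\<close> and \<open>one\<close> from rings; they play no
  role for modules and are left unspecified.\<close>

definition quotient_module ::
    "('a, 'b, 'm) module_scheme \<Rightarrow> 'b set \<Rightarrow> ('a, 'b set) module" where
  "quotient_module M N =
     \<lparr>carrier = a_rcosets\<^bsub>M\<^esub> N, monoid.mult = undefined, one = undefined,
      zero = N, add = set_add M, smult = (\<lambda>a C. \<Union>m\<in>C. N +>\<^bsub>M\<^esub> (a \<odot>\<^bsub>M\<^esub> m))\<rparr>"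

section \<open>Length and dimension\<close>

definition module_length :: "('a, 'r) ring_scheme \<Rightarrow> ('a, 'b, 'm) module_scheme \<Rightarrow> enat" where
  "module_length R M =
     Sup {enat n | n. \<exists>N. (\<forall>i\<le>n. submodule (N i) R M) \<and> (\<forall>i<n. N i \<subset> N (Suc i))}"

text \<open>The length as an integer; only meaningful for modules of finite length.\<close>

definition int_length :: "('a, 'r) ring_scheme \<Rightarrow> ('a, 'b, 'm) module_scheme \<Rightarrow> int" where
  "int_length R M = int (the_enat (module_length R M))"

definition annihilator :: "('a, 'r) ring_scheme \<Rightarrow> ('a, 'b, 'm) module_scheme \<Rightarrow> 'a set" where
  "annihilator R M = {a \<in> carrier R. \<forall>m \<in> carrier M. a \<odot>\<^bsub>M\<^esub> m = \<zero>\<^bsub>M\<^esub>}"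

text \<open>The Krull dimension of \<open>R / Ann M\<close>, as the supremum of the lengths of chains of prime ideals
  of \<open>R\<close> containing \<open>Ann M\<close>. There are no such primes exactly if \<open>M\<close> is zero, which gives
  dimension \<open>-1\<close>. The value is an extended real so that the supremum always makes sense.\<close>

definition module_dim :: "('a, 'r) ring_scheme \<Rightarrow> ('a, 'b, 'm) module_scheme \<Rightarrow> ereal" where
  "module_dim R M =
     Sup (insert (- 1) {ereal (real n) | n. \<exists>P.
       (\<forall>i\<le>n. primeideal (P i) R \<and> annihilator R M \<subseteq> P i) \<and> (\<forall>i<n. P i \<subset> P (Suc i))})"

text \<open>The (finite) dimension as a natural number, where the zero module gets the value \<open>0\<close>.\<close>

definition nat_dim :: "('a, 'r) ring_scheme \<Rightarrow> ('a, 'b, 'm) module_scheme \<Rightarrow> nat" where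
  "nat_dim R M = nat \<lfloor>real_of_ereal (module_dim R M)\<rfloor>"

section \<open>Systems of parameters and Serre multiplicity\<close>

definition system_of_parameters ::
    "('a, 'r) ring_scheme \<Rightarrow> 'a set \<Rightarrow> ('a, 'b, 'm) module_scheme \<Rightarrow> 'a list \<Rightarrow> bool" where
  "system_of_parameters R \<mm> M xs \<longleftrightarrow>
     set xs \<subseteq> \<mm> \<and> ereal (real (length xs)) = module_dim R M \<and>
     module_length R (quotient_module M (seq_smult R M xs)) < \<infinity>"

text \<open>The Koszul complex \<open>K(x\<^sub>0, \<dots>, x\<^sub>n\<^sub>-\<^sub>1; M)\<close>. An element \<open>\<Sum> f\<^sub>S e\<^sub>S\<close> of its component of degree
  \<open>p\<close>, with \<open>S\<close> running over the \<open>p\<close>-element subsets of \<open>{0, \<dots>, n - 1}\<close>, is represented by the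
  family of its coefficients \<open>f\<^sub>S\<close> in \<open>M\<close>.\<close>

definition koszul_index :: "nat \<Rightarrow> nat \<Rightarrow> nat set set" where
  "koszul_index n p = {S. S \<subseteq> {..<n} \<and> card S = p}"

definition koszul_module ::
    "('a, 'b, 'm) module_scheme \<Rightarrow> nat \<Rightarrow> nat \<Rightarrow> ('a, nat set \<Rightarrow> 'b) module" where
  "koszul_module M n p =
     \<lparr>carrier = koszul_index n p \<rightarrow>\<^sub>E carrier M, monoid.mult = undefined, one = undefined,
      zero = (\<lambda>S \<in> koszul_index n p. \<zero>\<^bsub>M\<^esub>),
      add = (\<lambda>f g. \<lambda>S \<in> koszul_index n p. f S \<oplus>\<^bsub>M\<^esub> g S),
      smult = (\<lambda>a f. \<lambda>S \<in> koszul_index n p. a \<odot>\<^bsub>M\<^esub> f S)\<rparr>"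

text \<open>The coefficient at \<open>e\<^sub>T\<close> of the differential of \<open>\<Sum> f\<^sub>S e\<^sub>S\<close>, where
  \<open>d(e\<^sub>S) = \<Sum>\<^sub>j\<^sub>\<in>\<^sub>S (-1)\<^sup>k x\<^sub>j e\<^sub>S\<^sub>-\<^sub>{\<^sub>j\<^sub>}\<close> with \<open>k\<close> the number of elements of \<open>S\<close> smaller than \<open>j\<close>.\<close>

definition koszul_coeff ::
    "('a, 'r) ring_scheme \<Rightarrow> ('a, 'b, 'm) module_scheme \<Rightarrow> 'a list \<Rightarrow> (nat set \<Rightarrow> 'b) \<Rightarrow> nat set \<Rightarrow> 'b"
  where
  "koszul_coeff R M xs f T =
     (\<Oplus>\<^bsub>M\<^esub> j \<in> {..<length xs} - T.
        (((\<ominus>\<^bsub>R\<^esub> \<one>\<^bsub>R\<^esub>) [^]\<^bsub>R\<^esub> card {i \<in> T. i < j}) \<otimes>\<^bsub>R\<^esub> xs ! j) \<odot>\<^bsub>M\<^esub> f (insert j T))"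

text \<open>In degree \<open>0\<close> the condition is vacuous, so every element is a cycle.\<close>

definition koszul_cycles ::
    "('a, 'r) ring_scheme \<Rightarrow> ('a, 'b, 'm) module_scheme \<Rightarrow> 'a list \<Rightarrow> nat \<Rightarrow> (nat set \<Rightarrow> 'b) set" where
  "koszul_cycles R M xs p =
     {f \<in> carrier (koszul_module M (length xs) p).
        \<forall>T \<subseteq> {..<length xs}. Suc (card T) = p \<longrightarrow> koszul_coeff R M xs f T = \<zero>\<^bsub>M\<^esub>}"

definition koszul_boundaries ::
    "('a, 'r) ring_scheme \<Rightarrow> ('a, 'b, 'm) module_scheme \<Rightarrow> 'a list \<Rightarrow> nat \<Rightarrow> (nat set \<Rightarrow> 'b) set" where
  "koszul_boundaries R M xs p =
     (\<lambda>f. \<lambda>T \<in> koszul_index (length xs) p. koszul_coeff R M xs f T) `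
       carrier (koszul_module M (length xs) (Suc p))"

definition koszul_homology ::
    "('a, 'r) ring_scheme \<Rightarrow> ('a, 'b, 'm) module_scheme \<Rightarrow> 'a list \<Rightarrow> nat \<Rightarrow>
       ('a, (nat set \<Rightarrow> 'b) set) module" where
  "koszul_homology R M xs p =
     quotient_module ((koszul_module M (length xs) p)\<lparr>carrier := koszul_cycles R M xs p\<rparr>)
       (koszul_boundaries R M xs p)"

text \<open>Serre's multiplicity is the Euler characteristic of the Koszul homology. In particular it is
  the length of \<open>M\<close> for the empty sequence, and hence \<open>0\<close> for \<open>M = 0\<close>.\<close>

definition serre_mult ::
    "('a, 'r) ring_scheme \<Rightarrow> ('a, 'b, 'm) module_scheme \<Rightarrow> 'a list \<Rightarrow> int" where
  "serre_mult R M xs =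
     (\<Sum>p \<le> length xs. (- 1) ^ p * int_length R (koszul_homology R M xs p))"

section \<open>Generalized Cohen-Macaulay modules and filtrations\<close>

definition gcm_invariant ::
    "('a, 'r) ring_scheme \<Rightarrow> 'a set \<Rightarrow> ('a, 'b, 'm) module_scheme \<Rightarrow> ereal" where
  "gcm_invariant R \<mm> N =
     (SUP ys \<in> {ys. system_of_parameters R \<mm> N ys}.
        ereal (of_int (int_length R (quotient_module N (seq_smult R N ys)) - serre_mult R N ys)))"

definition generalized_CM ::
    "('a, 'r) ring_scheme \<Rightarrow> 'a set \<Rightarrow> ('a, 'b, 'm) module_scheme \<Rightarrow> bool" where
  "generalized_CM R \<mm> N \<longleftrightarrow> fin_gen_module R N \<and> gcm_invariant R \<mm> N < \<infinity>"

text \<open>A filtration \<open>M\<^sub>0 \<subset> \<dots> \<subset> M\<^sub>t = M\<close> is given by \<open>t\<close> and the function \<open>F i = M\<^sub>i\<close>, whose values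
  for \<open>i > t\<close> are irrelevant.\<close>

definition filtration ::
    "('a, 'r) ring_scheme \<Rightarrow> ('a, 'b, 'm) module_scheme \<Rightarrow> nat \<Rightarrow> (nat \<Rightarrow> 'b set) \<Rightarrow> bool" where
  "filtration R M t F \<longleftrightarrow>
     (\<forall>i\<le>t. submodule (F i) R M) \<and> (\<forall>i<t. F i \<subset> F (Suc i)) \<and> F t = carrier M"

definition dimension_condition ::
    "('a, 'r) ring_scheme \<Rightarrow> ('a, 'b, 'm) module_scheme \<Rightarrow> nat \<Rightarrow> (nat \<Rightarrow> 'b set) \<Rightarrow> bool" where
  "dimension_condition R M t F \<longleftrightarrow>
     (\<forall>i<t. module_dim R (M\<lparr>carrier := F i\<rparr>) < module_dim R (M\<lparr>carrier := F (Suc i)\<rparr>))"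

text \<open>The last conjunct is the convention \<open>dim M\<^sub>1 > 0\<close>; the trivial filtration \<open>t = 0\<close> of a module
  of dimension at most \<open>0\<close> is not excluded.\<close>

definition gcm_filtration ::
    "('a, 'r) ring_scheme \<Rightarrow> 'a set \<Rightarrow> ('a, 'b, 'm) module_scheme \<Rightarrow> nat \<Rightarrow> (nat \<Rightarrow> 'b set) \<Rightarrow> bool"
  where
  "gcm_filtration R \<mm> M t F \<longleftrightarrow>
     filtration R M t F \<and> dimension_condition R M t F \<and>
     module_dim R (M\<lparr>carrier := F 0\<rparr>) \<le> 0 \<and>
     (\<forall>i<t. generalized_CM R \<mm> (quotient_module (M\<lparr>carrier := F (Suc i)\<rparr>) (F i))) \<and>
     (t \<ge> 1 \<longrightarrow> module_dim R (M\<lparr>carrier := F 1\<rparr>) > 0)"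

definition sequentially_generalized_CM ::
    "('a, 'r) ring_scheme \<Rightarrow> 'a set \<Rightarrow> ('a, 'b, 'm) module_scheme \<Rightarrow> bool" where
  "sequentially_generalized_CM R \<mm> M \<longleftrightarrow> (\<exists>t F. gcm_filtration R \<mm> M t F)"

definition good_system_of_parameters ::
    "('a, 'r) ring_scheme \<Rightarrow> 'a set \<Rightarrow> ('a, 'b, 'm) module_scheme \<Rightarrow> nat \<Rightarrow> (nat \<Rightarrow> 'b set) \<Rightarrow>
       'a list \<Rightarrow> bool" where
  "good_system_of_parameters R \<mm> M t F xs \<longleftrightarrow>
     system_of_parameters R \<mm> M xs \<and>
     (\<forall>i<t. F i \<inter> seq_smult R M (drop (nat_dim R (M\<lparr>carrier := F i\<rparr>)) xs) = {\<zero>\<^bsub>M\<^esub>})"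

definition filtration_invariant ::
    "('a, 'r) ring_scheme \<Rightarrow> ('a, 'b, 'm) module_scheme \<Rightarrow> nat \<Rightarrow> (nat \<Rightarrow> 'b set) \<Rightarrow> 'a list \<Rightarrow> int" where
  "filtration_invariant R M t F xs =
     int_length R (quotient_module M (seq_smult R M xs)) -
     (\<Sum>i\<le>t. serre_mult R (M\<lparr>carrier := F i\<rparr>) (take (nat_dim R (M\<lparr>carrier := F i\<rparr>)) xs))"

definition power_seq :: "('a, 'r) ring_scheme \<Rightarrow> 'a list \<Rightarrow> nat list \<Rightarrow> 'a list" where
  "power_seq R xs ns = map2 (\<lambda>x n. x [^]\<^bsub>R\<^esub> n) xs ns"

end

theory Submission
  imports Defs
begin

text \<open>Writing \<open>D\<^sub>i = M\<^sub>i / M\<^sub>i\<^sub>-\<^sub>1\<close>, the invariant is bounded by \<open>\<Sum> I(D\<^sub>i)\<close>: the length of \<open>M / xM\<close> is at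
  most the sum of the lengths of the \<open>D\<^sub>i / xD\<^sub>i\<close>, and \<open>e(x\<^sub>1, \<dots>, x\<^sub>d\<^sub>i; M\<^sub>i) = e(x\<^sub>1, \<dots>, x\<^sub>d\<^sub>i; D\<^sub>i)\<close> because one
  of these parameters kills \<open>M\<^sub>i\<^sub>-\<^sub>1\<close>. A bounded integer-valued function that is nondecreasing in every
  \<open>n\<^sub>j\<close> is eventually constant, so it remains to see that the invariant is nondecreasing. If \<open>x'\<close> is
  the sequence of the parameters other than \<open>x\<^sub>j\<close>, then \<open>\<ell>(M / (x', x\<^sub>j\<^sup>n)M) = n e(x\<^sub>j; M / x'M) + \<ell>(0 : x\<^sub>j\<^sup>n)\<close>
  on \<open>M / x'M\<close>, while the multiplicities with \<open>j \<le> d\<^sub>i\<close> are linear in \<open>n\<close> and the others do not depend on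
  it; so one needs \<open>e(x\<^sub>j; M / x'M) \<ge> \<Sum>\<^sub>j\<^sub>\<le>\<^sub>d\<^sub>i e(x\<^sub>1, \<dots>, x\<^sub>d\<^sub>i; M\<^sub>i)\<close>. This follows by dividing out
  \<open>x\<^sub>d, x\<^sub>d\<^sub>-\<^sub>1, \<dots>\<close> one after the other: when \<open>x\<^sub>k\<close> is divided out, the multiplicity grows by that of
  \<open>0 : x\<^sub>k\<close> on \<open>M / (x\<^sub>k\<^sub>+\<^sub>1, \<dots>, x\<^sub>d)M\<close>, which contains the \<open>M\<^sub>i\<close> with \<open>d\<^sub>i = k - 1\<close> since the system is good.\<close>

section \<open>The lattice of submodules\<close>

text \<open>Koszul homology consists of cosets of families of elements, so every passage to homology
  changes the type. What the argument uses about multiplicities is additivity, linearity in powers,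
  independence of the order and nonnegativity, and these make sense for all subquotients
  \<open>A / B\<close> of one fixed module. They are proved for the recursively defined
  \<open>emult\<close>, by induction on the parameters, as identities between submodules; the Koszul
  complex enters only in \<open>koszul_emult\<close>, which identifies the recursion with the Euler
  characteristic.

  The obstacle is that additivity needs finite lengths at the end of the recursion, while finite
  length of \<open>A / (B + xs A)\<close> is not visibly inherited by submodules of
  \<open>A / B\<close>. Therefore all inductions carry the predicate \<open>good\<close>: a power of
  each element of \<open>\<mm>\<close> lies in \<open>(xs) + Ann (A / B)\<close>. A substitute for
  the determinant trick derives it once, for \<open>M\<close> itself. Since \<open>good\<close> does
  not prescribe the number of parameters, a module may carry too many of them; if one of them kills
  the module, the multiplicity vanishes by \<open>emult_kill\<close>.\<close>

definition scale :: "('a, 'b, 'm) module_scheme \<Rightarrow> 'a \<Rightarrow> 'b set \<Rightarrow> 'b set" where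
  "scale M x A = (\<lambda>a. x \<odot>\<^bsub>M\<^esub> a) ` A"

text \<open>For \<open>B\<close> inside \<open>A\<close> this is, modulo \<open>B\<close>, the
  kernel of \<open>x\<close> on \<open>A / B\<close>, just as \<open>B + x A\<close> yields the
  cokernel.\<close>

definition colon :: "('a, 'b, 'm) module_scheme \<Rightarrow> 'a \<Rightarrow> 'b set \<Rightarrow> 'b set \<Rightarrow> 'b set" where
  "colon M x A B = {a \<in> A. x \<odot>\<^bsub>M\<^esub> a \<in> B}"

lemma colon_subset: "colon M x A B \<subseteq> A"
  by (auto simp: colon_def)

lemma colon_mono: "A \<subseteq> A' \<Longrightarrow> B \<subseteq> B' \<Longrightarrow> colon M x A B \<subseteq> colon M x A' B'"
  by (auto simp: colon_def)

lemma colon_Int: "C \<subseteq> A \<Longrightarrow> colon M x A B \<inter> C = colon M x C B"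
  by (auto simp: colon_def)

lemma scale_mono: "A \<subseteq> A' \<Longrightarrow> scale M x A \<subseteq> scale M x A'"
  by (auto simp: scale_def)

lemma scale_colon: "scale M x (colon M x A B) = scale M x A \<inter> B"
  by (auto simp: colon_def scale_def)

lemma set_add_iff: "z \<in> A <+>\<^bsub>M\<^esub> B \<longleftrightarrow> (\<exists>a\<in>A. \<exists>b\<in>B. z = a \<oplus>\<^bsub>M\<^esub> b)"
  by (auto simp: set_add_def' )

lemma set_addI: "a \<in> A \<Longrightarrow> b \<in> B \<Longrightarrow> a \<oplus>\<^bsub>M\<^esub> b \<in> A <+>\<^bsub>M\<^esub> B"
  unfolding set_add_iff by blast

lemma set_addE:
  assumes "z \<in> A <+>\<^bsub>M\<^esub> B"
  obtains a b where "a \<in> A" "b \<in> B" "z = a \<oplus>\<^bsub>M\<^esub> b"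
  using assms unfolding set_add_iff by blast

lemma set_add_mono: "A \<subseteq> A' \<Longrightarrow> B \<subseteq> B' \<Longrightarrow> A <+>\<^bsub>M\<^esub> B \<subseteq> A' <+>\<^bsub>M\<^esub> B'"
  unfolding subset_iff set_add_iff by blast

context module
begin

abbreviation subm :: "'c set \<Rightarrow> bool" where "subm A \<equiv> submodule A R M"

lemma subm_carrier: "subm A \<Longrightarrow> a \<in> A \<Longrightarrow> a \<in> carrier M"
  using submoduleE(1) by blast

lemma subm_sub: "subm A \<Longrightarrow> A \<subseteq> carrier M"
  by (rule submoduleE(1))

lemma subm_zero: "subm A \<Longrightarrow> \<zero>\<^bsub>M\<^esub> \<in> A"
  using submodule.axioms(1) subgroup.one_closed by fastforce

lemma subm_add: "subm A \<Longrightarrow> a \<in> A \<Longrightarrow> b \<in> A \<Longrightarrow> a \<oplus>\<^bsub>M\<^esub> b \<in> A"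
  by (rule submoduleE(5))

lemma subm_neg: "subm A \<Longrightarrow> a \<in> A \<Longrightarrow> \<ominus>\<^bsub>M\<^esub> a \<in> A"
  by (rule submoduleE(3))

lemma subm_minus: "subm A \<Longrightarrow> a \<in> A \<Longrightarrow> b \<in> A \<Longrightarrow> a \<ominus>\<^bsub>M\<^esub> b \<in> A"
  unfolding a_minus_def by (intro subm_add subm_neg)

lemma subm_smult: "subm A \<Longrightarrow> r \<in> carrier R \<Longrightarrow> a \<in> A \<Longrightarrow> r \<odot>\<^bsub>M\<^esub> a \<in> A"
  by (rule submoduleE(4))

lemmas subm_rules = subm_zero subm_add subm_neg subm_minus subm_smult

lemma subm_eq_minus:
  assumes "a = b \<oplus>\<^bsub>M\<^esub> c" "b \<in> carrier M" "c \<in> carrier M"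
  shows "b = a \<ominus>\<^bsub>M\<^esub> c" "c = a \<ominus>\<^bsub>M\<^esub> b"
proof -
  show "b = a \<ominus>\<^bsub>M\<^esub> c" using assms by (simp add: a_minus_def M.a_assoc M.r_neg)
  have "a = c \<oplus>\<^bsub>M\<^esub> b" using assms M.a_comm by simp
  then show "c = a \<ominus>\<^bsub>M\<^esub> b" using assms(2,3) by (simp add: a_minus_def M.a_assoc M.r_neg)
qed

lemma subm_cancel:
  assumes "subm A" "a \<oplus>\<^bsub>M\<^esub> b \<in> A" "b \<in> A" "a \<in> carrier M"
  shows "a \<in> A"
  using assms subm_eq_minus(1)[of "a \<oplus>\<^bsub>M\<^esub> b" a b] subm_minus subm_carrier by metis

lemma subm_cancel':
  assumes "subm A" "a \<oplus>\<^bsub>M\<^esub> b \<in> A" "a \<in> A" "b \<in> carrier M"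
  shows "b \<in> A"
  using assms subm_cancel M.a_comm subm_carrier by metis

lemma smult_minus_distr:
  "r \<in> carrier R \<Longrightarrow> a \<in> carrier M \<Longrightarrow> b \<in> carrier M \<Longrightarrow>
    r \<odot>\<^bsub>M\<^esub> (a \<ominus>\<^bsub>M\<^esub> b) = r \<odot>\<^bsub>M\<^esub> a \<ominus>\<^bsub>M\<^esub> r \<odot>\<^bsub>M\<^esub> b"
  by (simp add: a_minus_def smult_r_distr smult_r_minus)

lemma smult_swap:
  "r \<in> carrier R \<Longrightarrow> s \<in> carrier R \<Longrightarrow> a \<in> carrier M \<Longrightarrow> r \<odot>\<^bsub>M\<^esub> (s \<odot>\<^bsub>M\<^esub> a) = s \<odot>\<^bsub>M\<^esub> (r \<odot>\<^bsub>M\<^esub> a)"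
  by (metis smult_assoc1 R.m_comm)

lemma add4:
  assumes "a \<in> carrier M" "b \<in> carrier M" "c \<in> carrier M" "d \<in> carrier M"
  shows "(a \<oplus>\<^bsub>M\<^esub> b) \<oplus>\<^bsub>M\<^esub> (c \<oplus>\<^bsub>M\<^esub> d) = (a \<oplus>\<^bsub>M\<^esub> c) \<oplus>\<^bsub>M\<^esub> (b \<oplus>\<^bsub>M\<^esub> d)"
  using assms by (simp add: M.a_ac)

lemma subm_set_add:
  assumes A: "subm A" and B: "subm B"
  shows "subm (A <+>\<^bsub>M\<^esub> B)"
proof (rule submoduleI)
  show "A <+>\<^bsub>M\<^esub> B \<subseteq> carrier M"
    using subm_carrier[OF A] subm_carrier[OF B] by (auto simp: set_add_iff)
  show "\<zero>\<^bsub>M\<^esub> \<in> A <+>\<^bsub>M\<^esub> B"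
    unfolding set_add_iff using subm_zero[OF A] subm_zero[OF B] by (metis M.l_zero M.zero_closed)
next
  fix z assume "z \<in> A <+>\<^bsub>M\<^esub> B"
  then obtain a b where "a \<in> A" "b \<in> B" "z = a \<oplus>\<^bsub>M\<^esub> b" by (auto simp: set_add_iff)
  moreover from this have "\<ominus>\<^bsub>M\<^esub> z = \<ominus>\<^bsub>M\<^esub> a \<oplus>\<^bsub>M\<^esub> \<ominus>\<^bsub>M\<^esub> b"
    using A B subm_carrier M.minus_add by auto
  ultimately show "\<ominus>\<^bsub>M\<^esub> z \<in> A <+>\<^bsub>M\<^esub> B"
    unfolding set_add_iff using A B subm_neg by blast
next
  fix z w assume "z \<in> A <+>\<^bsub>M\<^esub> B" "w \<in> A <+>\<^bsub>M\<^esub> B"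
  then obtain a b c d where "a \<in> A" "b \<in> B" "z = a \<oplus>\<^bsub>M\<^esub> b" "c \<in> A" "d \<in> B" "w = c \<oplus>\<^bsub>M\<^esub> d"
    by (auto simp: set_add_iff)
  moreover from this have "z \<oplus>\<^bsub>M\<^esub> w = (a \<oplus>\<^bsub>M\<^esub> c) \<oplus>\<^bsub>M\<^esub> (b \<oplus>\<^bsub>M\<^esub> d)"
    using A B subm_carrier add4 by auto
  ultimately show "z \<oplus>\<^bsub>M\<^esub> w \<in> A <+>\<^bsub>M\<^esub> B"
    unfolding set_add_iff using A B subm_add by blast
next
  fix r z assume r: "r \<in> carrier R" and "z \<in> A <+>\<^bsub>M\<^esub> B"
  then obtain a b where "a \<in> A" "b \<in> B" "z = a \<oplus>\<^bsub>M\<^esub> b" by (auto simp: set_add_iff)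
  moreover from this have "r \<odot>\<^bsub>M\<^esub> z = r \<odot>\<^bsub>M\<^esub> a \<oplus>\<^bsub>M\<^esub> r \<odot>\<^bsub>M\<^esub> b"
    using A B r subm_carrier smult_r_distr by auto
  ultimately show "r \<odot>\<^bsub>M\<^esub> z \<in> A <+>\<^bsub>M\<^esub> B"
    unfolding set_add_iff using A B r subm_smult by blast
qed

lemma subm_Int: "subm A \<Longrightarrow> subm B \<Longrightarrow> subm (A \<inter> B)"
  by (rule submoduleI) (auto intro: subm_rules subm_carrier)

lemma subm_scale:
  assumes x: "x \<in> carrier R" and A: "subm A"
  shows "subm (scale M x A)"
proof (rule submoduleI)
  show "scale M x A \<subseteq> carrier M"
    using A x by (auto simp: scale_def subm_carrier)
  have "x \<odot>\<^bsub>M\<^esub> \<zero>\<^bsub>M\<^esub> \<in> scale M x A" unfolding scale_def using subm_zero[OF A] by blast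
  then show "\<zero>\<^bsub>M\<^esub> \<in> scale M x A" using x by simp
next
  fix z assume "z \<in> scale M x A"
  then obtain a where "a \<in> A" "z = x \<odot>\<^bsub>M\<^esub> a" by (auto simp: scale_def)
  moreover from this have "\<ominus>\<^bsub>M\<^esub> z = x \<odot>\<^bsub>M\<^esub> \<ominus>\<^bsub>M\<^esub> a"
    using A x subm_carrier smult_r_minus by auto
  ultimately show "\<ominus>\<^bsub>M\<^esub> z \<in> scale M x A"
    unfolding scale_def using subm_neg[OF A] by blast
next
  fix z w assume "z \<in> scale M x A" "w \<in> scale M x A"
  then obtain a b where "a \<in> A" "z = x \<odot>\<^bsub>M\<^esub> a" "b \<in> A" "w = x \<odot>\<^bsub>M\<^esub> b" by (auto simp: scale_def)
  moreover from this have "z \<oplus>\<^bsub>M\<^esub> w = x \<odot>\<^bsub>M\<^esub> (a \<oplus>\<^bsub>M\<^esub> b)"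
    using A x subm_carrier smult_r_distr by auto
  ultimately show "z \<oplus>\<^bsub>M\<^esub> w \<in> scale M x A"
    unfolding scale_def using subm_add[OF A] by blast
next
  fix r z assume r: "r \<in> carrier R" and "z \<in> scale M x A"
  then obtain a where "a \<in> A" "z = x \<odot>\<^bsub>M\<^esub> a" by (auto simp: scale_def)
  moreover from this have "r \<odot>\<^bsub>M\<^esub> z = x \<odot>\<^bsub>M\<^esub> (r \<odot>\<^bsub>M\<^esub> a)"
    using A x r subm_carrier smult_swap by auto
  ultimately show "r \<odot>\<^bsub>M\<^esub> z \<in> scale M x A"
    unfolding scale_def using subm_smult[OF A r] by blast
qed

lemma subm_colon:
  assumes x: "x \<in> carrier R" and A: "subm A" and B: "subm B"
  shows "subm (colon M x A B)"
proof (rule submoduleI)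
  fix r z assume r: "r \<in> carrier R" and "z \<in> colon M x A B"
  then show "r \<odot>\<^bsub>M\<^esub> z \<in> colon M x A B"
    using A B x by (auto simp: colon_def smult_swap[of x r] subm_carrier intro: subm_rules)
qed (use A B x in \<open>auto simp: colon_def smult_r_distr smult_r_minus subm_carrier subm_rules\<close>)

lemma subm_zero_set: "subm {\<zero>\<^bsub>M\<^esub>}"
  by (rule submoduleI) auto

lemmas subm_intros = subm_set_add subm_Int subm_scale subm_colon subm_zero_set carrier_is_submodule

lemma scale_subset: "x \<in> carrier R \<Longrightarrow> subm A \<Longrightarrow> scale M x A \<subseteq> A"
  by (auto simp: scale_def intro: subm_rules)

lemma set_add_comm: "subm A \<Longrightarrow> subm B \<Longrightarrow> A <+>\<^bsub>M\<^esub> B = B <+>\<^bsub>M\<^esub> A"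
  unfolding set_eq_iff set_add_iff by (metis M.a_comm subm_carrier)

lemma set_add_assoc: 
  assumes "subm A" "subm B" "subm C"
  shows "(A <+>\<^bsub>M\<^esub> B) <+>\<^bsub>M\<^esub> C = A <+>\<^bsub>M\<^esub> (B <+>\<^bsub>M\<^esub> C)"
proof -
  have *: "a \<in> A \<Longrightarrow> b \<in> B \<Longrightarrow> c \<in> C \<Longrightarrow> (a \<oplus>\<^bsub>M\<^esub> b) \<oplus>\<^bsub>M\<^esub> c = a \<oplus>\<^bsub>M\<^esub> (b \<oplus>\<^bsub>M\<^esub> c)" for a b c
    using assms by (simp add: M.a_assoc subm_carrier)
  show ?thesis
  proof (intro subset_antisym subsetI)
    fix z assume "z \<in> (A <+>\<^bsub>M\<^esub> B) <+>\<^bsub>M\<^esub> C"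
    then show "z \<in> A <+>\<^bsub>M\<^esub> (B <+>\<^bsub>M\<^esub> C)" by (elim set_addE) (simp add: * set_addI)
  next
    fix z assume "z \<in> A <+>\<^bsub>M\<^esub> (B <+>\<^bsub>M\<^esub> C)"
    then show "z \<in> (A <+>\<^bsub>M\<^esub> B) <+>\<^bsub>M\<^esub> C" by (elim set_addE) (simp add: *[symmetric] set_addI)
  qed
qed

lemma set_add_upper1: "subm A \<Longrightarrow> subm B \<Longrightarrow> A \<subseteq> A <+>\<^bsub>M\<^esub> B"
  unfolding subset_iff set_add_iff using subm_zero subm_carrier M.r_zero by metis

lemma set_add_upper2: "subm A \<Longrightarrow> subm B \<Longrightarrow> B \<subseteq> A <+>\<^bsub>M\<^esub> B"
  using set_add_upper1 set_add_comm by metis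

lemma set_add_least: "subm C \<Longrightarrow> A \<subseteq> C \<Longrightarrow> B \<subseteq> C \<Longrightarrow> A <+>\<^bsub>M\<^esub> B \<subseteq> C"
  unfolding subset_iff set_add_iff using subm_add by metis

lemma set_add_absorb1: "subm A \<Longrightarrow> subm B \<Longrightarrow> A \<subseteq> B \<Longrightarrow> A <+>\<^bsub>M\<^esub> B = B"
  by (meson order.refl set_add_least set_add_upper2 subset_antisym)

lemma set_add_absorb2: "subm A \<Longrightarrow> subm B \<Longrightarrow> B \<subseteq> A \<Longrightarrow> A <+>\<^bsub>M\<^esub> B = A"
  by (meson order.refl set_add_least set_add_upper1 subset_antisym)

lemma modular_law:
  assumes "subm A" "subm B" "subm C" "C \<subseteq> A"
  shows "A \<inter> (B <+>\<^bsub>M\<^esub> C) = (A \<inter> B) <+>\<^bsub>M\<^esub> C"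
proof
  show "A \<inter> (B <+>\<^bsub>M\<^esub> C) \<subseteq> (A \<inter> B) <+>\<^bsub>M\<^esub> C"
  proof
    fix z assume "z \<in> A \<inter> (B <+>\<^bsub>M\<^esub> C)"
    then obtain b c where z: "b \<in> B" "c \<in> C" "z = b \<oplus>\<^bsub>M\<^esub> c" "b \<oplus>\<^bsub>M\<^esub> c \<in> A"
      by (auto simp: set_add_iff)
    then have "b \<in> A" using subm_cancel[OF assms(1) z(4)] assms subm_carrier by blast
    then show "z \<in> (A \<inter> B) <+>\<^bsub>M\<^esub> C" unfolding set_add_iff using z by blast
  qed
  show "(A \<inter> B) <+>\<^bsub>M\<^esub> C \<subseteq> A \<inter> (B <+>\<^bsub>M\<^esub> C)"
    using assms by (auto elim!: set_addE intro: subm_add set_addI)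
qed

lemma scale_set_add:
  assumes "x \<in> carrier R" "subm A" "subm B"
  shows "scale M x (A <+>\<^bsub>M\<^esub> B) = scale M x A <+>\<^bsub>M\<^esub> scale M x B"
proof -
  have *: "a \<in> A \<Longrightarrow> b \<in> B \<Longrightarrow> x \<odot>\<^bsub>M\<^esub> (a \<oplus>\<^bsub>M\<^esub> b) = x \<odot>\<^bsub>M\<^esub> a \<oplus>\<^bsub>M\<^esub> x \<odot>\<^bsub>M\<^esub> b" for a b
    using assms by (simp add: smult_r_distr subm_carrier)
  show ?thesis
  proof (intro subset_antisym subsetI)
    fix z assume "z \<in> scale M x (A <+>\<^bsub>M\<^esub> B)"
    then obtain a b where "a \<in> A" "b \<in> B" "z = x \<odot>\<^bsub>M\<^esub> (a \<oplus>\<^bsub>M\<^esub> b)"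
      by (auto simp: scale_def set_add_iff)
    then show "z \<in> scale M x A <+>\<^bsub>M\<^esub> scale M x B"
      by (auto simp: scale_def set_add_iff * )
  next
    fix z assume "z \<in> scale M x A <+>\<^bsub>M\<^esub> scale M x B"
    then obtain a b where ab: "a \<in> A" "b \<in> B" "z = x \<odot>\<^bsub>M\<^esub> a \<oplus>\<^bsub>M\<^esub> x \<odot>\<^bsub>M\<^esub> b"
      by (auto simp: scale_def set_add_iff)
    then have "z = x \<odot>\<^bsub>M\<^esub> (a \<oplus>\<^bsub>M\<^esub> b)" "a \<oplus>\<^bsub>M\<^esub> b \<in> A <+>\<^bsub>M\<^esub> B"
      by (auto simp: set_add_iff * )
    then show "z \<in> scale M x (A <+>\<^bsub>M\<^esub> B)" by (auto simp: scale_def)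
  qed
qed

text \<open>If \<open>x z = b + x c\<close>, then \<open>x\<close> takes \<open>z - c\<close> into
  \<open>B\<close>. The identity computes kernels of multiplication maps between subquotients, for
  instance of the connecting map in \<open>emult_add\<close>.\<close>

lemma colon_add_scale:
  assumes x: "x \<in> carrier R" and A: "subm A" and B: "subm B" and C: "subm C" and CA: "C \<subseteq> A"
  shows "colon M x A (B <+>\<^bsub>M\<^esub> scale M x C) = colon M x A B <+>\<^bsub>M\<^esub> C"
proof
  show "colon M x A B <+>\<^bsub>M\<^esub> C \<subseteq> colon M x A (B <+>\<^bsub>M\<^esub> scale M x C)"
  proof
    fix z assume "z \<in> colon M x A B <+>\<^bsub>M\<^esub> C"
    then obtain a c where z: "a \<in> A" "x \<odot>\<^bsub>M\<^esub> a \<in> B" "c \<in> C" "z = a \<oplus>\<^bsub>M\<^esub> c"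
      by (auto simp: set_add_iff colon_def)
    then have "x \<odot>\<^bsub>M\<^esub> z = x \<odot>\<^bsub>M\<^esub> a \<oplus>\<^bsub>M\<^esub> x \<odot>\<^bsub>M\<^esub> c"
      using A C x by (simp add: smult_r_distr subm_carrier)
    with z show "z \<in> colon M x A (B <+>\<^bsub>M\<^esub> scale M x C)"
      using CA subm_add[OF A] by (auto simp: set_add_iff colon_def scale_def)
  qed
  show "colon M x A (B <+>\<^bsub>M\<^esub> scale M x C) \<subseteq> colon M x A B <+>\<^bsub>M\<^esub> C"
  proof
    fix z assume "z \<in> colon M x A (B <+>\<^bsub>M\<^esub> scale M x C)"
    then obtain b c where z: "z \<in> A" "b \<in> B" "c \<in> C" "x \<odot>\<^bsub>M\<^esub> z = b \<oplus>\<^bsub>M\<^esub> x \<odot>\<^bsub>M\<^esub> c"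
      by (auto simp: set_add_iff colon_def scale_def)
    have car: "z \<in> carrier M" "b \<in> carrier M" "c \<in> carrier M"
      using z A B C subm_carrier by auto
    have "x \<odot>\<^bsub>M\<^esub> (z \<ominus>\<^bsub>M\<^esub> c) = b"
      using subm_eq_minus(1)[OF z(4)] car x by (simp add: smult_minus_distr)
    then have "z \<ominus>\<^bsub>M\<^esub> c \<in> colon M x A B"
      using z CA subm_minus[OF A] by (auto simp: colon_def)
    moreover have "z = (z \<ominus>\<^bsub>M\<^esub> c) \<oplus>\<^bsub>M\<^esub> c"
      using car by (simp add: a_minus_def M.a_assoc M.l_neg)
    ultimately show "z \<in> colon M x A B <+>\<^bsub>M\<^esub> C"
      using z by (auto simp: set_add_iff)
  qed
qed

lemma scale_scale:
  "x \<in> carrier R \<Longrightarrow> y \<in> carrier R \<Longrightarrow> subm A \<Longrightarrow> scale M x (scale M y A) = scale M (x \<otimes> y) A"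
  by (auto simp: scale_def image_image smult_assoc1 subm_carrier intro!: image_cong)

lemma scale_comm:
  "x \<in> carrier R \<Longrightarrow> y \<in> carrier R \<Longrightarrow> subm A \<Longrightarrow> scale M x (scale M y A) = scale M y (scale M x A)"
  by (simp add: scale_scale R.m_comm)

lemma colon_colon:
  "x \<in> carrier R \<Longrightarrow> y \<in> carrier R \<Longrightarrow> subm A \<Longrightarrow>
    colon M y A (colon M x A B) = colon M (x \<otimes> y) A B"
  by (auto simp: colon_def smult_assoc1 subm_carrier subm_smult)

lemma subset_colon: "x \<in> carrier R \<Longrightarrow> subm B \<Longrightarrow> B \<subseteq> A \<Longrightarrow> B \<subseteq> colon M x A B"
  by (auto simp: colon_def intro: subm_smult)

end

section \<open>Isomorphic subquotients\<close>

text \<open>The map \<open>f\<close>, which need only be linear on \<open>A\<close>, induces an isomorphism from \<open>A / B\<close> onto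
  \<open>A' / B'\<close>.\<close>

definition sq_iso ::
    "('a, 'r) ring_scheme \<Rightarrow> ('a, 'b, 'm) module_scheme \<Rightarrow> ('a, 'c, 'k) module_scheme \<Rightarrow>
      ('b \<Rightarrow> 'c) \<Rightarrow> 'b set \<Rightarrow> 'b set \<Rightarrow> 'c set \<Rightarrow> 'c set \<Rightarrow> bool" where
  "sq_iso R M N f A B A' B' \<longleftrightarrow>
     module R M \<and> module R N \<and> submodule A R M \<and> submodule B R M \<and> B \<subseteq> A \<and>
     submodule A' R N \<and> submodule B' R N \<and> B' \<subseteq> A' \<and>
     (\<forall>a\<in>A. \<forall>b\<in>A. f (a \<oplus>\<^bsub>M\<^esub> b) = f a \<oplus>\<^bsub>N\<^esub> f b) \<and>
     (\<forall>r\<in>carrier R. \<forall>a\<in>A. f (r \<odot>\<^bsub>M\<^esub> a) = r \<odot>\<^bsub>N\<^esub> f a) \<and>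
     A' = f ` A <+>\<^bsub>N\<^esub> B' \<and> B = {a \<in> A. f a \<in> B'}"

lemma sq_isoD:
  assumes "sq_iso R M N f A B A' B'"
  shows "module R M" "module R N" "submodule A R M" "submodule B R M" "B \<subseteq> A"
    "submodule A' R N" "submodule B' R N" "B' \<subseteq> A'"
    "\<And>a b. a \<in> A \<Longrightarrow> b \<in> A \<Longrightarrow> f (a \<oplus>\<^bsub>M\<^esub> b) = f a \<oplus>\<^bsub>N\<^esub> f b"
    "\<And>r a. r \<in> carrier R \<Longrightarrow> a \<in> A \<Longrightarrow> f (r \<odot>\<^bsub>M\<^esub> a) = r \<odot>\<^bsub>N\<^esub> f a"
    "A' = f ` A <+>\<^bsub>N\<^esub> B'" "B = {a \<in> A. f a \<in> B'}"
  using assms unfolding sq_iso_def by auto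

lemma sq_isoI:
  assumes "module R M" "module R N" "submodule A R M" "submodule B R M"
    "submodule A' R N" "submodule B' R N"
    "\<And>a b. a \<in> A \<Longrightarrow> b \<in> A \<Longrightarrow> f (a \<oplus>\<^bsub>M\<^esub> b) = f a \<oplus>\<^bsub>N\<^esub> f b"
    "\<And>r a. r \<in> carrier R \<Longrightarrow> a \<in> A \<Longrightarrow> f (r \<odot>\<^bsub>M\<^esub> a) = r \<odot>\<^bsub>N\<^esub> f a"
    "A' = f ` A <+>\<^bsub>N\<^esub> B'" "B = {a \<in> A. f a \<in> B'}" "B' \<subseteq> A'"
  shows "sq_iso R M N f A B A' B'"
proof -
  have "B \<subseteq> A" using assms(10) by blast
  then show ?thesis unfolding sq_iso_def by (intro conjI ballI assms)
qed

text \<open>The definition does not say that \<open>f\<close> maps into the carrier of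
  \<open>N\<close>, so nothing can be cancelled yet. Instead \<open>f a = f a + f 0\<close>, where
  \<open>f 0\<close> lies in \<open>B'\<close> because \<open>0\<close> lies in \<open>B\<close>,
  and such sums make up \<open>A'\<close>.\<close>

lemma sq_iso_closed:
  assumes "sq_iso R M N f A B A' B'" and a: "a \<in> A"
  shows "f a \<in> A'"
proof -
  note D = sq_isoD[OF assms(1)]
  interpret M: module R M by (rule D)
  interpret N: module R N by (rule D)
  have "f \<zero>\<^bsub>M\<^esub> \<in> B'" using D(12) M.subm_zero[OF D(4)] by auto
  then have "f a \<oplus>\<^bsub>N\<^esub> f \<zero>\<^bsub>M\<^esub> \<in> A'" unfolding D(11) using a by (blast intro: set_addI)
  then show ?thesis
    using D(9)[OF a M.subm_zero[OF D(3)]] M.subm_carrier[OF D(3) a] by simp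
qed

text \<open>Together with \<open>sq_iso_vimage\<close> this is the correspondence between the
  submodules from \<open>B\<close> to \<open>A\<close> and those from \<open>B'\<close> to
  \<open>A'\<close>. The summand \<open>B'\<close> is there because \<open>f\<close> is onto
  \<open>A'\<close> only modulo \<open>B'\<close>.\<close>

lemma sq_iso_image:
  assumes iso: "sq_iso R M N f A B A' B'" and X: "submodule X R M" "X \<subseteq> A"
  shows "submodule (f ` X <+>\<^bsub>N\<^esub> B') R N" "B' \<subseteq> f ` X <+>\<^bsub>N\<^esub> B'" "f ` X <+>\<^bsub>N\<^esub> B' \<subseteq> A'"
    "B \<subseteq> X \<Longrightarrow> {a \<in> A. f a \<in> f ` X <+>\<^bsub>N\<^esub> B'} = X"
proof -
  note D = sq_isoD[OF iso]
  interpret M: module R M by (rule D)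
  interpret N: module R N by (rule D)
  have f: "f a \<in> carrier N" if "a \<in> A" for a
    using sq_iso_closed[OF iso that] N.subm_carrier D(6) by auto
  have z: "f \<zero>\<^bsub>M\<^esub> = \<zero>\<^bsub>N\<^esub>"
    using D(10)[of "\<zero>\<^bsub>R\<^esub>" "\<zero>\<^bsub>M\<^esub>"] M.subm_zero[OF D(3)] f by simp
  have neg: "f (\<ominus>\<^bsub>M\<^esub> a) = \<ominus>\<^bsub>N\<^esub> f a" if a: "a \<in> A" for a
  proof -
    have "f a \<oplus>\<^bsub>N\<^esub> f (\<ominus>\<^bsub>M\<^esub> a) = \<zero>\<^bsub>N\<^esub>"
      using D(9)[OF a M.subm_neg[OF D(3) a]] z M.subm_carrier[OF D(3) a] by (simp add: M.M.r_neg)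
    then show ?thesis using f[OF a] f[OF M.subm_neg[OF D(3) a]] 
      by (metis N.M.minus_equality N.M.a_comm)
  qed
  have sX: "submodule (f ` X) R N"
  proof (rule N.submoduleI)
    show "f ` X \<subseteq> carrier N" using f X by auto
    show "\<zero>\<^bsub>N\<^esub> \<in> f ` X" using z M.subm_zero[OF X(1)] by force
  next
    fix u assume "u \<in> f ` X"
    then show "\<ominus>\<^bsub>N\<^esub> u \<in> f ` X" using neg X M.subm_neg[OF X(1)] by (force simp: image_iff)
  next
    fix u v assume "u \<in> f ` X" "v \<in> f ` X"
    then show "u \<oplus>\<^bsub>N\<^esub> v \<in> f ` X" using D(9) X M.subm_add[OF X(1)] by (force simp: image_iff)
  next
    fix r u assume "r \<in> carrier R" "u \<in> f ` X"
    then show "r \<odot>\<^bsub>N\<^esub> u \<in> f ` X" using D(10) X M.subm_smult[OF X(1)] by (force simp: image_iff)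
  qed
  then show "submodule (f ` X <+>\<^bsub>N\<^esub> B') R N" using D(7) N.subm_set_add by auto
  show "B' \<subseteq> f ` X <+>\<^bsub>N\<^esub> B'" using sX D(7) N.set_add_upper2 by auto
  show "f ` X <+>\<^bsub>N\<^esub> B' \<subseteq> A'" unfolding D(11) using X by (intro set_add_mono image_mono) auto
  show "{a \<in> A. f a \<in> f ` X <+>\<^bsub>N\<^esub> B'} = X" if BX: "B \<subseteq> X"
  proof
    show "X \<subseteq> {a \<in> A. f a \<in> f ` X <+>\<^bsub>N\<^esub> B'}"
      using X N.set_add_upper1[OF sX D(7)] by auto
    show "{a \<in> A. f a \<in> f ` X <+>\<^bsub>N\<^esub> B'} \<subseteq> X"
    proof safe
      fix a assume a: "a \<in> A" "f a \<in> f ` X <+>\<^bsub>N\<^esub> B'"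
      then obtain u b where u: "u \<in> X" "b \<in> B'" "f a = f u \<oplus>\<^bsub>N\<^esub> b" by (auto simp: set_add_iff)
      then have uA: "u \<in> A" using X by auto
      have "f (a \<oplus>\<^bsub>M\<^esub> \<ominus>\<^bsub>M\<^esub> u) = f a \<oplus>\<^bsub>N\<^esub> \<ominus>\<^bsub>N\<^esub> f u"
        using D(9) neg uA a M.subm_neg[OF D(3) uA] by simp
      also have "\<dots> = b" using N.subm_eq_minus(2)[OF u(3)] f[OF uA] u(2) D(7) N.subm_carrier
        by (auto simp: a_minus_def)
      finally have "a \<oplus>\<^bsub>M\<^esub> \<ominus>\<^bsub>M\<^esub> u \<in> B"
        using D(12) u(2) M.subm_add[OF D(3)] M.subm_neg[OF D(3) uA] a by auto
      then show "a \<in> X" using BX u(1) X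
        by (metis M.subm_cancel M.subm_neg a(1) D(3) M.subm_carrier subsetD)
    qed
  qed
qed

lemma sq_iso_vimage:
  assumes iso: "sq_iso R M N f A B A' B'" and Y: "submodule Y R N" "B' \<subseteq> Y"
  shows "submodule {a \<in> A. f a \<in> Y} R M" "B \<subseteq> {a \<in> A. f a \<in> Y}"
    "Y \<subseteq> A' \<Longrightarrow> f ` {a \<in> A. f a \<in> Y} <+>\<^bsub>N\<^esub> B' = Y"
proof -
  note D = sq_isoD[OF iso]
  interpret M: module R M by (rule D)
  interpret N: module R N by (rule D)
  have f: "f a \<in> carrier N" if "a \<in> A" for a
    using sq_iso_closed[OF iso that] N.subm_carrier D(6) by auto
  have z: "f \<zero>\<^bsub>M\<^esub> = \<zero>\<^bsub>N\<^esub>"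
    using D(10)[of "\<zero>\<^bsub>R\<^esub>" "\<zero>\<^bsub>M\<^esub>"] M.subm_zero[OF D(3)] f by simp
  have neg: "f (\<ominus>\<^bsub>M\<^esub> a) = \<ominus>\<^bsub>N\<^esub> f a" if a: "a \<in> A" for a
    using D(10)[of "\<ominus>\<^bsub>R\<^esub> \<one>\<^bsub>R\<^esub>" a] a f[OF a] M.subm_carrier[OF D(3) a]
    by (simp add: M.smult_l_minus N.smult_l_minus)
  show "submodule {a \<in> A. f a \<in> Y} R M"
    using M.subm_rules[OF D(3)] N.subm_rules[OF Y(1)] z neg D(9,10) M.subm_carrier[OF D(3)]
    by (intro M.submoduleI) auto
  show "B \<subseteq> {a \<in> A. f a \<in> Y}" using D(12) Y by auto
  show "f ` {a \<in> A. f a \<in> Y} <+>\<^bsub>N\<^esub> B' = Y" if YA: "Y \<subseteq> A'"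
  proof
    show "f ` {a \<in> A. f a \<in> Y} <+>\<^bsub>N\<^esub> B' \<subseteq> Y" using Y by (intro N.set_add_least) auto
    show "Y \<subseteq> f ` {a \<in> A. f a \<in> Y} <+>\<^bsub>N\<^esub> B'"
    proof
      fix y assume y: "y \<in> Y"
      then obtain a b where ab: "a \<in> A" "b \<in> B'" "y = f a \<oplus>\<^bsub>N\<^esub> b"
        using YA D(11) by (blast elim: set_addE)
      then have "f a \<in> Y" using y Y f N.subm_cancel[OF Y(1)] by (metis subsetD)
      then show "y \<in> f ` {a \<in> A. f a \<in> Y} <+>\<^bsub>N\<^esub> B'" using ab by (auto simp: set_add_iff)
    qed
  qed
qed

text \<open>The second isomorphism theorem, induced by the inclusion of \<open>A\<close>.\<close>

lemma (in module) sq_iso_id: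
  assumes "subm A" "subm B"
  shows "sq_iso R M M (\<lambda>a. a) A (A \<inter> B) (A <+>\<^bsub>M\<^esub> B) B"
  by (rule sq_isoI) (use assms in \<open>auto intro!: subm_intros set_add_upper2[THEN subsetD] simp: module_axioms\<close>)

text \<open>The first isomorphism theorem for multiplication by \<open>x\<close> on
  \<open>A\<close>, followed by reduction modulo \<open>B\<close>.\<close>

lemma (in module) sq_iso_smult:
  assumes "x \<in> carrier R" "subm A" "subm B"
  shows "sq_iso R M M (\<lambda>a. x \<odot>\<^bsub>M\<^esub> a) A (colon M x A B) (scale M x A <+>\<^bsub>M\<^esub> B) B"
proof (rule sq_isoI)
  show "colon M x A B = {a \<in> A. x \<odot>\<^bsub>M\<^esub> a \<in> B}" by (rule colon_def)
  show "scale M x A <+>\<^bsub>M\<^esub> B = (\<lambda>a. x \<odot>\<^bsub>M\<^esub> a) ` A <+>\<^bsub>M\<^esub> B" by (simp add: scale_def)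
  show "B \<subseteq> scale M x A <+>\<^bsub>M\<^esub> B" using assms by (intro set_add_upper2 subm_intros)
qed (use assms in \<open>auto intro!: subm_intros module_axioms simp: smult_r_distr subm_carrier smult_swap\<close>)

text \<open>Kernels of \<open>x\<close> correspond under the isomorphism, and in
  \<open>sq_iso_scale\<close> its cokernels; these are the two modules on which the recursion of
  \<open>emult\<close> runs.\<close>

lemma sq_iso_colon:
  assumes iso: "sq_iso R M N f A B A' B'" and x: "x \<in> carrier R"
  shows "sq_iso R M N f (colon M x A B) B (colon N x A' B') B'"
proof -
  note D = sq_isoD[OF iso]
  interpret M: module R M by (rule D)
  interpret N: module R N by (rule D)
  have f: "f a \<in> carrier N" if "a \<in> A" for a
    using sq_iso_closed[OF iso that] N.subm_carrier D(6) by auto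
  have B: "B \<subseteq> colon M x A B" "B' \<subseteq> colon N x A' B'"
    using M.subset_colon N.subset_colon D x by auto
  have s: "submodule (colon N x A' B') R N" using N.subm_colon D x by auto
  have "colon M x A B = {a \<in> A. f a \<in> colon N x A' B'}"
    unfolding colon_def using D(10)[OF x] sq_iso_closed[OF iso] M.subm_smult[OF D(3) x]
    by (subst D(12)) auto
  then have "colon N x A' B' = f ` colon M x A B <+>\<^bsub>N\<^esub> B'"
    using sq_iso_vimage(3)[OF iso s B(2) colon_subset] by simp
  moreover have "B = {a \<in> colon M x A B. f a \<in> B'}" using D(12) B colon_subset by fast
  moreover have "f (a \<oplus>\<^bsub>M\<^esub> b) = f a \<oplus>\<^bsub>N\<^esub> f b" if "a \<in> colon M x A B" "b \<in> colon M x A B" for a b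
    using that D(9) colon_subset by fast
  moreover have "f (r \<odot>\<^bsub>M\<^esub> a) = r \<odot>\<^bsub>N\<^esub> f a" if "r \<in> carrier R" "a \<in> colon M x A B" for r a
    using that D(10) colon_subset by fast
  ultimately show ?thesis
    by (intro sq_isoI[OF D(1,2) M.subm_colon[OF x D(3,4)] D(4) s D(7) _ _ _ _ B(2)])
qed

lemma sq_iso_scale:
  assumes iso: "sq_iso R M N f A B A' B'" and x: "x \<in> carrier R"
  shows "sq_iso R M N f A (B <+>\<^bsub>M\<^esub> scale M x A) A' (B' <+>\<^bsub>N\<^esub> scale N x A')"
proof -
  note D = sq_isoD[OF iso]
  interpret M: module R M by (rule D)
  interpret N: module R N by (rule D)
  have f: "f a \<in> carrier N" if "a \<in> A" for a
    using sq_iso_closed[OF iso that] N.subm_carrier D(6) by auto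
  have s: "submodule (B <+>\<^bsub>M\<^esub> scale M x A) R M" "submodule (B' <+>\<^bsub>N\<^esub> scale N x A') R N"
    using M.subm_intros N.subm_intros D x by auto
  have le: "B <+>\<^bsub>M\<^esub> scale M x A \<subseteq> A" "B' <+>\<^bsub>N\<^esub> scale N x A' \<subseteq> A'"
    using M.set_add_least N.set_add_least D M.scale_subset N.scale_subset x by auto
  have ge: "B \<subseteq> B <+>\<^bsub>M\<^esub> scale M x A" "B' \<subseteq> B' <+>\<^bsub>N\<^esub> scale N x A'"
    using M.set_add_upper1 N.set_add_upper1 D M.subm_scale N.subm_scale x by auto
  have "f ` (B <+>\<^bsub>M\<^esub> scale M x A) <+>\<^bsub>N\<^esub> B' = B' <+>\<^bsub>N\<^esub> scale N x A'" (is "?L = ?Q")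
  proof
    have "f z \<in> B' <+>\<^bsub>N\<^esub> scale N x A'" if "z \<in> B <+>\<^bsub>M\<^esub> scale M x A" for z
    proof -
      from that obtain b a where z: "b \<in> B" "a \<in> A" "z = b \<oplus>\<^bsub>M\<^esub> x \<odot>\<^bsub>M\<^esub> a"
        by (auto simp: set_add_iff scale_def)
      then have "f z = f b \<oplus>\<^bsub>N\<^esub> x \<odot>\<^bsub>N\<^esub> f a"
        using D(9,10) x D(5) M.subm_smult[OF D(3) x] by (metis subsetD)
      moreover have "f b \<in> B'" using z D(12) by auto
      ultimately show ?thesis using sq_iso_closed[OF iso z(2)] by (auto simp: set_add_iff scale_def)
    qed
    then show "?L \<subseteq> ?Q" using ge by (intro N.set_add_least[OF s(2)]) auto
    show "?Q \<subseteq> ?L"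
    proof (rule N.set_add_least)
      show "submodule ?L R N" "B' \<subseteq> ?L" using sq_iso_image[OF iso s(1) le(1)] by auto
      show "scale N x A' \<subseteq> ?L"
      proof
        fix y assume "y \<in> scale N x A'"
        then obtain a b where y: "y = x \<odot>\<^bsub>N\<^esub> (f a \<oplus>\<^bsub>N\<^esub> b)" "a \<in> A" "b \<in> B'"
          unfolding D(11) by (auto simp: set_add_iff scale_def)
        then have "y = f (x \<odot>\<^bsub>M\<^esub> a) \<oplus>\<^bsub>N\<^esub> x \<odot>\<^bsub>N\<^esub> b"
          using D(10) f x N.subm_carrier[OF D(7)] by (simp add: N.smult_r_distr)
        moreover have "x \<odot>\<^bsub>M\<^esub> a \<in> B <+>\<^bsub>M\<^esub> scale M x A"
          using M.set_add_upper2[OF D(4) M.subm_scale[OF x D(3)]] y by (auto simp: scale_def)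
        ultimately show "y \<in> ?L"
          using y N.subm_smult[OF D(7) x] by (auto intro!: set_addI)
      qed
    qed
  qed
  then have "B <+>\<^bsub>M\<^esub> scale M x A = {a \<in> A. f a \<in> B' <+>\<^bsub>N\<^esub> scale N x A'}"
    using sq_iso_image(4)[OF iso s(1) le(1) ge(1)] by simp
  moreover have "A' = f ` A <+>\<^bsub>N\<^esub> (B' <+>\<^bsub>N\<^esub> scale N x A')"
  proof
    show "f ` A <+>\<^bsub>N\<^esub> (B' <+>\<^bsub>N\<^esub> scale N x A') \<subseteq> A'"
      using sq_iso_closed[OF iso] by (intro N.set_add_least[OF D(6)] le(2)) auto
    show "A' \<subseteq> f ` A <+>\<^bsub>N\<^esub> (B' <+>\<^bsub>N\<^esub> scale N x A')"
      by (subst D(11)) (intro set_add_mono ge order.refl)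
  qed
  ultimately show ?thesis
    by (intro sq_isoI[OF D(1-3) s(1) D(6) s(2) _ _ _ _ le(2)] D(9,10))
qed

section \<open>Length of subquotients\<close>

text \<open>Submodules between \<open>B\<close> and \<open>A\<close> stand for the submodules of
  \<open>A / B\<close>, so that lengths of subquotients are available without forming
  quotients.\<close>

definition chain_between ::
    "('a, 'r) ring_scheme \<Rightarrow> ('a, 'b, 'm) module_scheme \<Rightarrow> 'b set \<Rightarrow> 'b set \<Rightarrow> nat \<Rightarrow> bool" where
  "chain_between R M A B n \<longleftrightarrow>
     (\<exists>N. (\<forall>i\<le>n. submodule (N i) R M \<and> B \<subseteq> N i \<and> N i \<subseteq> A) \<and> (\<forall>i<n. N i \<subset> N (Suc i)))"

definition len ::
    "('a, 'r) ring_scheme \<Rightarrow> ('a, 'b, 'm) module_scheme \<Rightarrow> 'b set \<Rightarrow> 'b set \<Rightarrow> enat" where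
  "len R M A B = Sup {enat n | n. chain_between R M A B n}"

lemma chain_between_le: "chain_between R M A B n \<Longrightarrow> m \<le> n \<Longrightarrow> chain_between R M A B m"
  unfolding chain_between_def by (meson order.trans order_less_le_trans)

lemma chain_between_mono:
  "chain_between R M A B n \<Longrightarrow> A \<subseteq> A' \<Longrightarrow> B' \<subseteq> B \<Longrightarrow> chain_between R M A' B' n"
  unfolding chain_between_def by (meson order.trans)

lemma chain_between_0: "submodule A R M \<Longrightarrow> B \<subseteq> A \<Longrightarrow> chain_between R M A B 0"
  unfolding chain_between_def by auto

lemma chain_between_Suc:
  assumes "chain_between R M X B n" "submodule Y R M" "X \<subset> Y"
  shows "chain_between R M Y B (Suc n)"
proof -
  from assms(1) obtain N where N: "\<forall>i\<le>n. submodule (N i) R M \<and> B \<subseteq> N i \<and> N i \<subseteq> X" "\<forall>i<n. N i \<subset> N (Suc i)"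
    unfolding chain_between_def by blast
  define N' where "N' = N(Suc n := Y)"
  have "\<forall>i\<le>Suc n. submodule (N' i) R M \<and> B \<subseteq> N' i \<and> N' i \<subseteq> Y"
    using N(1) assms by (auto simp: N'_def le_Suc_eq)
  moreover have "N' i \<subset> N' (Suc i)" if "i < Suc n" for i
  proof (cases "i = n")
    case True
    then show ?thesis using N(1) assms(3) by (simp add: N'_def) (meson le_refl order.strict_trans1)
  qed (use that N in \<open>simp add: N'_def\<close>)
  ultimately show ?thesis unfolding chain_between_def by blast
qed

lemma chain_between_concat:
  assumes "chain_between R M C B q" "chain_between R M A C p" "B \<subseteq> C" "C \<subseteq> A"
  shows "chain_between R M A B (p + q)"
  using assms(2,1,3,4)
proof (induction p arbitrary: A)
  case 0
  then show ?case using chain_between_mono by (metis add_0 order.refl)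
next
  case (Suc p)
  from Suc.prems(1) obtain N where N: "\<forall>i\<le>Suc p. submodule (N i) R M \<and> C \<subseteq> N i \<and> N i \<subseteq> A" "\<forall>i<Suc p. N i \<subset> N (Suc i)"
    unfolding chain_between_def by blast
  have "N i \<subseteq> N p" if "i \<le> p" for i
    using that N(2) by (induction rule: inc_induct) (auto simp: less_Suc_eq)
  then have "chain_between R M (N p) C p"
    unfolding chain_between_def using N by (intro exI[of _ N]) auto
  then have "chain_between R M (N p) B (p + q)" using Suc N(1) by auto
  then have "chain_between R M (N (Suc p)) B (Suc (p + q))"
    using N by (intro chain_between_Suc) auto
  then show ?case using N(1) chain_between_mono by (metis add_Suc order.refl)
qed

text \<open>A chain can be truncated, so the possible lengths are closed downwards: if there is no
  chain of length \<open>Suc k\<close>, then all lengths are at most \<open>k\<close>, and so is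
  their supremum.\<close>

lemma enat_le_len_iff:
  assumes "submodule A R M" "B \<subseteq> A"
  shows "enat n \<le> len R M A B \<longleftrightarrow> chain_between R M A B n"
proof
  assume le: "enat n \<le> len R M A B"
  show "chain_between R M A B n"
  proof (rule ccontr)
    assume no: "\<not> chain_between R M A B n"
    then obtain k where k: "n = Suc k" using chain_between_0[OF assms] by (cases n) auto
    have "m \<le> k" if "chain_between R M A B m" for m
      using no that chain_between_le[OF that] k by (meson not_less_eq_eq)
    then have "len R M A B \<le> enat k" unfolding len_def by (auto intro!: Sup_least)
    then show False using le k by (metis Suc_n_not_le_n enat_ord_simps(1) order.trans)
  qed
next
  assume "chain_between R M A B n"
  then show "enat n \<le> len R M A B" unfolding len_def by (auto intro: Sup_upper)
qed

lemma enat_leI: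
  fixes a b :: enat
  assumes "\<And>n. enat n \<le> a \<Longrightarrow> enat n \<le> b"
  shows "a \<le> b"
proof (cases a)
  case (enat n)
  then show ?thesis using assms[of n] by simp
next
  case infinity
  then have "enat n \<le> b" for n using assms by simp
  then have "b = \<infinity>" by (metis Suc_ile_eq enat.exhaust less_irrefl)
  then show ?thesis by simp
qed

lemma enat_le_addE:
  fixes a b :: enat
  assumes "enat n \<le> a + b"
  obtains p q where "n = p + q" "enat p \<le> a" "enat q \<le> b"
proof (cases "enat n \<le> a")
  case True
  then show ?thesis using that[of n 0] by (simp add: zero_enat_def[symmetric])
next
  case False
  then obtain p where p: "a = enat p" "p < n" by (cases a) auto
  then have "enat (n - p) \<le> b" using assms by (cases b) auto
  then show ?thesis using that[of p "n - p"] p by auto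
qed

text \<open>A strict step of the chain stays strict after intersecting with \<open>C\<close> or
  after adding \<open>C\<close>: if both results agreed, the modular law would identify the two
  members. Only \<open>n \<le> p + q\<close> can be claimed here, because a step may stay strict in
  both ways.\<close>

lemma (in module) chain_between_split:
  assumes "subm C" "\<forall>i\<le>n. subm (N i) \<and> B \<subseteq> N i" "\<forall>i<n. N i \<subset> N (Suc i)" "B \<subseteq> C"
  shows "\<exists>p q. n \<le> p + q \<and> chain_between R M (N n \<inter> C) B q \<and> chain_between R M (N n <+>\<^bsub>M\<^esub> C) C p"
  using assms(2,3)
proof (induction n)
  case 0
  then have "chain_between R M (N 0 \<inter> C) B 0" "chain_between R M (N 0 <+>\<^bsub>M\<^esub> C) C 0"
    using assms(1,4) by (simp_all add: chain_between_0 subm_intros set_add_upper2)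
  then show ?case by force
next
  case (Suc n)
  then obtain p q where pq: "n \<le> p + q" "chain_between R M (N n \<inter> C) B q" "chain_between R M (N n <+>\<^bsub>M\<^esub> C) C p"
    by auto
  have s: "subm (N n)" "subm (N (Suc n))" and lt: "N n \<subset> N (Suc n)" using Suc.prems by auto
  have s': "subm (N (Suc n) \<inter> C)" "subm (N (Suc n) <+>\<^bsub>M\<^esub> C)" using s assms(1) by (auto intro: subm_intros)
  have le: "N n \<inter> C \<subseteq> N (Suc n) \<inter> C" "N n <+>\<^bsub>M\<^esub> C \<subseteq> N (Suc n) <+>\<^bsub>M\<^esub> C"
    using lt set_add_mono[of "N n" "N (Suc n)" C C M] by auto
  have "N n \<inter> C \<subset> N (Suc n) \<inter> C \<or> N n <+>\<^bsub>M\<^esub> C \<subset> N (Suc n) <+>\<^bsub>M\<^esub> C" (is ?disj)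
  proof (rule ccontr)
    assume "\<not> ?disj"
    then have eq: "N n \<inter> C = N (Suc n) \<inter> C" "N n <+>\<^bsub>M\<^esub> C = N (Suc n) <+>\<^bsub>M\<^esub> C" using le by auto
    have "N (Suc n) \<subseteq> C <+>\<^bsub>M\<^esub> N n"
      using set_add_upper1[OF s(2) assms(1)] eq(2) set_add_comm[OF s(1) assms(1)] by simp
    then have "N (Suc n) = N (Suc n) \<inter> (C <+>\<^bsub>M\<^esub> N n)" by (rule Int_absorb2[symmetric])
    also have "\<dots> = (N (Suc n) \<inter> C) <+>\<^bsub>M\<^esub> N n" by (rule modular_law[OF s(2) assms(1) s(1)]) (use lt in auto)
    also have "\<dots> \<subseteq> N n" using s eq(1) by (intro set_add_least) auto
    finally show False using lt by auto
  qed
  then show ?case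
  proof
    assume 1: "N n \<inter> C \<subset> N (Suc n) \<inter> C"
    have "chain_between R M (N (Suc n) \<inter> C) B (Suc q)" by (rule chain_between_Suc[OF pq(2) s'(1) 1])
    moreover have "chain_between R M (N (Suc n) <+>\<^bsub>M\<^esub> C) C p"
      using chain_between_mono[OF pq(3) le(2)] by auto
    ultimately show ?thesis using pq(1) by (metis Suc_le_mono add_Suc_right)
  next
    assume 2: "N n <+>\<^bsub>M\<^esub> C \<subset> N (Suc n) <+>\<^bsub>M\<^esub> C"
    have "chain_between R M (N (Suc n) <+>\<^bsub>M\<^esub> C) C (Suc p)" by (rule chain_between_Suc[OF pq(3) s'(2) 2])
    moreover have "chain_between R M (N (Suc n) \<inter> C) B q"
      using chain_between_mono[OF pq(2) le(1)] by auto
    ultimately show ?thesis using pq(1) by (metis Suc_le_mono add_Suc)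
  qed
qed

text \<open>One inequality splits a chain at \<open>C\<close>, the other glues two chains. Comparing
  the finite numbers below both sides covers infinite lengths as well.\<close>

lemma (in module) len_add:
  assumes "subm A" "subm B" "subm C" "B \<subseteq> C" "C \<subseteq> A"
  shows "len R M A B = len R M A C + len R M C B"
proof (rule antisym; rule enat_leI)
  have BA: "B \<subseteq> A" using assms by auto
  fix n assume "enat n \<le> len R M A B"
  then have "chain_between R M A B n" using enat_le_len_iff[OF assms(1) BA] by simp
  then obtain N where N: "\<forall>i\<le>n. subm (N i) \<and> B \<subseteq> N i \<and> N i \<subseteq> A" "\<forall>i<n. N i \<subset> N (Suc i)"
    unfolding chain_between_def by blast
  obtain p q where pq: "n \<le> p + q" "chain_between R M (N n \<inter> C) B q" "chain_between R M (N n <+>\<^bsub>M\<^esub> C) C p"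
    using chain_between_split[OF assms(3) _ N(2) assms(4)] N(1) by blast
  have "chain_between R M C B q" using chain_between_mono[OF pq(2)] by auto
  moreover have "chain_between R M A C p"
    using assms N(1) by (intro chain_between_mono[OF pq(3)] set_add_least) auto
  ultimately have "enat q \<le> len R M C B" "enat p \<le> len R M A C"
    using enat_le_len_iff[OF assms(3,4)] enat_le_len_iff[OF assms(1,5)] by auto
  then have "enat p + enat q \<le> len R M A C + len R M C B" by (intro add_mono)
  then show "enat n \<le> len R M A C + len R M C B" using pq(1)
    by (metis enat_ord_simps(1) order.trans plus_enat_simps(1))
next
  have BA: "B \<subseteq> A" using assms by auto
  fix n assume "enat n \<le> len R M A C + len R M C B"
  then obtain p q where "n = p + q" "enat p \<le> len R M A C" "enat q \<le> len R M C B" by (rule enat_le_addE)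
  then show "enat n \<le> len R M A B"
    using enat_le_len_iff[OF assms(3,4)] enat_le_len_iff[OF assms(1,5)] enat_le_len_iff[OF assms(1) BA]
      chain_between_concat[OF _ _ assms(4,5)] by auto
qed

lemma sq_iso_chain_between:
  assumes iso: "sq_iso R M N f A B A' B'"
  shows "chain_between R M A B n \<longleftrightarrow> chain_between R N A' B' n"
proof
  assume "chain_between R M A B n"
  then obtain X where X: "\<forall>i\<le>n. submodule (X i) R M \<and> B \<subseteq> X i \<and> X i \<subseteq> A" "\<forall>i<n. X i \<subset> X (Suc i)"
    unfolding chain_between_def by blast
  define Y where "Y i = f ` X i <+>\<^bsub>N\<^esub> B'" for i
  have "Y i \<subset> Y (Suc i)" if "i < n" for i
  proof -
    have "Y i \<subseteq> Y (Suc i)" unfolding Y_def using X(2) that by (intro set_add_mono) auto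
    moreover have "Y i \<noteq> Y (Suc i)"
    proof
      assume "Y i = Y (Suc i)"
      then have "{a \<in> A. f a \<in> Y i} = {a \<in> A. f a \<in> Y (Suc i)}" by simp
      moreover have "{a \<in> A. f a \<in> Y i} = X i" "{a \<in> A. f a \<in> Y (Suc i)} = X (Suc i)"
        unfolding Y_def using X(1) that by (simp_all add: sq_iso_image(4)[OF iso])
      ultimately show False using X(2) that by blast
    qed
    ultimately show ?thesis by auto
  qed
  moreover have "\<forall>i\<le>n. submodule (Y i) R N \<and> B' \<subseteq> Y i \<and> Y i \<subseteq> A'"
    unfolding Y_def using sq_iso_image(1-3)[OF iso] X(1) by simp
  ultimately show "chain_between R N A' B' n" unfolding chain_between_def by blast
next
  assume "chain_between R N A' B' n"
  then obtain X where X: "\<forall>i\<le>n. submodule (X i) R N \<and> B' \<subseteq> X i \<and> X i \<subseteq> A'" "\<forall>i<n. X i \<subset> X (Suc i)"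
    unfolding chain_between_def by blast
  define Y where "Y i = {a \<in> A. f a \<in> X i}" for i
  have "Y i \<subset> Y (Suc i)" if "i < n" for i
  proof -
    have "Y i \<subseteq> Y (Suc i)" unfolding Y_def using X(2) that by auto
    moreover have "Y i \<noteq> Y (Suc i)"
    proof
      assume "Y i = Y (Suc i)"
      then have "f ` Y i <+>\<^bsub>N\<^esub> B' = f ` Y (Suc i) <+>\<^bsub>N\<^esub> B'" by simp
      moreover have "f ` Y i <+>\<^bsub>N\<^esub> B' = X i" "f ` Y (Suc i) <+>\<^bsub>N\<^esub> B' = X (Suc i)"
        unfolding Y_def using X(1) that by (simp_all add: sq_iso_vimage(3)[OF iso])
      ultimately show False using X(2) that by blast
    qed
    ultimately show ?thesis by auto
  qed
  moreover have "\<forall>i\<le>n. submodule (Y i) R M \<and> B \<subseteq> Y i \<and> Y i \<subseteq> A"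
    unfolding Y_def using sq_iso_vimage(1,2)[OF iso] X(1) by simp
  ultimately show "chain_between R M A B n" unfolding chain_between_def by blast
qed

lemma sq_iso_len: "sq_iso R M N f A B A' B' \<Longrightarrow> len R M A B = len R N A' B'"
  unfolding len_def by (simp add: sq_iso_chain_between)

lemma (in module) len_self: "subm A \<Longrightarrow> len R M A A = 0"
proof -
  assume A: "subm A"
  have "\<not> chain_between R M A A (Suc 0)"
    unfolding chain_between_def by (metis le_numeral_extra(3) lessI less_Suc_eq_le order.refl psubsetE subset_antisym zero_le)
  then have "\<not> enat (Suc 0) \<le> len R M A A" using enat_le_len_iff[OF A] by blast
  then show ?thesis by (metis Suc_ile_eq not_gr_zero zero_enat_def)
qed

lemma module_length_eq_len:
  assumes "module R Q"
  shows "module_length R Q = len R Q (carrier Q) {\<zero>\<^bsub>Q\<^esub>}"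
proof -
  interpret module R Q by fact
  have "subm X \<and> {\<zero>\<^bsub>Q\<^esub>} \<subseteq> X \<and> X \<subseteq> carrier Q \<longleftrightarrow> subm X" for X
    using subm_zero subm_sub by blast
  then show ?thesis unfolding module_length_def len_def chain_between_def by (simp only:)
qed

section \<open>Restriction and quotients\<close>

lemma (in module) submodule_restrict_iff:
  assumes "subm A"
  shows "submodule X R (M\<lparr>carrier := A\<rparr>) \<longleftrightarrow> subm X \<and> X \<subseteq> A"
proof -
  interpret A: module R "M\<lparr>carrier := A\<rparr>" using submodule.submodule_is_module[OF assms module_axioms] .
  \<comment> \<open>Negatives of the restricted module are defined through its own carrier, so their
    agreement with the negatives of \<open>M\<close> needs an argument.\<close>
  have inv: "\<ominus>\<^bsub>M\<lparr>carrier := A\<rparr>\<^esub> a = \<ominus>\<^bsub>M\<^esub> a" if "a \<in> A" for a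
  proof -
    have "\<ominus>\<^bsub>M\<^esub> a \<oplus>\<^bsub>M\<^esub> a = \<zero>\<^bsub>M\<^esub>" using that assms subm_carrier M.l_neg by auto
    then show ?thesis
      using A.M.minus_equality[of "\<ominus>\<^bsub>M\<^esub> a" a] that subm_neg[OF assms] by simp
  qed
  show ?thesis
  proof
    assume X: "submodule X R (M\<lparr>carrier := A\<rparr>)"
    have XA: "X \<subseteq> A" using A.subm_sub[OF X] by simp
    have "subm X"
    proof (rule submoduleI)
      show "X \<subseteq> carrier M" using XA subm_sub[OF assms] by auto
      show "\<zero>\<^bsub>M\<^esub> \<in> X" using A.subm_zero[OF X] by simp
      show "\<ominus>\<^bsub>M\<^esub> a \<in> X" if "a \<in> X" for a using A.subm_neg[OF X that] inv that XA by auto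
      show "a \<oplus>\<^bsub>M\<^esub> b \<in> X" if "a \<in> X" "b \<in> X" for a b using A.subm_add[OF X that] by simp
      show "r \<odot>\<^bsub>M\<^esub> b \<in> X" if "r \<in> carrier R" "b \<in> X" for r b using A.subm_smult[OF X that] by simp
    qed
    then show "subm X \<and> X \<subseteq> A" using XA by simp
  next
    assume X: "subm X \<and> X \<subseteq> A"
    then show "submodule X R (M\<lparr>carrier := A\<rparr>)"
      using subm_rules[of X] by (intro A.submoduleI) (auto simp: inv[OF subsetD[of X A]])
  qed
qed

lemma (in module) sq_iso_restrict:
  assumes "subm X" "subm A" "subm B" "B \<subseteq> A" "A \<subseteq> X"
  shows "sq_iso R (M\<lparr>carrier := X\<rparr>) M (\<lambda>a. a) A B A B"
  using assms by (intro sq_isoI submodule.submodule_is_module module_axioms)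
    (auto simp: submodule_restrict_iff set_add_absorb2)

lemma (in module) coset_iff:
  assumes "subm N" "a \<in> carrier M" "b \<in> carrier M"
  shows "N +>\<^bsub>M\<^esub> a = N +>\<^bsub>M\<^esub> b \<longleftrightarrow> a \<ominus>\<^bsub>M\<^esub> b \<in> N"
proof -
  interpret abelian_subgroup N M
    using assms(1) by (intro abelian_subgroupI3 additive_subgroup.intro M.abelian_group_axioms)
      (rule submodule.axioms)
  show ?thesis
    using a_rcos_module[OF assms(3,2)] a_rcos_self[OF assms(2)] a_repr_independence[OF _ assms(3) additive_subgroup.a_subgroup[OF is_additive_subgroup]]
    unfolding a_minus_def by metis
qed

lemma (in module) mem_coset: "subm N \<Longrightarrow> a \<in> carrier M \<Longrightarrow> a \<in> N +>\<^bsub>M\<^esub> a"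
  unfolding a_r_coset_def' using subm_zero M.l_zero by force

lemma (in module) coset_add:
  assumes N: "subm N" and a: "a \<in> carrier M" and b: "b \<in> carrier M"
  shows "(N +>\<^bsub>M\<^esub> a) <+>\<^bsub>M\<^esub> (N +>\<^bsub>M\<^esub> b) = N +>\<^bsub>M\<^esub> (a \<oplus>\<^bsub>M\<^esub> b)"
proof -
  interpret abelian_subgroup N M
    using assms(1) by (intro abelian_subgroupI3 additive_subgroup.intro M.abelian_group_axioms)
      (rule submodule.axioms)
  show ?thesis by (rule a_rcos_sum[OF a b])
qed

text \<open>The union that defines scalar multiplication on the quotient runs over equal cosets: two
  representatives differ by an element of \<open>N\<close>, and so do their multiples by
  \<open>r\<close>.\<close>

lemma (in module) coset_smult:
  assumes N: "subm N" and r: "r \<in> carrier R" and a: "a \<in> carrier M"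
  shows "(\<Union>m \<in> N +>\<^bsub>M\<^esub> a. N +>\<^bsub>M\<^esub> (r \<odot>\<^bsub>M\<^esub> m)) = N +>\<^bsub>M\<^esub> (r \<odot>\<^bsub>M\<^esub> a)"
proof -
  have "N +>\<^bsub>M\<^esub> (r \<odot>\<^bsub>M\<^esub> m) = N +>\<^bsub>M\<^esub> (r \<odot>\<^bsub>M\<^esub> a)" if "m \<in> N +>\<^bsub>M\<^esub> a" for m
  proof -
    from that obtain n where n: "n \<in> N" "m = n \<oplus>\<^bsub>M\<^esub> a" unfolding a_r_coset_def' by auto
    have nc: "n \<in> carrier M" using n N subm_carrier by auto
    have "r \<odot>\<^bsub>M\<^esub> m \<ominus>\<^bsub>M\<^esub> r \<odot>\<^bsub>M\<^esub> a = r \<odot>\<^bsub>M\<^esub> n"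
      using n nc a r subm_eq_minus(1)[of "r \<odot>\<^bsub>M\<^esub> m" "r \<odot>\<^bsub>M\<^esub> n"] by (simp add: smult_r_distr)
    then show ?thesis using coset_iff[OF N] n nc a r subm_smult[OF N r] by simp
  qed
  then show ?thesis using mem_coset[OF N a] by blast
qed

lemma (in module) quotient_module_sel:
  "carrier (quotient_module M N) = (\<lambda>a. N +>\<^bsub>M\<^esub> a) ` carrier M"
  "\<zero>\<^bsub>quotient_module M N\<^esub> = N" "add (quotient_module M N) = set_add M"
  "smult (quotient_module M N) = (\<lambda>a C. \<Union>m\<in>C. N +>\<^bsub>M\<^esub> (a \<odot>\<^bsub>M\<^esub> m))"
  by (auto simp: quotient_module_def A_RCOSETS_def')

lemma (in module) coset_zero: "subm N \<Longrightarrow> N +>\<^bsub>M\<^esub> \<zero>\<^bsub>M\<^esub> = N"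
  unfolding a_r_coset_def' by (auto simp: subm_carrier)

lemma (in module) quotient_module_is_module:
  assumes N: "subm N"
  shows "module R (quotient_module M N)" (is "module R ?Q")
proof -
  note S = quotient_module_sel
  note C = coset_add[OF N]
  have sm: "r \<odot>\<^bsub>?Q\<^esub> (N +>\<^bsub>M\<^esub> a) = N +>\<^bsub>M\<^esub> (r \<odot>\<^bsub>M\<^esub> a)" if "r \<in> carrier R" "a \<in> carrier M" for r a
    using coset_smult[OF N that] by (simp only: S)
  have rep: "\<exists>a\<in>carrier M. x = N +>\<^bsub>M\<^esub> a" if "x \<in> carrier ?Q" for x using that unfolding S by blast
  have mem: "N +>\<^bsub>M\<^esub> a \<in> carrier ?Q" if "a \<in> carrier M" for a using that unfolding S by blast
  show ?thesis
  proof (rule moduleI)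
    show "cring R" by (rule R.cring_axioms)
    show "abelian_group ?Q"
    proof (rule abelian_groupI)
      fix x assume "x \<in> carrier ?Q"
      then obtain a where a: "a \<in> carrier M" "x = N +>\<^bsub>M\<^esub> a" using rep by blast
      show "\<zero>\<^bsub>?Q\<^esub> \<oplus>\<^bsub>?Q\<^esub> x = x"
        using a coset_add[OF N M.zero_closed a(1)] coset_zero[OF N] by (simp add: S)
      show "\<exists>y\<in>carrier ?Q. y \<oplus>\<^bsub>?Q\<^esub> x = \<zero>\<^bsub>?Q\<^esub>"
        using a by (intro bexI[of _ "N +>\<^bsub>M\<^esub> \<ominus>\<^bsub>M\<^esub> a"]) (auto simp: S C M.l_neg coset_zero[OF N])
    next
      show "\<zero>\<^bsub>?Q\<^esub> \<in> carrier ?Q" using coset_zero[OF N] mem[OF M.zero_closed] by (simp add: S(2))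
    qed (auto simp: S C M.a_ac)
  next
    fix r x assume "r \<in> carrier R" "x \<in> carrier ?Q"
    then show "r \<odot>\<^bsub>?Q\<^esub> x \<in> carrier ?Q" using rep sm mem smult_closed by metis
  next
    fix x assume "x \<in> carrier ?Q"
    then show "\<one> \<odot>\<^bsub>?Q\<^esub> x = x" using rep sm[OF R.one_closed] by fastforce
  next
    fix r s x assume r: "r \<in> carrier R" and s: "s \<in> carrier R" and "x \<in> carrier ?Q"
    then obtain a where a: "a \<in> carrier M" "x = N +>\<^bsub>M\<^esub> a" using rep by blast
    show "(r \<oplus> s) \<odot>\<^bsub>?Q\<^esub> x = r \<odot>\<^bsub>?Q\<^esub> x \<oplus>\<^bsub>?Q\<^esub> s \<odot>\<^bsub>?Q\<^esub> x"
      using a r s by (simp add: sm S(3) C smult_l_distr)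
    show "(r \<otimes> s) \<odot>\<^bsub>?Q\<^esub> x = r \<odot>\<^bsub>?Q\<^esub> (s \<odot>\<^bsub>?Q\<^esub> x)"
      using a r s by (simp add: sm smult_assoc1)
  next
    fix r x y assume r: "r \<in> carrier R" and "x \<in> carrier ?Q" "y \<in> carrier ?Q"
    then obtain a b where a: "a \<in> carrier M" "x = N +>\<^bsub>M\<^esub> a" "b \<in> carrier M" "y = N +>\<^bsub>M\<^esub> b" using rep by blast
    show "r \<odot>\<^bsub>?Q\<^esub> (x \<oplus>\<^bsub>?Q\<^esub> y) = r \<odot>\<^bsub>?Q\<^esub> x \<oplus>\<^bsub>?Q\<^esub> r \<odot>\<^bsub>?Q\<^esub> y"
      using a r by (simp add: sm S(3) C smult_r_distr)
  qed
qed

lemma (in module) sq_iso_quotient: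
  assumes N: "subm N"
  shows "sq_iso R M (quotient_module M N) (\<lambda>a. N +>\<^bsub>M\<^esub> a) (carrier M) N
    (carrier (quotient_module M N)) {\<zero>\<^bsub>quotient_module M N\<^esub>}"
proof -
  interpret Q: module R "quotient_module M N" by (rule quotient_module_is_module[OF N])
  have z: "\<zero>\<^bsub>quotient_module M N\<^esub> = N +>\<^bsub>M\<^esub> \<zero>\<^bsub>M\<^esub>" using coset_zero[OF N] by (simp add: quotient_module_sel)
  show ?thesis
  proof (rule sq_isoI)
    have "Q.subm (carrier (quotient_module M N) <+>\<^bsub>quotient_module M N\<^esub> {\<zero>\<^bsub>quotient_module M N\<^esub>})"
      by (intro Q.subm_intros)
    show "carrier (quotient_module M N) = (\<lambda>a. N +>\<^bsub>M\<^esub> a) ` carrier M <+>\<^bsub>quotient_module M N\<^esub> {\<zero>\<^bsub>quotient_module M N\<^esub>}"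
      using Q.set_add_absorb2[OF Q.carrier_is_submodule Q.subm_zero_set] by (simp add: quotient_module_sel(1)[symmetric])
    have "N +>\<^bsub>M\<^esub> a = N +>\<^bsub>M\<^esub> \<zero>\<^bsub>M\<^esub> \<longleftrightarrow> a \<in> N" if "a \<in> carrier M" for a
      using coset_iff[OF N that M.zero_closed] that M.add.inv_one by (simp add: a_minus_def a_inv_def)
    then show "N = {a \<in> carrier M. N +>\<^bsub>M\<^esub> a \<in> {\<zero>\<^bsub>quotient_module M N\<^esub>}}"
      unfolding z using subm_sub[OF N] by auto
  qed (auto simp: N module_axioms Q.module_axioms carrier_is_submodule Q.carrier_is_submodule Q.subm_zero_set
      coset_add[OF N] coset_smult[OF N] quotient_module_sel(3,4))
qed

lemma (in module) restrict_quotient: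
  assumes A: "subm A" and B: "subm B" and BA: "B \<subseteq> A"
  shows "module R (quotient_module (M\<lparr>carrier := A\<rparr>) B)"
    "sq_iso R M (quotient_module (M\<lparr>carrier := A\<rparr>) B) (\<lambda>a. B +>\<^bsub>M\<^esub> a) A B
      (carrier (quotient_module (M\<lparr>carrier := A\<rparr>) B)) {\<zero>\<^bsub>quotient_module (M\<lparr>carrier := A\<rparr>) B\<^esub>}"
proof -
  interpret A: module R "M\<lparr>carrier := A\<rparr>" using submodule.submodule_is_module[OF A module_axioms] .
  have B': "submodule B R (M\<lparr>carrier := A\<rparr>)" using submodule_restrict_iff[OF A] B BA by simp
  show "module R (quotient_module (M\<lparr>carrier := A\<rparr>) B)" by (rule A.quotient_module_is_module[OF B'])
  \<comment> \<open>A coset of \<open>B\<close> does not depend on the carrier, so the projection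
    can be read as a map that is linear on the submodule \<open>A\<close> of
    \<open>M\<close>.\<close>
  have "B +>\<^bsub>M\<lparr>carrier := A\<rparr>\<^esub> a = B +>\<^bsub>M\<^esub> a" for a by (simp add: a_r_coset_def')
  then have "sq_iso R (M\<lparr>carrier := A\<rparr>) (quotient_module (M\<lparr>carrier := A\<rparr>) B) (\<lambda>a. B +>\<^bsub>M\<^esub> a) A B
      (carrier (quotient_module (M\<lparr>carrier := A\<rparr>) B)) {\<zero>\<^bsub>quotient_module (M\<lparr>carrier := A\<rparr>) B\<^esub>}"
    using A.sq_iso_quotient[OF B'] by simp
  note D = sq_isoD[OF this]
  show "sq_iso R M (quotient_module (M\<lparr>carrier := A\<rparr>) B) (\<lambda>a. B +>\<^bsub>M\<^esub> a) A B
      (carrier (quotient_module (M\<lparr>carrier := A\<rparr>) B)) {\<zero>\<^bsub>quotient_module (M\<lparr>carrier := A\<rparr>) B\<^esub>}"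
    using D(9,10) by (intro sq_isoI[OF module_axioms D(2) A B D(6,7) _ _ D(11,12,8)]) simp_all
qed

lemma (in module) module_length_quotient:
  assumes "subm A" "subm B" "B \<subseteq> A"
  shows "module_length R (quotient_module (M\<lparr>carrier := A\<rparr>) B) = len R M A B"
  using module_length_eq_len[OF restrict_quotient(1)[OF assms]] sq_iso_len[OF restrict_quotient(2)[OF assms]]
  by simp

lemma (in module) module_length_quotient_carrier:
  "subm B \<Longrightarrow> module_length R (quotient_module M B) = len R M (carrier M) B"
  using module_length_eq_len[OF quotient_module_is_module] sq_iso_len[OF sq_iso_quotient] by simp

section \<open>Noetherian subquotients\<close>

definition noeth ::
    "('a, 'r) ring_scheme \<Rightarrow> ('a, 'b, 'm) module_scheme \<Rightarrow> 'b set \<Rightarrow> 'b set \<Rightarrow> bool" where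
  "noeth R M A B \<longleftrightarrow>
     (\<forall>N :: nat \<Rightarrow> 'b set. (\<forall>i. submodule (N i) R M \<and> B \<subseteq> N i \<and> N i \<subseteq> A \<and> N i \<subseteq> N (Suc i)) \<longrightarrow>
       (\<exists>k. \<forall>i\<ge>k. N i = N k))"

lemma noethI:
  assumes "\<And>N :: nat \<Rightarrow> 'b set. (\<And>i. submodule (N i) R M) \<Longrightarrow> (\<And>i. B \<subseteq> N i) \<Longrightarrow> (\<And>i. N i \<subseteq> A) \<Longrightarrow>
    (\<And>i. N i \<subseteq> N (Suc i)) \<Longrightarrow> \<exists>k. \<forall>i\<ge>k. N i = N k"
  shows "noeth R M A B"
  using assms unfolding noeth_def by simp

lemma noethD:
  assumes "noeth R M A B"
    and "\<And>i. submodule (N i) R M" "\<And>i. B \<subseteq> N i" "\<And>i. N i \<subseteq> A" "\<And>i. N i \<subseteq> N (Suc i)"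
  obtains k where "\<And>i. i \<ge> k \<Longrightarrow> N i = N k"
  using assms unfolding noeth_def by metis

lemma noeth_sub:
  assumes "noeth R M A B" "C \<subseteq> A" "B \<subseteq> D"
  shows "noeth R M C D"
proof (rule noethI)
  fix N assume N: "\<And>i::nat. submodule (N i) R M" "\<And>i. D \<subseteq> N i" "\<And>i. N i \<subseteq> C" "\<And>i. N i \<subseteq> N (Suc i)"
  obtain k where "\<And>i. i \<ge> k \<Longrightarrow> N i = N k"
  proof (rule noethD[OF assms(1), of N])
    show "B \<subseteq> N i" "N i \<subseteq> A" for i using N(2,3)[of i] assms by auto
  qed (use N in auto)
  then show "\<exists>k. \<forall>i\<ge>k. N i = N k" by blast
qed

text \<open>The same principle as for lengths: the intersections with \<open>C\<close> and the sums
  with \<open>C\<close> both become stationary, and by the modular law nested submodules that agree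
  in both respects are equal.\<close>

lemma (in module) noeth_ext:
  assumes AC: "noeth R M A C" and CB: "noeth R M C B"
    and s: "subm A" "subm B" "subm C" "B \<subseteq> C" "C \<subseteq> A"
  shows "noeth R M A B"
proof (rule noethI)
  fix N assume N: "\<And>i::nat. subm (N i)" "\<And>i. B \<subseteq> N i" "\<And>i. N i \<subseteq> A" "\<And>i. N i \<subseteq> N (Suc i)"
  obtain k where k: "\<And>i. i \<ge> k \<Longrightarrow> N i \<inter> C = N k \<inter> C"
  proof (rule noethD[OF CB, of "\<lambda>i. N i \<inter> C"])
    show "subm (N i \<inter> C)" for i using N s by (intro subm_intros) auto
    show "B \<subseteq> N i \<inter> C" "N i \<inter> C \<subseteq> C" "N i \<inter> C \<subseteq> N (Suc i) \<inter> C" for i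
      using N(2,4)[of i] s by auto
  qed blast
  obtain l where l: "\<And>i. i \<ge> l \<Longrightarrow> N i <+>\<^bsub>M\<^esub> C = N l <+>\<^bsub>M\<^esub> C"
  proof (rule noethD[OF AC, of "\<lambda>i. N i <+>\<^bsub>M\<^esub> C"])
    show "subm (N i <+>\<^bsub>M\<^esub> C)" for i using N s by (intro subm_intros) auto
    show "C \<subseteq> N i <+>\<^bsub>M\<^esub> C" for i using N s by (intro set_add_upper2) auto
    show "N i <+>\<^bsub>M\<^esub> C \<subseteq> A" for i using N s by (intro set_add_least) auto
    show "N i <+>\<^bsub>M\<^esub> C \<subseteq> N (Suc i) <+>\<^bsub>M\<^esub> C" for i using N by (intro set_add_mono) auto
  qed blast
  have "N i = N (max k l)" if "i \<ge> max k l" for i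
  proof
    let ?m = "max k l"
    show sub: "N ?m \<subseteq> N i" using that lift_Suc_mono_le[of N ?m i] N(4) by auto
    have eq: "N i \<inter> C = N ?m \<inter> C" "N i <+>\<^bsub>M\<^esub> C = N ?m <+>\<^bsub>M\<^esub> C"
      using k[of i] k[of ?m] l[of i] l[of ?m] that by auto
    have "N i \<subseteq> C <+>\<^bsub>M\<^esub> N ?m"
      using set_add_upper1[OF N(1)[of i] s(3)] eq(2) set_add_comm[OF N(1)[of ?m] s(3)] by simp
    then have "N i = N i \<inter> (C <+>\<^bsub>M\<^esub> N ?m)" by (rule Int_absorb2[symmetric])
    also have "\<dots> = (N i \<inter> C) <+>\<^bsub>M\<^esub> N ?m" by (rule modular_law[OF N(1) s(3) N(1) sub])
    also have "\<dots> \<subseteq> N ?m" using eq(1) by (intro set_add_least N) auto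
    finally show "N i \<subseteq> N ?m" .
  qed
  then show "\<exists>k. \<forall>i\<ge>k. N i = N k" by blast
qed

lemma sq_iso_noeth:
  assumes iso: "sq_iso R M N f A B A' B'"
  shows "noeth R M A B \<longleftrightarrow> noeth R N A' B'"
proof
  assume no: "noeth R M A B"
  show "noeth R N A' B'"
  proof (rule noethI)
    fix X assume X: "\<And>i::nat. submodule (X i) R N" "\<And>i. B' \<subseteq> X i" "\<And>i. X i \<subseteq> A'" "\<And>i. X i \<subseteq> X (Suc i)"
    obtain k where k: "\<And>i. i \<ge> k \<Longrightarrow> {a \<in> A. f a \<in> X i} = {a \<in> A. f a \<in> X k}"
    proof (rule noethD[OF no, of "\<lambda>i. {a \<in> A. f a \<in> X i}"])
      show "submodule {a \<in> A. f a \<in> X i} R M" "B \<subseteq> {a \<in> A. f a \<in> X i}" for i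
        using sq_iso_vimage(1,2)[OF iso X(1,2)] by auto
      show "{a \<in> A. f a \<in> X i} \<subseteq> {a \<in> A. f a \<in> X (Suc i)}" for i using X(4)[of i] by auto
    qed auto
    have "X i = X k" if "i \<ge> k" for i
      using sq_iso_vimage(3)[OF iso X(1,2,3), of i] sq_iso_vimage(3)[OF iso X(1,2,3), of k]
      unfolding k[OF that] by (rule trans[OF sym])
    then show "\<exists>k. \<forall>i\<ge>k. X i = X k" by blast
  qed
next
  assume no: "noeth R N A' B'"
  show "noeth R M A B"
  proof (rule noethI)
    fix X assume X: "\<And>i::nat. submodule (X i) R M" "\<And>i. B \<subseteq> X i" "\<And>i. X i \<subseteq> A" "\<And>i. X i \<subseteq> X (Suc i)"
    obtain k where k: "\<And>i. i \<ge> k \<Longrightarrow> f ` X i <+>\<^bsub>N\<^esub> B' = f ` X k <+>\<^bsub>N\<^esub> B'"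
    proof (rule noethD[OF no, of "\<lambda>i. f ` X i <+>\<^bsub>N\<^esub> B'"])
      show "submodule (f ` X i <+>\<^bsub>N\<^esub> B') R N" "B' \<subseteq> f ` X i <+>\<^bsub>N\<^esub> B'" "f ` X i <+>\<^bsub>N\<^esub> B' \<subseteq> A'" for i
        using sq_iso_image(1-3)[OF iso X(1,3)] by auto
      show "f ` X i <+>\<^bsub>N\<^esub> B' \<subseteq> f ` X (Suc i) <+>\<^bsub>N\<^esub> B'" for i using X(4) by (intro set_add_mono) auto
    qed blast
    have "X i = X k" if "i \<ge> k" for i
      using sq_iso_image(4)[OF iso X(1,3,2), of i] sq_iso_image(4)[OF iso X(1,3,2), of k]
      unfolding k[OF that] by (rule trans[OF sym])
    then show "\<exists>k. \<forall>i\<ge>k. X i = X k" by blast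
  qed
qed

text \<open>Induction from \<open>A\<close> downwards. If the conclusion failed, every
  counterexample would be properly contained in another one, and dependent choice would produce a
  chain that never stops.\<close>

lemma noeth_induct:
  assumes no: "noeth R M A B" and B: "submodule B R M" "B \<subseteq> A"
    and step: "\<And>N. submodule N R M \<Longrightarrow> B \<subseteq> N \<Longrightarrow> N \<subseteq> A \<Longrightarrow>
      (\<And>N'. submodule N' R M \<Longrightarrow> N \<subset> N' \<Longrightarrow> N' \<subseteq> A \<Longrightarrow> P N') \<Longrightarrow> P N"
  shows "P B"
proof (rule ccontr)
  assume nP: "\<not> P B"
  define Q where "Q N \<longleftrightarrow> submodule N R M \<and> B \<subseteq> N \<and> N \<subseteq> A \<and> \<not> P N" for N
  have "\<exists>f. \<forall>n::nat. Q (f n) \<and> f n \<subset> f (Suc n)"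
  proof (rule dependent_nat_choice)
    show "\<exists>x. Q x" using nP B by (auto simp: Q_def)
    show "\<exists>y. Q y \<and> x \<subset> y" if "Q x" for x and n :: nat
    proof (rule ccontr)
      assume no: "\<nexists>y. Q y \<and> x \<subset> y"
      have x: "submodule x R M" "B \<subseteq> x" "x \<subseteq> A" using that by (auto simp: Q_def)
      have "P N'" if "submodule N' R M" "x \<subset> N'" "N' \<subseteq> A" for N'
        using no that x(2) unfolding Q_def by blast
      then have "P x" by (rule step[OF x])
      then show False using that by (simp add: Q_def)
    qed
  qed
  then obtain f where f: "\<And>n::nat. Q (f n)" "\<And>n. f n \<subset> f (Suc n)" by blast
  obtain k where "\<And>i. i \<ge> k \<Longrightarrow> f i = f k"
  proof (rule noethD[OF no, of f])
    show "submodule (f i) R M" "B \<subseteq> f i" "f i \<subseteq> A" "f i \<subseteq> f (Suc i)" for i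
      using f(1)[of i] psubset_imp_subset[OF f(2)] by (simp_all add: Q_def)
  qed blast
  then show False using f(2)[of k] by (metis le_SucI order.refl psubset_eq)
qed

section \<open>Cyclic and finitely generated submodules\<close>

definition cyclic :: "('a, 'r) ring_scheme \<Rightarrow> ('a, 'b, 'm) module_scheme \<Rightarrow> 'b \<Rightarrow> 'b set" where
  "cyclic R M g = (\<lambda>r. r \<odot>\<^bsub>M\<^esub> g) ` carrier R"

text \<open>Generators are absorbed into the base, so that an induction on the list keeps the top
  module fixed and only enlarges the bottom one.\<close>

fun span_over ::
    "('a, 'r) ring_scheme \<Rightarrow> ('a, 'b, 'm) module_scheme \<Rightarrow> 'b list \<Rightarrow> 'b set \<Rightarrow> 'b set" where
  "span_over R M [] B = B"
| "span_over R M (g # gs) B = span_over R M gs (B <+>\<^bsub>M\<^esub> cyclic R M g)"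

definition ann_sq ::
    "('a, 'r) ring_scheme \<Rightarrow> ('a, 'b, 'm) module_scheme \<Rightarrow> 'b set \<Rightarrow> 'b set \<Rightarrow> 'a set" where
  "ann_sq R M A B = {r \<in> carrier R. \<forall>a\<in>A. r \<odot>\<^bsub>M\<^esub> a \<in> B}"

context module
begin

lemma subm_cyclic: 
  assumes g: "g \<in> carrier M"
  shows "subm (cyclic R M g)"
proof (rule submoduleI)
  show "cyclic R M g \<subseteq> carrier M" using g by (auto simp: cyclic_def)
  show "\<zero>\<^bsub>M\<^esub> \<in> cyclic R M g" unfolding cyclic_def using g by (intro image_eqI[of _ _ \<zero>]) auto
next
  fix a assume "a \<in> cyclic R M g"
  then show "\<ominus>\<^bsub>M\<^esub> a \<in> cyclic R M g"
    using g unfolding cyclic_def by (auto simp: smult_l_minus[symmetric])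
next
  fix a b assume "a \<in> cyclic R M g" "b \<in> cyclic R M g"
  then show "a \<oplus>\<^bsub>M\<^esub> b \<in> cyclic R M g"
    using g unfolding cyclic_def by (auto simp: smult_l_distr[symmetric])
next
  fix r b assume "r \<in> carrier R" "b \<in> cyclic R M g"
  then show "r \<odot>\<^bsub>M\<^esub> b \<in> cyclic R M g"
    using g unfolding cyclic_def by (auto simp: smult_assoc1[symmetric])
qed

lemma mem_cyclic: "g \<in> carrier M \<Longrightarrow> g \<in> cyclic R M g"
  unfolding cyclic_def by (intro image_eqI[of _ _ \<one>]) auto

lemma cyclic_least: "subm A \<Longrightarrow> g \<in> A \<Longrightarrow> cyclic R M g \<subseteq> A"
  unfolding cyclic_def by (auto intro: subm_smult)

lemma subm_span_over: "subm B \<Longrightarrow> set gs \<subseteq> carrier M \<Longrightarrow> subm (span_over R M gs B)"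
  by (induction gs arbitrary: B) (auto intro!: subm_set_add subm_cyclic)

lemma span_over_upper: 
  "subm B \<Longrightarrow> set gs \<subseteq> carrier M \<Longrightarrow> B \<subseteq> span_over R M gs B \<and> set gs \<subseteq> span_over R M gs B"
proof (induction gs arbitrary: B)
  case (Cons g gs)
  have s: "subm (cyclic R M g)" "subm (B <+>\<^bsub>M\<^esub> cyclic R M g)" using Cons.prems by (auto intro: subm_set_add subm_cyclic)
  have "B \<subseteq> B <+>\<^bsub>M\<^esub> cyclic R M g" "g \<in> B <+>\<^bsub>M\<^esub> cyclic R M g"
    using set_add_upper1[OF Cons.prems(1) s(1)] set_add_upper2[OF Cons.prems(1) s(1)] mem_cyclic[of g] Cons.prems by auto
  then show ?case using Cons.IH[OF s(2)] Cons.prems by auto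
qed auto

lemma ideal_ann_sq:
  assumes A: "A \<subseteq> carrier M" and B: "subm B"
  shows "ideal (ann_sq R M A B) R"
proof (rule idealI)
  show "ring R" by (rule R.ring_axioms)
  show "subgroup (ann_sq R M A B) (add_monoid R)"
  proof (rule R.add.subgroupI)
    show "ann_sq R M A B \<noteq> {}" using A subm_zero[OF B] by (auto simp: ann_sq_def intro!: exI[of _ \<zero>])
    fix a assume "a \<in> ann_sq R M A B"
    then show "\<ominus> a \<in> ann_sq R M A B"
      using A subm_neg[OF B] by (auto simp: ann_sq_def smult_l_minus)
  next
    fix a b assume "a \<in> ann_sq R M A B" "b \<in> ann_sq R M A B"
    then show "a \<oplus> b \<in> ann_sq R M A B"
      using A subm_add[OF B] by (auto simp: ann_sq_def smult_l_distr subset_iff)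
  qed (auto simp: ann_sq_def)
  fix a x assume a: "a \<in> ann_sq R M A B" and x: "x \<in> carrier R"
  show "x \<otimes> a \<in> ann_sq R M A B" 
    using a x A subm_smult[OF B] by (auto simp: ann_sq_def smult_assoc1 subset_iff)
  then show "a \<otimes> x \<in> ann_sq R M A B" 
    using a x by (simp add: ann_sq_def R.m_comm)
qed

end

section \<open>Radical conditions\<close>

text \<open>The ideal \<open>(xs) + Ann (A / B)\<close>. For finitely generated \<open>A / B\<close>
  it has the same radical as the annihilator of \<open>A / (B + xs A)\<close>, but it depends on
  \<open>A / B\<close> only through the annihilator of the latter.\<close>

definition par ::
    "('a, 'r) ring_scheme \<Rightarrow> ('a, 'b, 'm) module_scheme \<Rightarrow> 'a list \<Rightarrow> 'b set \<Rightarrow> 'b set \<Rightarrow> 'a set" where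
  "par R M xs A B = Idl\<^bsub>R\<^esub> (set xs) <+>\<^bsub>R\<^esub> ann_sq R M A B"

text \<open>For finitely generated \<open>A / B\<close> the last conjunct says that \<open>A / (B + xs A)\<close> has finite length,
  but unlike that condition it visibly passes to submodules of \<open>A / B\<close>.\<close>

definition good ::
    "('a, 'r) ring_scheme \<Rightarrow> 'a set \<Rightarrow> ('a, 'b, 'm) module_scheme \<Rightarrow> 'a list \<Rightarrow> 'b set \<Rightarrow> 'b set \<Rightarrow> bool" where
  "good R \<mm> M xs A B \<longleftrightarrow>
     submodule A R M \<and> submodule B R M \<and> B \<subseteq> A \<and> set xs \<subseteq> carrier R \<and> noeth R M A B \<and>
     (\<forall>a\<in>\<mm>. \<exists>k::nat. a [^]\<^bsub>R\<^esub> k \<in> par R M xs A B)"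

lemma goodD:
  assumes "good R \<mm> M xs A B"
  shows "submodule A R M" "submodule B R M" "B \<subseteq> A" "set xs \<subseteq> carrier R" "noeth R M A B"
    "\<And>a. a \<in> \<mm> \<Longrightarrow> \<exists>k::nat. a [^]\<^bsub>R\<^esub> k \<in> par R M xs A B"
  using assms unfolding good_def by auto

context module
begin

lemma ideal_par:
  assumes "set xs \<subseteq> carrier R" "subm A" "subm B"
  shows "ideal (par R M xs A B) R"
  unfolding par_def using assms R.genideal_ideal ideal_ann_sq[OF subm_sub] by (intro R.add_ideals) auto

lemma par_upper:
  assumes "set xs \<subseteq> carrier R" "subm A" "subm B"
  shows "set xs \<subseteq> par R M xs A B" "ann_sq R M A B \<subseteq> par R M xs A B" "Idl (set xs) \<subseteq> par R M xs A B"
proof -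
  have I: "ideal (Idl (set xs)) R" "ideal (ann_sq R M A B) R"
    using assms R.genideal_ideal ideal_ann_sq[OF subm_sub] by auto
  have z: "\<zero> \<in> Idl (set xs)" "\<zero> \<in> ann_sq R M A B"
    using I by (simp_all add: additive_subgroup.zero_closed ideal.axioms(1))
  have c: "Idl (set xs) \<subseteq> carrier R" "ann_sq R M A B \<subseteq> carrier R"
    using I ideal.axioms(1) additive_subgroup.a_subset by blast+
  show 1: "Idl (set xs) \<subseteq> par R M xs A B"
    unfolding par_def
  proof
    fix i assume "i \<in> Idl (set xs)"
    then show "i \<in> Idl (set xs) <+>\<^bsub>R\<^esub> ann_sq R M A B"
      using set_addI[of i "Idl (set xs)" \<zero> "ann_sq R M A B" R] z c by auto
  qed
  show "ann_sq R M A B \<subseteq> par R M xs A B"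
    unfolding par_def
  proof
    fix i assume "i \<in> ann_sq R M A B"
    then show "i \<in> Idl (set xs) <+>\<^bsub>R\<^esub> ann_sq R M A B"
      using set_addI[of \<zero> "Idl (set xs)" i "ann_sq R M A B" R] z c by auto
  qed
  show "set xs \<subseteq> par R M xs A B"
    using 1 R.genideal_self[OF assms(1)] by blast
qed

lemma par_least:
  assumes "ideal J R" "set xs \<subseteq> J" "ann_sq R M A B \<subseteq> J"
  shows "par R M xs A B \<subseteq> J"
proof
  fix z assume "z \<in> par R M xs A B"
  then obtain i c where "i \<in> Idl (set xs)" "c \<in> ann_sq R M A B" "z = i \<oplus> c"
    unfolding par_def by (rule set_addE)
  then show "z \<in> J"
    using R.genideal_minimal[OF assms(1,2)] assms(3) additive_subgroup.a_closed[OF ideal.axioms(1)[OF assms(1)]] by blast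
qed

text \<open>Annihilators grow on passing to a subquotient \<open>C / D\<close>, and an element of
  \<open>xs\<close> that kills \<open>C / D\<close> lies in the new annihilator. So
  \<open>par\<close> can only become larger.\<close>

lemma good_change:
  assumes g: "good R \<mm> M xs A B"
    and s: "subm C" "subm D" "B \<subseteq> D" "D \<subseteq> C" "C \<subseteq> A"
    and ys: "set ys \<subseteq> carrier R"
    and x: "\<And>x. x \<in> set xs \<Longrightarrow> x \<in> Idl (set ys) \<or> scale M x C \<subseteq> D"
  shows "good R \<mm> M ys C D"
proof -
  note D = goodD[OF g]
  have "par R M xs A B \<subseteq> par R M ys C D"
  proof (rule par_least)
    show "ideal (par R M ys C D) R" by (rule ideal_par[OF ys s(1,2)])
    have "ann_sq R M A B \<subseteq> ann_sq R M C D" using s by (auto simp: ann_sq_def)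
    then show "ann_sq R M A B \<subseteq> par R M ys C D" using par_upper(2)[OF ys s(1,2)] by blast
    show "set xs \<subseteq> par R M ys C D"
    proof
      fix z assume z: "z \<in> set xs"
      from x[OF z] show "z \<in> par R M ys C D"
      proof
        assume "scale M z C \<subseteq> D"
        then have "z \<in> ann_sq R M C D" using z D(4) by (auto simp: ann_sq_def scale_def)
        then show ?thesis using par_upper(2)[OF ys s(1,2)] by blast
      qed (use par_upper(3)[OF ys s(1,2)] in blast)
    qed
  qed
  moreover have "noeth R M C D" using noeth_sub[OF D(5) s(5,3)] .
  ultimately show ?thesis using D(6) s ys unfolding good_def by blast
qed

lemma good_sub:
  assumes "good R \<mm> M xs A B" "subm C" "subm D" "B \<subseteq> D" "D \<subseteq> C" "C \<subseteq> A"
  shows "good R \<mm> M xs C D"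
  using good_change[OF assms goodD(4)[OF assms(1)]] R.genideal_self[OF goodD(4)[OF assms(1)]] by blast

lemma good_kill:
  assumes "good R \<mm> M (x # xs) A B" "subm C" "subm D" "B \<subseteq> D" "D \<subseteq> C" "C \<subseteq> A" "scale M x C \<subseteq> D"
  shows "good R \<mm> M xs C D"
proof (rule good_change[OF assms(1-6)])
  show "set xs \<subseteq> carrier R" using goodD(4)[OF assms(1)] by auto
  then show "z \<in> Idl (set xs) \<or> scale M z C \<subseteq> D" if "z \<in> set (x # xs)" for z
    using that assms(7) R.genideal_self[of "set xs"] by auto
qed

lemma good_set:
  assumes "good R \<mm> M xs A B" "set xs \<subseteq> set ys" "set ys \<subseteq> carrier R"
  shows "good R \<mm> M ys A B"
  using assms R.genideal_self[OF assms(3)] by (intro good_change[OF assms(1)] goodD[OF assms(1)]) auto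

text \<open>The product lies in every ideal that contains one of the factors.\<close>

lemma good_mult_left:
  assumes g: "good R \<mm> M (x \<otimes> y # xs) A B" and c: "x \<in> carrier R" "y \<in> carrier R"
  shows "good R \<mm> M (x # xs) A B" "good R \<mm> M (y # xs) A B"
proof -
  have xs: "set xs \<subseteq> carrier R" using goodD(4)[OF g] by simp
  have mem: "x \<otimes> y \<in> Idl (set (z # xs))" if "z = x \<or> z = y" for z
  proof -
    have "set (z # xs) \<subseteq> carrier R" using xs c that by auto
    then have I: "ideal (Idl (set (z # xs))) R" "z \<in> Idl (set (z # xs))"
      using R.genideal_ideal R.genideal_self[of "set (z # xs)"] by auto
    show ?thesis using that ideal.I_r_closed[OF I] ideal.I_l_closed[OF I] c by auto
  qed
  have "good R \<mm> M (z # xs) A B" if "z = x \<or> z = y" for z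
  proof (rule good_change[OF g goodD(1,2)[OF g] order.refl goodD(3)[OF g] order.refl])
    show zs: "set (z # xs) \<subseteq> carrier R" using xs c that by auto
    show "w \<in> Idl (set (z # xs)) \<or> scale M w A \<subseteq> B" if "w \<in> set (x \<otimes> y # xs)" for w
      using that mem[OF \<open>z = x \<or> z = y\<close>] R.genideal_self[OF zs] by auto
  qed
  then show "good R \<mm> M (x # xs) A B" "good R \<mm> M (y # xs) A B" by auto
qed

end

context cring
begin

lemma ideal_carrier: "ideal I R \<Longrightarrow> a \<in> I \<Longrightarrow> a \<in> carrier R"
  by (rule additive_subgroup.a_Hcarr[OF ideal.axioms(1)])

lemma ideal_add: "ideal I R \<Longrightarrow> a \<in> I \<Longrightarrow> b \<in> I \<Longrightarrow> a \<oplus> b \<in> I"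
  by (rule additive_subgroup.a_closed[OF ideal.axioms(1)])

lemma ideal_mult: "ideal I R \<Longrightarrow> a \<in> I \<Longrightarrow> r \<in> carrier R \<Longrightarrow> r \<otimes> a \<in> I" "ideal I R \<Longrightarrow> a \<in> I \<Longrightarrow> r \<in> carrier R \<Longrightarrow> a \<otimes> r \<in> I"
  by (rule ideal.I_l_closed ideal.I_r_closed; assumption)+

lemma binomial_mult:
  "a \<in> carrier R \<Longrightarrow> b \<in> carrier R \<Longrightarrow> c \<in> carrier R \<Longrightarrow> d \<in> carrier R \<Longrightarrow>
    (a \<oplus> b) \<otimes> (c \<oplus> d) = a \<otimes> (c \<oplus> d) \<oplus> (b \<otimes> c \<oplus> b \<otimes> d)"
  by (simp add: l_distr r_distr a_ac)

end

context module
begin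

text \<open>Let \<open>a^k = i + c\<close> and \<open>a^l = j + d\<close>, with \<open>i\<close>,
  \<open>j\<close> in the ideal of \<open>xs\<close>, \<open>c A\<close> inside \<open>C\<close> and
  \<open>d C\<close> inside \<open>B\<close>. In the product of the two, \<open>c d\<close>
  annihilates \<open>A / B\<close> and all other terms lie in the ideal of
  \<open>xs\<close>.\<close>

lemma good_ext:
  assumes AC: "good R \<mm> M xs A C" and CB: "good R \<mm> M xs C B" and m: "\<mm> \<subseteq> carrier R"
  shows "good R \<mm> M xs A B"
proof -
  note D = goodD[OF AC] and D' = goodD[OF CB]
  have P: "ideal (par R M xs A B) R" by (rule ideal_par[OF D(4,1) D'(2)])
  note up = par_upper[OF D(4,1) D'(2)]
  have I: "ideal (Idl (set xs)) R" using R.genideal_ideal[OF D(4)] .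
  have "\<exists>k::nat. a [^] k \<in> par R M xs A B" if a: "a \<in> \<mm>" for a
  proof -
    have ac: "a \<in> carrier R" using a m by auto
    from D(6)[OF a] obtain k :: nat and i c where k: "i \<in> Idl (set xs)" "c \<in> ann_sq R M A C" "a [^] k = i \<oplus> c"
      unfolding par_def by (blast elim: set_addE)
    from D'(6)[OF a] obtain l :: nat and j d where l: "j \<in> Idl (set xs)" "d \<in> ann_sq R M C B" "a [^] l = j \<oplus> d"
      unfolding par_def by (blast elim: set_addE)
    have car: "i \<in> carrier R" "j \<in> carrier R" "c \<in> carrier R" "d \<in> carrier R"
      using k l R.ideal_carrier[OF I] by (auto simp: ann_sq_def)
    have "c \<otimes> d = d \<otimes> c" using car R.m_comm by auto
    then have "c \<otimes> d \<in> ann_sq R M A B"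
      using k(2) l(2) car subm_carrier[OF D(1)] by (auto simp: ann_sq_def smult_assoc1)
    moreover have "a [^] (k + l) = i \<otimes> (j \<oplus> d) \<oplus> (c \<otimes> j \<oplus> c \<otimes> d)"
      using ac car k l R.nat_pow_mult[OF ac, of k l] R.binomial_mult by simp
    moreover have "i \<otimes> (j \<oplus> d) \<in> par R M xs A B" "c \<otimes> j \<in> par R M xs A B"
      using R.ideal_mult[OF P] k(1) l(1) up car by auto
    ultimately have "a [^] (k + l) \<in> par R M xs A B"
      using R.ideal_add[OF P] subsetD[OF up(2)] by simp
    then show ?thesis by blast
  qed
  moreover have "noeth R M A B" using noeth_ext[OF D(5) D'(5) D(1) D'(2) D(2) D'(3) D(3)] .
  ultimately show ?thesis unfolding good_def using D D' by auto
qed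

text \<open>Modulo \<open>J\<close>, which is \<open>par\<close> for the remaining parameters, one
  power of \<open>a\<close> is a multiple of \<open>x\<close> and another one a multiple of
  \<open>y\<close>; their product is a multiple of \<open>x y\<close> modulo
  \<open>J\<close>.\<close>

lemma good_mult:
  assumes gx: "good R \<mm> M (x # xs) A B" and gy: "good R \<mm> M (y # xs) A B" and m: "\<mm> \<subseteq> carrier R"
  shows "good R \<mm> M (x \<otimes> y # xs) A B"
proof -
  note D = goodD[OF gx] and D' = goodD[OF gy]
  have xy: "x \<in> carrier R" "y \<in> carrier R" and xs: "set xs \<subseteq> carrier R" using D(4) D'(4) by auto
  then have xyc: "set (x \<otimes> y # xs) \<subseteq> carrier R" by auto
  define J where "J = par R M xs A B"
  have J: "ideal J R" unfolding J_def by (rule ideal_par[OF xs D(1,2)])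
  have P: "ideal (par R M (x \<otimes> y # xs) A B) R" by (rule ideal_par[OF xyc D(1,2)])
  have xyP: "x \<otimes> y \<in> par R M (x \<otimes> y # xs) A B" using par_upper(1)[OF xyc D(1,2)] by auto
  have JP: "J \<subseteq> par R M (x \<otimes> y # xs) A B"
    unfolding J_def using par_upper[OF xyc D(1,2)] by (intro par_least[OF P]) auto
  \<comment> \<open>Splitting off the first parameter: \<open>par\<close> for \<open>z # xs\<close>
    is contained in the sum of the principal ideal of \<open>z\<close> and \<open>J\<close>.\<close>
  have dec: "\<exists>r\<in>carrier R. \<exists>j\<in>J. u = r \<otimes> z \<oplus> j" if u: "u \<in> par R M (z # xs) A B" and z: "z \<in> carrier R" for u z
  proof -
    have "par R M (z # xs) A B \<subseteq> PIdl z <+>\<^bsub>R\<^esub> J"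
    proof (rule par_least)
      show "ideal (PIdl z <+>\<^bsub>R\<^esub> J) R" by (rule R.add_ideals[OF R.cgenideal_ideal[OF z] J])
      have "j \<in> PIdl z <+>\<^bsub>R\<^esub> J" if "j \<in> J" for j
        using set_addI[of \<zero> "PIdl z" j J R] that R.ideal_carrier[OF J that] 
          additive_subgroup.zero_closed[OF ideal.axioms(1)[OF R.cgenideal_ideal[OF z]]] by simp
      moreover have "z \<in> PIdl z <+>\<^bsub>R\<^esub> J"
        using set_addI[of z "PIdl z" \<zero> J R] R.cgenideal_self[OF z] z
          additive_subgroup.zero_closed[OF ideal.axioms(1)[OF J]] by simp
      ultimately show "set (z # xs) \<subseteq> PIdl z <+>\<^bsub>R\<^esub> J" "ann_sq R M A B \<subseteq> PIdl z <+>\<^bsub>R\<^esub> J"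
        using par_upper(1,2)[OF xs D(1,2)] unfolding J_def[symmetric] by auto
    qed
    then have "u \<in> PIdl z <+>\<^bsub>R\<^esub> J" using u by blast
    then show ?thesis unfolding cgenideal_def by (blast elim: set_addE)
  qed
  have "\<exists>k::nat. a [^] k \<in> par R M (x \<otimes> y # xs) A B" if a: "a \<in> \<mm>" for a
  proof -
    have ac: "a \<in> carrier R" using a m by auto
    from D(6)[OF a] dec[OF _ xy(1)] obtain k :: nat and r i where k: "r \<in> carrier R" "i \<in> J" "a [^] k = r \<otimes> x \<oplus> i"
      by blast
    from D'(6)[OF a] dec[OF _ xy(2)] obtain l :: nat and s j where l: "s \<in> carrier R" "j \<in> J" "a [^] l = s \<otimes> y \<oplus> j"
      by blast
    have car: "i \<in> carrier R" "j \<in> carrier R" using k l R.ideal_carrier[OF J] by auto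
    have "a [^] (k + l) = (i \<oplus> r \<otimes> x) \<otimes> (j \<oplus> s \<otimes> y)"
      using ac car k l xy R.nat_pow_mult[OF ac, of k l] R.a_comm by simp
    also have "\<dots> = i \<otimes> (j \<oplus> s \<otimes> y) \<oplus> ((r \<otimes> x) \<otimes> j \<oplus> (r \<otimes> x) \<otimes> (s \<otimes> y))"
      using car k l xy by (intro R.binomial_mult) auto
    also have "(r \<otimes> x) \<otimes> (s \<otimes> y) = (r \<otimes> s) \<otimes> (x \<otimes> y)" using k l xy by (simp add: R.m_ac)
    finally have "a [^] (k + l) = i \<otimes> (j \<oplus> s \<otimes> y) \<oplus> ((r \<otimes> x) \<otimes> j \<oplus> (r \<otimes> s) \<otimes> (x \<otimes> y))" .
    moreover have "i \<otimes> (j \<oplus> s \<otimes> y) \<in> J" "(r \<otimes> x) \<otimes> j \<in> J" using R.ideal_mult[OF J] k l xy car by auto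
    moreover have "(r \<otimes> s) \<otimes> (x \<otimes> y) \<in> par R M (x \<otimes> y # xs) A B" using R.ideal_mult[OF P xyP] k l by auto
    ultimately have "a [^] (k + l) \<in> par R M (x \<otimes> y # xs) A B"
      using R.ideal_add[OF P] subsetD[OF JP] by simp
    then show ?thesis by blast
  qed
  then show ?thesis unfolding good_def using D xyc by auto
qed

end

lemma sq_iso_ann:
  assumes iso: "sq_iso R M N f A B A' B'"
  shows "ann_sq R M A B = ann_sq R N A' B'"
proof -
  note D = sq_isoD[OF iso]
  interpret M: module R M by (rule D)
  interpret N: module R N by (rule D)
  have car: "\<And>a. a \<in> A' \<Longrightarrow> a \<in> carrier N" "\<And>a. a \<in> B' \<Longrightarrow> a \<in> carrier N"
    using N.subm_carrier D(6,7) by auto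
  have f: "r \<odot>\<^bsub>M\<^esub> a \<in> B \<longleftrightarrow> r \<odot>\<^bsub>N\<^esub> f a \<in> B'" if "r \<in> carrier R" "a \<in> A" for r a
    using D(10)[OF that] M.subm_smult[OF D(3) that] by (subst D(12)) auto
  have "(\<forall>a\<in>A. r \<odot>\<^bsub>N\<^esub> f a \<in> B') \<longleftrightarrow> (\<forall>a\<in>A'. r \<odot>\<^bsub>N\<^esub> a \<in> B')" if r: "r \<in> carrier R" for r
  proof
    assume *: "\<forall>a\<in>A. r \<odot>\<^bsub>N\<^esub> f a \<in> B'"
    show "\<forall>a\<in>A'. r \<odot>\<^bsub>N\<^esub> a \<in> B'"
    proof
      fix z assume "z \<in> A'"
      then obtain a b where z: "a \<in> A" "b \<in> B'" "z = f a \<oplus>\<^bsub>N\<^esub> b" using D(11) by (blast elim: set_addE)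
      then have "r \<odot>\<^bsub>N\<^esub> z = r \<odot>\<^bsub>N\<^esub> f a \<oplus>\<^bsub>N\<^esub> r \<odot>\<^bsub>N\<^esub> b"
        using r car sq_iso_closed[OF iso] by (simp add: N.smult_r_distr)
      then show "r \<odot>\<^bsub>N\<^esub> z \<in> B'"
        using * z N.subm_add[OF D(7)] N.subm_smult[OF D(7) r] by simp
    qed
  qed (use sq_iso_closed[OF iso] in blast)
  moreover have "(\<forall>a\<in>A. r \<odot>\<^bsub>M\<^esub> a \<in> B) \<longleftrightarrow> (\<forall>a\<in>A. r \<odot>\<^bsub>N\<^esub> f a \<in> B')" if "r \<in> carrier R" for r
    using f[OF that] by simp
  ultimately show ?thesis unfolding ann_sq_def by (intro Collect_cong) blast
qed

lemma sq_iso_good: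
  assumes iso: "sq_iso R M N f A B A' B'"
  shows "good R \<mm> M xs A B \<longleftrightarrow> good R \<mm> N xs A' B'"
  unfolding good_def par_def sq_iso_ann[OF iso] sq_iso_noeth[OF iso] using sq_isoD(3-8)[OF iso] by simp

section \<open>Finite length over a Noetherian local ring\<close>

locale lmod = noetherian_local_ring R \<mm> + module R M
  for R (structure) and \<mm> and M (structure)

section \<open>Units of the local ring\<close>

context noetherian_local_ring
begin

lemma ideal_m: "ideal \<mm> R"
  using maximal maximalideal.axioms(1) by blast

lemma m_carrier: "\<mm> \<subseteq> carrier R"
  using ideal_m ideal_carrier by blast

lemma one_notin_m: "\<one> \<notin> \<mm>"
  using maximalideal.I_notcarr[OF maximal] ideal.one_imp_carrier[OF ideal_m] by auto

text \<open>A non-unit generates a proper ideal, which Zorn's lemma enlarges to a maximal one, that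
  is, to \<open>\<mm>\<close>. Upper bounds are immediate, because in a Noetherian ring a nonempty
  chain of ideals contains its union.\<close>

lemma unit_if_notin_m:
  assumes r: "r \<in> carrier R" "r \<notin> \<mm>"
  shows "\<exists>s\<in>carrier R. s \<otimes> r = \<one>"
proof (rule ccontr)
  assume no: "\<not> ?thesis"
  define S where "S = {I. ideal I R \<and> PIdl r \<subseteq> I \<and> \<one> \<notin> I}"
  have rS: "PIdl r \<in> S" 
    using no r cgenideal_ideal unfolding S_def by (auto simp: cgenideal_def)
  have "\<exists>I\<in>S. \<forall>X\<in>S. I \<subseteq> X \<longrightarrow> X = I"
  proof (rule subset_Zorn)
    fix C assume C: "subset.chain S C"
    show "\<exists>U\<in>S. \<forall>X\<in>C. X \<subseteq> U"
    proof (cases "C = {}")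
      case False
      have "subset.chain {I. ideal I R} C"
        using C unfolding pred_on.chain_def S_def by auto
      then have "\<Union>C \<in> C" by (rule ideal_chain_is_trivial[OF False])
      moreover have "\<Union>C \<in> S" using C calculation unfolding pred_on.chain_def by auto
      ultimately show ?thesis by (intro bexI[of _ "\<Union>C"]) auto
    qed (use rS in auto)
  qed
  then obtain I where I: "I \<in> S" "\<And>X. X \<in> S \<Longrightarrow> I \<subseteq> X \<Longrightarrow> X = I" by blast
  have "maximalideal I R"
  proof (rule maximalidealI)
    show "ideal I R" using I(1) by (simp add: S_def)
    show "carrier R \<noteq> I" using I(1) one_closed by (auto simp: S_def)
    fix J assume J: "ideal J R" "I \<subseteq> J" "J \<subseteq> carrier R"
    show "J = I \<or> J = carrier R"
    proof (cases "\<one> \<in> J")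
      case True
      then show ?thesis using ideal.one_imp_carrier[OF J(1)] by auto
    next
      case False
      then have "J \<in> S" using J I(1) by (auto simp: S_def)
      then show ?thesis using I(2) J by auto
    qed
  qed
  then have "I = \<mm>" by (rule unique_maximal)
  moreover have "r \<in> I" using I(1) cgenideal_self[OF r(1)] by (auto simp: S_def)
  ultimately show False using r by simp
qed

lemma one_minus_unit:
  assumes a: "a \<in> \<mm>"
  shows "\<exists>s\<in>carrier R. s \<otimes> (\<one> \<ominus> a) = \<one>"
proof (rule unit_if_notin_m)
  have ac: "a \<in> carrier R" using a m_carrier by auto
  then show "\<one> \<ominus> a \<in> carrier R" by simp
  show "\<one> \<ominus> a \<notin> \<mm>"
  proof
    assume "\<one> \<ominus> a \<in> \<mm>"
    then have "(\<one> \<ominus> a) \<oplus> a \<in> \<mm>" using ideal_add[OF ideal_m] a by auto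
    then show False using ac one_notin_m by (simp add: a_minus_def a_assoc l_neg)
  qed
qed

end

section \<open>Maximal submodules, nilpotency and socles\<close>

context lmod
begin

lemma len_pos: 
  assumes "subm A" "subm B" "B \<subset> A"
  shows "1 \<le> len R M A B"
proof -
  have "chain_between R M A B (Suc 0)"
    using chain_between_Suc[OF chain_between_0[OF assms(2) order.refl] assms(1,3)] .
  then show ?thesis using enat_le_len_iff[OF assms(1)] assms(3) by (simp add: one_enat_def)
qed

text \<open>Nakayama's argument for a simple quotient: if \<open>z = a u\<close> were outside
  \<open>A'\<close>, then \<open>A = A' + R z\<close>, so \<open>u = n + r a u\<close> with
  \<open>n\<close> in \<open>A'\<close>; as \<open>1 - r a\<close> is a unit, \<open>u\<close> and
  with it \<open>z\<close> would lie in \<open>A'\<close>.\<close>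

lemma maximal_submodule_smult:
  assumes s: "subm A" "subm A'" "A' \<subseteq> A" and a: "a \<in> \<mm>" 
    and max: "\<And>X. subm X \<Longrightarrow> A' \<subseteq> X \<Longrightarrow> X \<subseteq> A \<Longrightarrow> X = A' \<or> X = A"
  shows "scale M a A \<subseteq> A'"
proof
  have ac: "a \<in> carrier R" using a m_carrier by auto
  fix z assume "z \<in> scale M a A"
  then obtain u where u: "u \<in> A" "z = a \<odot>\<^bsub>M\<^esub> u" by (auto simp: scale_def)
  have uc: "u \<in> carrier M" and zA: "z \<in> A" and zc: "z \<in> carrier M"
    using u s ac subm_carrier subm_smult by auto
  show "z \<in> A'"
  proof (rule ccontr)
    assume nz: "z \<notin> A'"
    let ?X = "A' <+>\<^bsub>M\<^esub> cyclic R M z"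
    have X: "subm ?X" "A' \<subseteq> ?X" "cyclic R M z \<subseteq> ?X"
      using s subm_cyclic[OF zc] subm_set_add set_add_upper1 set_add_upper2 by auto
    have "?X \<subseteq> A" using s cyclic_least[OF s(1) zA] by (intro set_add_least) auto
    moreover have "z \<in> ?X" using X mem_cyclic[OF zc] by auto
    ultimately have "?X = A" using max[OF X(1,2)] nz by blast
    then have "u \<in> ?X" using u by simp
    then obtain n r where n: "n \<in> A'" "r \<in> carrier R" "u = n \<oplus>\<^bsub>M\<^esub> r \<odot>\<^bsub>M\<^esub> z"
      by (auto simp: cyclic_def elim!: set_addE)
    have nc: "n \<in> carrier M" using n s subm_carrier by auto
    have "(\<one> \<ominus> r \<otimes> a) \<odot>\<^bsub>M\<^esub> u = u \<ominus>\<^bsub>M\<^esub> r \<odot>\<^bsub>M\<^esub> z"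
      using n(2) ac uc u(2) by (simp add: a_minus_def smult_l_distr smult_l_minus smult_assoc1)
    also have "\<dots> = n" using subm_eq_minus(1)[OF n(3) nc] n(2) zc by simp
    finally have eq: "(\<one> \<ominus> r \<otimes> a) \<odot>\<^bsub>M\<^esub> u = n" .
    have "r \<otimes> a \<in> \<mm>" using ideal_mult[OF ideal_m a n(2)] by simp
    then obtain t where t: "t \<in> carrier R" "t \<otimes> (\<one> \<ominus> r \<otimes> a) = \<one>" using one_minus_unit by blast
    have "t \<odot>\<^bsub>M\<^esub> n = u" unfolding eq[symmetric]
      using t n(2) ac uc by (simp add: smult_assoc1[symmetric])
    then have "u \<in> A'" using subm_smult[OF s(2) t(1) n(1)] by simp
    then show False using nz u subm_smult[OF s(2) ac] by simp
  qed
qed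

text \<open>Induction on the length: \<open>a\<close> maps \<open>A\<close> into a maximal proper
  submodule \<open>A'\<close> above \<open>B\<close>, and a power of \<open>a\<close> maps the
  shorter module \<open>A' / B\<close> to zero.\<close>

lemma finite_len_nilpotent:
  assumes s: "subm A" "subm B" "B \<subseteq> A" and fin: "len R M A B \<noteq> \<infinity>" and a: "a \<in> \<mm>"
  shows "\<exists>k::nat. a [^] k \<in> ann_sq R M A B"
  using s fin
proof (induction "the_enat (len R M A B)" arbitrary: A rule: less_induct)
  case less
  note s = less.prems(1-3) and fin = less.prems(4)
  have ac: "a \<in> carrier R" using a m_carrier by auto
  show ?case
  proof (cases "A = B")
    case True
    then have "a [^] (0::nat) \<in> ann_sq R M A B" using s subm_carrier by (auto simp: ann_sq_def)
    then show ?thesis by blast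
  next
    case False
    define Q where "Q X \<longleftrightarrow> subm X \<and> B \<subseteq> X \<and> X \<subset> A" for X
    have "Q B" using False s by (auto simp: Q_def)
    then obtain A' where A': "Q A'" "\<And>X. Q X \<Longrightarrow> the_enat (len R M A A') \<le> the_enat (len R M A X)"
      using ex_has_least_nat[of Q B "\<lambda>X. the_enat (len R M A X)"] by blast
    have sA': "subm A'" "B \<subseteq> A'" "A' \<subseteq> A" "A' \<noteq> A" using A'(1) by (auto simp: Q_def)
    have "X = A' \<or> X = A" if X: "subm X" "A' \<subseteq> X" "X \<subseteq> A" for X
    proof (rule ccontr)
      \<comment> \<open>Maximality of \<open>A'\<close> was encoded as least length of
        \<open>A / A'\<close>; a submodule strictly between \<open>A'\<close> and \<open>A\<close>
        would give a smaller length.\<close>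
      assume no: "\<not> ?thesis"
      then have QX: "Q X" using X sA' by (auto simp: Q_def)
      have 1: "len R M A A' = len R M A X + len R M X A'" by (rule len_add[OF s(1) sA'(1) X(1,2,3)])
      have 2: "len R M A B = len R M A A' + len R M A' B" by (rule len_add[OF s(1,2) sA'(1,2,3)])
      have 3: "1 \<le> len R M X A'" using len_pos[OF X(1) sA'(1)] X no by auto
      show False
        using A'(2)[OF QX] 1 2 3 fin
        by (cases "len R M A X"; cases "len R M X A'"; cases "len R M A' B") (auto simp: one_enat_def)
    qed
    then have aA: "scale M a A \<subseteq> A'" by (rule maximal_submodule_smult[OF s(1) sA'(1,3) a])
    have 2: "len R M A B = len R M A A' + len R M A' B" by (rule len_add[OF s(1,2) sA'(1,2,3)])
    have 3: "1 \<le> len R M A A'" using len_pos[OF s(1) sA'(1)] sA' by auto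
    have "the_enat (len R M A' B) < the_enat (len R M A B)" "len R M A' B \<noteq> \<infinity>"
      using 2 3 fin by (cases "len R M A A'"; cases "len R M A' B"; auto simp: one_enat_def)+
    then obtain k :: nat where k: "a [^] k \<in> ann_sq R M A' B" using less.hyps sA' s by blast
    have "a [^] k \<odot>\<^bsub>M\<^esub> (a \<odot>\<^bsub>M\<^esub> u) \<in> B" if "u \<in> A" for u
      using k aA that by (auto simp: ann_sq_def scale_def)
    then have "a [^] Suc k \<in> ann_sq R M A B"
      using ac subm_carrier[OF s(1)] by (auto simp: ann_sq_def smult_assoc1)
    then show ?thesis by blast
  qed
qed

text \<open>The generators of \<open>\<mm>\<close> are treated one at a time: \<open>u\<close> is
  replaced by its last multiple \<open>a^j u\<close> outside \<open>B\<close>, which is still taken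
  into \<open>B\<close> by the generators treated before.\<close>

lemma socle_element:
  assumes s: "subm A" "subm B" "B \<subseteq> A" "A \<noteq> B"
    and nil: "\<And>a. a \<in> \<mm> \<Longrightarrow> \<exists>k::nat. a [^] k \<in> ann_sq R M A B"
  shows "\<exists>u\<in>A - B. \<forall>a\<in>\<mm>. a \<odot>\<^bsub>M\<^esub> u \<in> B"
proof -
  obtain F where F: "F \<subseteq> carrier R" "finite F" "\<mm> = Idl F" using finetely_gen[OF ideal_m] by blast
  have "\<exists>u\<in>A - B. \<forall>a\<in>F. a \<odot>\<^bsub>M\<^esub> u \<in> B" if "finite F" "F \<subseteq> \<mm>" for F
    using that
  proof (induction F)
    case empty
    then show ?case using s by auto
  next
    case (insert a F)
    then obtain u where u: "u \<in> A" "u \<notin> B" "\<forall>b\<in>F. b \<odot>\<^bsub>M\<^esub> u \<in> B" by auto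
    have uc: "u \<in> carrier M" using u s subm_carrier by auto
    have ac: "a \<in> carrier R" using insert.prems m_carrier by auto
    \<comment> \<open>The least exponent is positive because \<open>u\<close> itself is not in
      \<open>B\<close>; the exponent before it gives the new element.\<close>
    define k where "k = (LEAST k::nat. a [^] k \<odot>\<^bsub>M\<^esub> u \<in> B)"
    have "\<exists>k::nat. a [^] k \<odot>\<^bsub>M\<^esub> u \<in> B" using nil[of a] insert.prems u by (auto simp: ann_sq_def)
    then have kB: "a [^] k \<odot>\<^bsub>M\<^esub> u \<in> B" unfolding k_def by (rule LeastI_ex)
    then obtain j where j: "k = Suc j" using u uc by (cases k) auto
    let ?v = "a [^] j \<odot>\<^bsub>M\<^esub> u"
    have vB: "?v \<notin> B" using not_less_Least[of j "\<lambda>k. a [^] k \<odot>\<^bsub>M\<^esub> u \<in> B"] j unfolding k_def by auto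
    have vA: "?v \<in> A" using subm_smult[OF s(1) _ u(1)] ac by simp
    have "a \<odot>\<^bsub>M\<^esub> ?v \<in> B" using kB j ac uc by (simp add: smult_assoc1 smult_swap[of a])
    moreover have "b \<odot>\<^bsub>M\<^esub> ?v \<in> B" if "b \<in> F" for b
      using that u(3) ac uc insert.prems m_carrier subm_smult[OF s(2)] by (subst smult_swap) auto
    ultimately show ?case using vA vB by (intro bexI[of _ ?v]) auto
  qed
  then obtain u where u: "u \<in> A" "u \<notin> B" "\<forall>a\<in>F. a \<odot>\<^bsub>M\<^esub> u \<in> B"
    using F genideal_self by (metis DiffE)
  have "F \<subseteq> ann_sq R M {u} B" using u F by (auto simp: ann_sq_def)
  moreover have "ideal (ann_sq R M {u} B) R" using u s subm_carrier by (intro ideal_ann_sq) auto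
  ultimately have "\<mm> \<subseteq> ann_sq R M {u} B" unfolding F(3) by (intro genideal_minimal)
  then show ?thesis using u by (auto simp: ann_sq_def intro!: bexI[of _ u])
qed

text \<open>\<open>(B + R u) / B\<close> is a quotient of the residue field. Concretely, a
  coefficient of \<open>u\<close> outside \<open>\<mm>\<close> is a unit and brings \<open>u\<close>
  into \<open>X\<close>, while a coefficient inside \<open>\<mm>\<close> contributes only to
  \<open>B\<close>.\<close>

lemma socle_interval:
  assumes B: "subm B" and u: "u \<in> carrier M" and mu: "\<And>a. a \<in> \<mm> \<Longrightarrow> a \<odot>\<^bsub>M\<^esub> u \<in> B"
    and X: "subm X" "B \<subseteq> X" "X \<subseteq> B <+>\<^bsub>M\<^esub> cyclic R M u"
  shows "X = B \<or> X = B <+>\<^bsub>M\<^esub> cyclic R M u"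
proof (cases "u \<in> X")
  case True
  then have "B <+>\<^bsub>M\<^esub> cyclic R M u \<subseteq> X" using X by (intro set_add_least cyclic_least) auto
  then show ?thesis using X by auto
next
  case False
  have "X \<subseteq> B"
  proof
    fix z assume z: "z \<in> X"
    then have "z \<in> B <+>\<^bsub>M\<^esub> cyclic R M u" using X by auto
    then obtain b r where b: "b \<in> B" "r \<in> carrier R" "z = b \<oplus>\<^bsub>M\<^esub> r \<odot>\<^bsub>M\<^esub> u"
      by (auto simp: cyclic_def elim!: set_addE)
    have "r \<in> \<mm>"
    proof (rule ccontr)
      assume "r \<notin> \<mm>"
      then obtain t where t: "t \<in> carrier R" "t \<otimes> r = \<one>" using unit_if_notin_m b by blast
      have "r \<odot>\<^bsub>M\<^esub> u \<in> X" using subm_cancel'[OF X(1), of b] b z X u by auto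
      then have "t \<odot>\<^bsub>M\<^esub> (r \<odot>\<^bsub>M\<^esub> u) \<in> X" by (rule subm_smult[OF X(1) t(1)])
      then show False using False t b u by (simp add: smult_assoc1[symmetric])
    qed
    then show "z \<in> B" using b mu subm_add[OF B] by simp
  qed
  then show ?thesis using X by auto
qed

text \<open>Without parameters \<open>par\<close> is the annihilator, so every element of
  \<open>\<mm>\<close> acts nilpotently on \<open>A / N\<close> for each \<open>N\<close> between
  \<open>B\<close> and \<open>A\<close>. As long as \<open>N\<close> is not \<open>A\<close>, there
  is a socle element modulo \<open>N\<close>; adjoining it costs finite length, and Noetherian
  induction takes care of the rest.\<close>

lemma good_Nil_finite:
  assumes g: "good R \<mm> M [] A B"
  shows "len R M A B \<noteq> \<infinity>"
proof -
  note D = goodD[OF g]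
  have "par R M [] A B \<subseteq> ann_sq R M A B"
    using par_least[OF ideal_ann_sq[OF subm_sub[OF D(1)] D(2)]] by simp
  then have nil: "\<exists>k::nat. a [^] k \<in> ann_sq R M A B" if "a \<in> \<mm>" for a using D(6)[OF that] by blast
  show ?thesis
  proof (rule noeth_induct[OF D(5,2,3)])
    fix N assume N: "subm N" "B \<subseteq> N" "N \<subseteq> A"
      and IH: "\<And>N'. subm N' \<Longrightarrow> N \<subset> N' \<Longrightarrow> N' \<subseteq> A \<Longrightarrow> len R M A N' \<noteq> \<infinity>"
    show "len R M A N \<noteq> \<infinity>"
    proof (cases "N = A")
      case True
      then show ?thesis using len_self[OF D(1)] by simp
    next
      case False
      have "\<exists>u\<in>A - N. \<forall>a\<in>\<mm>. a \<odot>\<^bsub>M\<^esub> u \<in> N"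
      proof (rule socle_element[OF D(1) N(1,3)])
        have "ann_sq R M A B \<subseteq> ann_sq R M A N" using N by (auto simp: ann_sq_def)
        then show "\<exists>k::nat. a [^] k \<in> ann_sq R M A N" if "a \<in> \<mm>" for a using nil[OF that] by blast
      qed (use False in auto)
      then obtain u where u: "u \<in> A" "u \<notin> N" "\<And>a. a \<in> \<mm> \<Longrightarrow> a \<odot>\<^bsub>M\<^esub> u \<in> N" by blast
      have uc: "u \<in> carrier M" using u D subm_carrier by auto
      let ?N = "N <+>\<^bsub>M\<^esub> cyclic R M u"
      have s: "subm ?N" "N \<subseteq> ?N" "?N \<subseteq> A" "u \<in> ?N"
        using subm_set_add[OF N(1) subm_cyclic[OF uc]] set_add_upper1[OF N(1) subm_cyclic[OF uc]]
          set_add_least[OF D(1) N(3) cyclic_least[OF D(1) u(1)]]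
          subsetD[OF set_add_upper2[OF N(1) subm_cyclic[OF uc]] mem_cyclic[OF uc]] by blast+
      \<comment> \<open>Three distinct nested submodules do not fit into an interval that has only
        its two ends.\<close>
      have "\<not> chain_between R M ?N N 2"
      proof
        assume "chain_between R M ?N N 2"
        then obtain X where X: "\<forall>i\<le>2. subm (X i) \<and> N \<subseteq> X i \<and> X i \<subseteq> ?N" "\<forall>i<2. X i \<subset> X (Suc i)"
          unfolding chain_between_def by blast
        have "X i = N \<or> X i = ?N" if "i \<le> 2" for i
          using socle_interval[OF N(1) uc u(3), of "X i"] X(1) that by auto
        then have "X 0 = N \<or> X 0 = ?N" "X 1 = N \<or> X 1 = ?N" "X 2 = N \<or> X 2 = ?N" by auto
        moreover have "X 0 \<subset> X 1" "X 1 \<subset> X 2" using X(2) by (auto simp: numeral_2_eq_2)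
        ultimately show False by (metis order.strict_trans psubset_eq)
      qed
      then have "\<not> enat 2 \<le> len R M ?N N" using enat_le_len_iff[OF s(1,2)] by simp
      then have "len R M ?N N \<noteq> \<infinity>" by (metis enat_ord_code(3))
      moreover have "len R M A ?N \<noteq> \<infinity>" using IH[OF s(1) _ s(3)] s(2,4) u(2) by blast
      ultimately show ?thesis using len_add[OF D(1) N(1) s(1,2,3)] by (simp del: not_infinity_eq add: plus_eq_infty_iff_enat)
    qed
  qed
qed

text \<open>A submodule between \<open>B\<close> and \<open>B + R g\<close> is determined by the
  ideal of all \<open>r\<close> with \<open>r g\<close> in it, so the chain condition of the ring
  applies.\<close>

lemma noeth_cyclic:
  assumes B: "subm B" and g: "g \<in> carrier M"
  shows "noeth R M (B <+>\<^bsub>M\<^esub> cyclic R M g) B"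
proof (rule noethI)
  fix N assume N: "\<And>i::nat. subm (N i)" "\<And>i. B \<subseteq> N i" "\<And>i. N i \<subseteq> B <+>\<^bsub>M\<^esub> cyclic R M g"
    "\<And>i. N i \<subseteq> N (Suc i)"
  define I where "I i = ann_sq R M {g} (N i)" for i
  have mono: "I i \<subseteq> I j" if "i \<le> j" for i j
    using lift_Suc_mono_le[of N, OF N(4) that] by (auto simp: I_def ann_sq_def)
  have "subset.chain {J. ideal J R} (range I)"
    unfolding pred_on.chain_def
  proof (intro conjI ballI)
    show "range I \<subseteq> {J. ideal J R}" unfolding I_def using ideal_ann_sq[OF _ N(1)] g by auto
    fix x y assume "x \<in> range I" "y \<in> range I"
    then obtain i j where "x = I i" "y = I j" by blast
    then have "x \<subseteq> y \<or> y \<subseteq> x" using mono[of i j] mono[of j i] nat_le_linear[of i j] by blast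
    then show "(\<subset>)\<^sup>=\<^sup>= x y \<or> (\<subset>)\<^sup>=\<^sup>= y x" by (auto simp: psubset_eq)
  qed
  then have "\<Union>(range I) \<in> range I" by (intro ideal_chain_is_trivial) auto
  then obtain k where k: "I i \<subseteq> I k" for i by blast
  have "N i = N k" if "i \<ge> k" for i
  proof
    show "N k \<subseteq> N i" by (rule lift_Suc_mono_le[of N, OF N(4) that])
    show "N i \<subseteq> N k"
    proof
      fix z assume z: "z \<in> N i"
      then have "z \<in> B <+>\<^bsub>M\<^esub> cyclic R M g" using N(3) by blast
      then obtain b r where b: "b \<in> B" "r \<in> carrier R" "z = b \<oplus>\<^bsub>M\<^esub> r \<odot>\<^bsub>M\<^esub> g"
        by (auto simp: cyclic_def elim!: set_addE)
      have "r \<odot>\<^bsub>M\<^esub> g \<in> N i" using subm_cancel'[OF N(1)[of i], of b] b z N(2)[of i] g by auto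
      then have "r \<in> I k" using k[of i] b by (auto simp: I_def ann_sq_def)
      then show "z \<in> N k" using b N(2)[of k] subm_add[OF N(1)[of k]] by (auto simp: I_def ann_sq_def)
    qed
  qed
  then show "\<exists>k. \<forall>i\<ge>k. N i = N k" by blast
qed

lemma noeth_span_over:
  "subm B \<Longrightarrow> set gs \<subseteq> carrier M \<Longrightarrow> noeth R M (span_over R M gs B) B"
proof (induction gs arbitrary: B)
  case Nil
  show ?case
  proof (rule noethI)
    fix N :: "nat \<Rightarrow> _" assume "\<And>i. B \<subseteq> N i" "\<And>i. N i \<subseteq> span_over R M [] B"
    then have "N i = B" for i by (simp add: subset_antisym)
    then show "\<exists>k. \<forall>i\<ge>k. N i = N k" by simp
  qed
next
  case (Cons g gs)
  have s: "subm (cyclic R M g)" "subm (B <+>\<^bsub>M\<^esub> cyclic R M g)" using Cons.prems by (auto intro: subm_set_add subm_cyclic)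
  have gs: "set gs \<subseteq> carrier M" using Cons.prems by auto
  have g: "g \<in> carrier M" using Cons.prems by auto
  show ?case unfolding span_over.simps
    by (rule noeth_ext[OF Cons.IH[OF s(2) gs] noeth_cyclic[OF Cons.prems(1) g] subm_span_over[OF s(2) gs]
      Cons.prems(1) s(2) set_add_upper1[OF Cons.prems(1) s(1)] conjunct1[OF span_over_upper[OF s(2) gs]]])
qed

end

section \<open>Quotients by parameters and the determinant trick\<close>

primrec lin :: "('a, 'b, 'm) module_scheme \<Rightarrow> 'a list \<Rightarrow> 'b set \<Rightarrow> 'b set \<Rightarrow> 'b set" where
  "lin M [] A B = B"
| "lin M (x # xs) A B = scale M x A <+>\<^bsub>M\<^esub> lin M xs A B"

lemma lin_append: "lin M (xs @ ys) A B = lin M xs A (lin M ys A B)"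
  by (induction xs) auto

context module
begin

lemma subm_lin: "set xs \<subseteq> carrier R \<Longrightarrow> subm A \<Longrightarrow> subm B \<Longrightarrow> subm (lin M xs A B)"
  by (induction xs) (auto intro!: subm_intros)

lemma lin_mono: "A \<subseteq> A' \<Longrightarrow> B \<subseteq> B' \<Longrightarrow> lin M xs A B \<subseteq> lin M xs A' B'"
  by (induction xs) (simp_all add: set_add_mono scale_mono)

lemma lin_upper: 
  "set xs \<subseteq> carrier R \<Longrightarrow> subm A \<Longrightarrow> subm B \<Longrightarrow> B \<subseteq> lin M xs A B \<and> (\<forall>x\<in>set xs. scale M x A \<subseteq> lin M xs A B)"
proof (induction xs)
  case (Cons x xs)
  have s: "subm (scale M x A)" "subm (lin M xs A B)" using Cons.prems subm_scale subm_lin by auto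
  have IH: "B \<subseteq> lin M xs A B" "\<forall>x\<in>set xs. scale M x A \<subseteq> lin M xs A B" using Cons by simp_all
  show ?case unfolding lin.simps list.set
    using order.trans[OF IH(1) set_add_upper2[OF s]] order.trans[OF bspec[OF IH(2)] set_add_upper2[OF s]]
      set_add_upper1[OF s] by blast
qed auto

lemma lin_least:
  "subm C \<Longrightarrow> B \<subseteq> C \<Longrightarrow> (\<And>x. x \<in> set xs \<Longrightarrow> scale M x A \<subseteq> C) \<Longrightarrow> lin M xs A B \<subseteq> C"
proof (induction xs)
  case (Cons x xs)
  then show ?case by (simp add: set_add_least)
qed auto

lemma lin_subset: "set xs \<subseteq> carrier R \<Longrightarrow> subm A \<Longrightarrow> B \<subseteq> A \<Longrightarrow> lin M xs A B \<subseteq> A"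
  by (intro lin_least scale_subset) auto

lemma lin_cong_set:
  assumes "set xs = set ys" "set xs \<subseteq> carrier R" "subm A" "subm B"
  shows "lin M xs A B = lin M ys A B"
  using assms lin_upper[of xs A B] lin_upper[of ys A B] subm_lin[of xs A B] subm_lin[of ys A B]
  by (intro subset_antisym lin_least) auto

text \<open>Multiplication by \<open>c\<close> pushes all of \<open>A\<close> into
  \<open>B + R g\<close>, hence an \<open>xs\<close>-combination of elements of \<open>A\<close>
  into \<open>B + I g\<close>. This provides the coefficient \<open>j\<close> in
  \<open>power_in_par\<close>.\<close>

lemma lin_mult_mod:
  assumes s: "subm A" "subm B" "subm (cyclic R M g)" and c: "c \<in> carrier R" and g: "g \<in> carrier M"
    and cA: "scale M c A \<subseteq> B <+>\<^bsub>M\<^esub> cyclic R M g"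
    and I: "ideal I R" "set xs \<subseteq> I" and u: "u \<in> lin M xs A B"
  shows "\<exists>i\<in>I. \<exists>b\<in>B. c \<odot>\<^bsub>M\<^esub> u = b \<oplus>\<^bsub>M\<^esub> i \<odot>\<^bsub>M\<^esub> g"
  using I(2) u
proof (induction xs arbitrary: u)
  case Nil
  then show ?case using subm_smult[OF s(2) c] subm_carrier[OF s(2)] g
      additive_subgroup.zero_closed[OF ideal.axioms(1)[OF I(1)]] 
    by (intro bexI[of _ \<zero>] bexI[of _ "c \<odot>\<^bsub>M\<^esub> u"]) auto
next
  case (Cons x xs)
  from Cons.prems(2) obtain a v where u: "a \<in> A" "v \<in> lin M xs A B" "u = x \<odot>\<^bsub>M\<^esub> a \<oplus>\<^bsub>M\<^esub> v"
    by (auto simp: scale_def elim!: set_addE)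
  obtain i b where i: "i \<in> I" "b \<in> B" "c \<odot>\<^bsub>M\<^esub> v = b \<oplus>\<^bsub>M\<^esub> i \<odot>\<^bsub>M\<^esub> g"
    using Cons.IH[OF _ u(2)] Cons.prems(1) by auto
  have "c \<odot>\<^bsub>M\<^esub> a \<in> B <+>\<^bsub>M\<^esub> cyclic R M g" using cA u by (auto simp: scale_def)
  then obtain b' r where b': "b' \<in> B" "r \<in> carrier R" "c \<odot>\<^bsub>M\<^esub> a = b' \<oplus>\<^bsub>M\<^esub> r \<odot>\<^bsub>M\<^esub> g"
    by (auto simp: cyclic_def elim!: set_addE)
  have xI: "x \<in> I" using Cons.prems by auto
  have xs: "set xs \<subseteq> carrier R" "x \<in> carrier R" "i \<in> carrier R"
    using Cons.prems R.ideal_carrier[OF I(1)] i by auto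
  have car: "a \<in> carrier M" "v \<in> carrier M" "b \<in> carrier M" "b' \<in> carrier M"
    using u i b' subm_carrier s subm_lin[OF xs(1) s(1,2)] by auto
  have "c \<odot>\<^bsub>M\<^esub> u = x \<odot>\<^bsub>M\<^esub> (c \<odot>\<^bsub>M\<^esub> a) \<oplus>\<^bsub>M\<^esub> c \<odot>\<^bsub>M\<^esub> v"
    using u car xs c by (simp add: smult_r_distr smult_swap)
  also have "\<dots> = (x \<odot>\<^bsub>M\<^esub> b' \<oplus>\<^bsub>M\<^esub> (x \<otimes> r) \<odot>\<^bsub>M\<^esub> g) \<oplus>\<^bsub>M\<^esub> (b \<oplus>\<^bsub>M\<^esub> i \<odot>\<^bsub>M\<^esub> g)"
    using b' i car xs g by (simp add: smult_r_distr smult_assoc1)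
  also have "\<dots> = (x \<odot>\<^bsub>M\<^esub> b' \<oplus>\<^bsub>M\<^esub> b) \<oplus>\<^bsub>M\<^esub> (x \<otimes> r \<oplus> i) \<odot>\<^bsub>M\<^esub> g"
    using b' car xs g by (simp add: add4 smult_l_distr)
  finally have "c \<odot>\<^bsub>M\<^esub> u = (x \<odot>\<^bsub>M\<^esub> b' \<oplus>\<^bsub>M\<^esub> b) \<oplus>\<^bsub>M\<^esub> (x \<otimes> r \<oplus> i) \<odot>\<^bsub>M\<^esub> g" .
  moreover have "x \<odot>\<^bsub>M\<^esub> b' \<oplus>\<^bsub>M\<^esub> b \<in> B" using subm_add[OF s(2)] subm_smult[OF s(2)] b' i xs by auto
  moreover have "x \<otimes> r \<oplus> i \<in> I" using R.ideal_add[OF I(1)] R.ideal_mult[OF I(1) xI] b' i by auto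
  ultimately show ?case by blast
qed

text \<open>A substitute for the determinant trick, by induction on the number of generators: if
  \<open>a\<^sup>n = i + c\<close> with \<open>c A \<subseteq> B + R g\<close> and \<open>c a g - j g \<in> B\<close>, then \<open>c (c a - j)\<close> annihilates \<open>A / B\<close>.\<close>

lemma power_in_par:
  assumes xs: "set xs \<subseteq> carrier R" and a: "a \<in> carrier R"
    and B: "subm B" and gs: "set gs \<subseteq> carrier M" and aA: "scale M a (span_over R M gs B) \<subseteq> lin M xs (span_over R M gs B) B"
  shows "\<exists>n::nat. a [^] n \<in> par R M xs (span_over R M gs B) B"
  using B gs aA
proof (induction gs arbitrary: B)
  case Nil
  have "a [^] (0::nat) \<in> ann_sq R M (span_over R M [] B) B"
    using Nil subm_carrier by (auto simp: ann_sq_def)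
  then show ?case using par_upper(2)[OF xs] Nil by (metis span_over.simps(1) subsetD)
next
  case (Cons g gs)
  define B1 where "B1 = B <+>\<^bsub>M\<^esub> cyclic R M g"
  define A where "A = span_over R M gs B1"
  have A: "span_over R M (g # gs) B = A" by (simp add: A_def B1_def)
  have g: "g \<in> carrier M" "set gs \<subseteq> carrier M" using Cons.prems by auto
  have s: "subm B" "subm (cyclic R M g)" "subm B1" "subm A"
    using Cons.prems subm_cyclic subm_set_add subm_span_over g by (auto simp: B1_def A_def)
  have BB1: "B \<subseteq> B1" "g \<in> B1"
    using set_add_upper1[OF s(1,2)] set_add_upper2[OF s(1,2)] mem_cyclic[OF g(1)] by (auto simp: B1_def)
  have B1A: "B1 \<subseteq> A" using span_over_upper[OF s(3) g(2)] by (simp add: A_def)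
  have aA: "scale M a A \<subseteq> lin M xs A B" using Cons.prems(3) A by simp
  then have "scale M a A \<subseteq> lin M xs A B1" using lin_mono[OF order.refl BB1(1)] by blast
  then obtain n :: nat where "a [^] n \<in> par R M xs A B1" using Cons.IH[OF s(3) g(2)] by (auto simp: A_def)
  then obtain i c where n: "i \<in> Idl (set xs)" "c \<in> ann_sq R M A B1" "a [^] n = i \<oplus> c"
    unfolding par_def by (blast elim: set_addE)
  have I: "ideal (Idl (set xs)) R" "set xs \<subseteq> Idl (set xs)" using R.genideal_ideal R.genideal_self xs by auto
  have cc: "c \<in> carrier R" and cA: "scale M c A \<subseteq> B <+>\<^bsub>M\<^esub> cyclic R M g"
    using n(2) by (auto simp: ann_sq_def scale_def B1_def)
  have "a \<odot>\<^bsub>M\<^esub> g \<in> lin M xs A B" using aA BB1 B1A by (auto simp: scale_def)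
  then obtain j b where j: "j \<in> Idl (set xs)" "b \<in> B" "c \<odot>\<^bsub>M\<^esub> (a \<odot>\<^bsub>M\<^esub> g) = b \<oplus>\<^bsub>M\<^esub> j \<odot>\<^bsub>M\<^esub> g"
    using lin_mult_mod[OF s(4,1,2) cc g(1) cA I] by blast
  have jc: "j \<in> carrier R" "i \<in> carrier R" "b \<in> carrier M" using j n R.ideal_carrier[OF I(1)] subm_carrier s by auto
  define e where "e = c \<otimes> a \<ominus> j"
  have ec: "e \<in> carrier R" using cc a jc by (simp add: e_def)
  have eg: "e \<odot>\<^bsub>M\<^esub> g = b"
    using subm_eq_minus(1)[OF j(3)] jc g a cc
    by (simp add: e_def a_minus_def smult_l_distr smult_l_minus smult_assoc1)
  have eB1: "e \<odot>\<^bsub>M\<^esub> z \<in> B" if z: "z \<in> B1" for z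
  proof -
    from z obtain b' r where z: "b' \<in> B" "r \<in> carrier R" "z = b' \<oplus>\<^bsub>M\<^esub> r \<odot>\<^bsub>M\<^esub> g"
      unfolding B1_def by (auto simp: cyclic_def elim!: set_addE)
    have "e \<odot>\<^bsub>M\<^esub> z = e \<odot>\<^bsub>M\<^esub> b' \<oplus>\<^bsub>M\<^esub> r \<odot>\<^bsub>M\<^esub> b"
      using z ec g subm_carrier[OF s(1) z(1)] by (simp add: smult_r_distr smult_swap[of e] eg)
    then show ?thesis using z j subm_add[OF s(1)] subm_smult[OF s(1)] ec by simp
  qed
  have "e \<otimes> c \<in> ann_sq R M A B"
    using n(2) ec cc eB1 subm_carrier[OF s(4)] by (auto simp: ann_sq_def smult_assoc1)
  then have ecP: "e \<otimes> c \<in> par R M xs A B" using subsetD[OF par_upper(2)[OF xs s(4,1)]] by blast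
  have P: "ideal (par R M xs A B) R" by (rule ideal_par[OF xs s(4,1)])
  note up = par_upper[OF xs s(4,1)]
  have ca: "c \<otimes> a = e \<oplus> j" using cc a jc by (simp add: e_def a_minus_def R.a_assoc R.l_neg)
  \<comment> \<open>Modulo the ideal of \<open>xs\<close> this power is \<open>c (c a)\<close>. The
    extra factor \<open>a\<close> is what allows \<open>c a\<close> to be replaced by
    \<open>e + j\<close>, which leaves \<open>e c\<close>, an annihilator of
    \<open>A / B\<close>.\<close>
  have "a [^] (n + (n + 1)) = (i \<oplus> c) \<otimes> ((i \<oplus> c) \<otimes> a)"
    using n(3) a R.nat_pow_mult[OF a, of n "n + 1"] by simp
  also have "\<dots> = i \<otimes> ((i \<oplus> c) \<otimes> a) \<oplus> c \<otimes> ((i \<oplus> c) \<otimes> a)"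
    using jc cc a by (simp add: R.l_distr)
  also have "c \<otimes> ((i \<oplus> c) \<otimes> a) = i \<otimes> (c \<otimes> a) \<oplus> c \<otimes> (c \<otimes> a)"
    using jc cc a by (simp add: R.l_distr R.r_distr R.m_ac)
  also have "c \<otimes> (c \<otimes> a) = e \<otimes> c \<oplus> c \<otimes> j" unfolding ca using ec cc jc by (simp add: R.r_distr R.m_comm)
  finally have "a [^] (n + (n + 1)) = i \<otimes> ((i \<oplus> c) \<otimes> a) \<oplus> (i \<otimes> (c \<otimes> a) \<oplus> (e \<otimes> c \<oplus> c \<otimes> j))" .
  moreover have "i \<otimes> ((i \<oplus> c) \<otimes> a) \<in> par R M xs A B" "i \<otimes> (c \<otimes> a) \<in> par R M xs A B" "c \<otimes> j \<in> par R M xs A B"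
    using R.ideal_mult[OF P] subsetD[OF up(3)] n(1) j(1) jc cc a by auto
  ultimately have "a [^] (n + (n + 1)) \<in> par R M xs A B"
    using R.ideal_add[OF P] ecP by simp
  then show ?case unfolding A by blast
qed

end

text \<open>Finite length makes some power of \<open>a\<close> map \<open>A\<close> into
  \<open>B + xs A\<close>; \<open>power_in_par\<close>, applied to that power, then moves the
  information from the quotient into the ring.\<close>

lemma (in lmod) good_if_finite_len:
  assumes B: "subm B" and gs: "set gs \<subseteq> carrier M" "A = span_over R M gs B"
    and xs: "set xs \<subseteq> carrier R" and fin: "len R M A (lin M xs A B) \<noteq> \<infinity>"
  shows "good R \<mm> M xs A B"
proof -
  have A: "subm A" "B \<subseteq> A" using subm_span_over[OF B gs(1)] span_over_upper[OF B gs(1)] gs(2) by auto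
  have L: "subm (lin M xs A B)" "lin M xs A B \<subseteq> A" using subm_lin lin_subset A B xs by auto
  have "\<exists>k::nat. a [^] k \<in> par R M xs A B" if a: "a \<in> \<mm>" for a
  proof -
    have ac: "a \<in> carrier R" using a m_carrier by auto
    obtain k :: nat where k: "a [^] k \<in> ann_sq R M A (lin M xs A B)"
      using finite_len_nilpotent[OF A(1) L fin a] by blast
    then have "scale M (a [^] k) A \<subseteq> lin M xs A B" by (auto simp: ann_sq_def scale_def)
    then obtain n :: nat where "(a [^] k) [^] n \<in> par R M xs A B"
      using power_in_par[OF xs _ B gs(1), of "a [^] k"] ac gs(2) by auto
    then show ?thesis using nat_pow_pow[OF ac] by metis
  qed
  then show ?thesis unfolding good_def using A B xs noeth_span_over[OF B gs(1)] gs(2) by simp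
qed

lemma (in module) fin_gen_span:
  assumes "fin_gen_module R M"
  obtains gs where "set gs \<subseteq> carrier M" "carrier M = span_over R M gs {\<zero>\<^bsub>M\<^esub>}"
proof -
  obtain G where G: "G \<subseteq> carrier M" "finite G" "gen_submodule R M G = carrier M"
    using assms unfolding fin_gen_module_def by blast
  obtain gs where gs: "set gs = G" using finite_list[OF G(2)] by blast
  have s: "subm (span_over R M gs {\<zero>\<^bsub>M\<^esub>})" "G \<subseteq> span_over R M gs {\<zero>\<^bsub>M\<^esub>}"
    using subm_span_over[OF subm_zero_set] span_over_upper[OF subm_zero_set] gs G by auto
  then have "gen_submodule R M G \<subseteq> span_over R M gs {\<zero>\<^bsub>M\<^esub>}" unfolding gen_submodule_def by blast
  then show ?thesis using that[of gs] gs G subm_sub[OF s(1)] by auto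
qed

section \<open>Multiplicities of subquotients\<close>

text \<open>The Serre multiplicity of \<open>A / B\<close>, computed by the recursion
  \<open>e(x, xs; N) = e(xs; N / x N) - e(xs; 0 :\<^bsub>N\<^esub> x)\<close>. Both modules on the right are again subquotients of
  the ambient module \<open>M\<close>, so that the recursion never leaves the type of \<open>M\<close>.\<close>

primrec emult ::
    "('a, 'r) ring_scheme \<Rightarrow> ('a, 'b, 'm) module_scheme \<Rightarrow> 'a list \<Rightarrow> 'b set \<Rightarrow> 'b set \<Rightarrow> int" where
  "emult R M [] = (\<lambda>A B. int (the_enat (len R M A B)))"
| "emult R M (x # xs) =
     (\<lambda>A B. emult R M xs A (B <+>\<^bsub>M\<^esub> scale M x A) - emult R M xs (colon M x A B) B)"

lemma sq_iso_emult:
  "sq_iso R M N f A B A' B' \<Longrightarrow> set xs \<subseteq> carrier R \<Longrightarrow> emult R M xs A B = emult R N xs A' B'"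
proof (induction xs arbitrary: A B A' B')
  case Nil
  then show ?case using sq_iso_len by fastforce
next
  case (Cons x xs)
  have x: "x \<in> carrier R" "set xs \<subseteq> carrier R" using Cons.prems by auto
  show ?case
    using Cons.IH[OF sq_iso_scale[OF Cons.prems(1) x(1)] x(2)] Cons.IH[OF sq_iso_colon[OF Cons.prems(1) x(1)] x(2)]
    by simp
qed

lemma colon_restrict: "A' \<subseteq> A \<Longrightarrow> colon M x A D \<subseteq> A' \<Longrightarrow> colon M x A' D = colon M x A D"
  by (auto simp: colon_def)

context module
begin

lemma emult_id:
  assumes "subm A" "subm B" "set xs \<subseteq> carrier R"
  shows "emult R M xs (A <+>\<^bsub>M\<^esub> B) B = emult R M xs A (A \<inter> B)"
  using sq_iso_emult[OF sq_iso_id[OF assms(1,2)] assms(3)] by simp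

lemma emult_smult:
  assumes "x \<in> carrier R" "subm A" "subm B" "set xs \<subseteq> carrier R"
  shows "emult R M xs (scale M x A <+>\<^bsub>M\<^esub> B) B = emult R M xs A (colon M x A B)"
  using sq_iso_emult[OF sq_iso_smult[OF assms(1-3)] assms(4)] by simp

text \<open>The shape in which images of multiplication maps occur: by \<open>scale_colon\<close>
  such an image is an intersection \<open>S \<inter> X\<close>, and it is taken modulo
  \<open>B + Z\<close> with \<open>Z\<close> inside \<open>S\<close>.\<close>

lemma modular_absorb:
  assumes s: "subm X" "subm S" "subm B" "subm Z" and le: "B \<subseteq> X" "Z \<subseteq> S" "Z \<subseteq> X"
  shows "(S \<inter> X) <+>\<^bsub>M\<^esub> (B <+>\<^bsub>M\<^esub> Z) = X \<inter> (B <+>\<^bsub>M\<^esub> S)"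
proof -
  have SX: "subm (S \<inter> X)" using s by (intro subm_intros)
  have "(S \<inter> X) <+>\<^bsub>M\<^esub> (B <+>\<^bsub>M\<^esub> Z) = ((S \<inter> X) <+>\<^bsub>M\<^esub> Z) <+>\<^bsub>M\<^esub> B"
    using set_add_comm[OF s(3,4)] set_add_assoc[OF SX s(4,3)] by simp
  also have "(S \<inter> X) <+>\<^bsub>M\<^esub> Z = S \<inter> X" using le by (intro set_add_absorb2 SX s) auto
  also have "(S \<inter> X) <+>\<^bsub>M\<^esub> B = X \<inter> (S <+>\<^bsub>M\<^esub> B)" using modular_law[OF s(1,2,3) le(1)] by (simp add: Int_commute)
  finally show ?thesis using set_add_comm[OF s(2,3)] by simp
qed

text \<open>When the recursion reaches \<open>x\<close>, the kernel and the cokernel of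
  \<open>x\<close> are both all of \<open>A / B\<close> and their contributions cancel. At an
  earlier parameter \<open>y\<close>, \<open>x\<close> also kills kernel and cokernel of
  \<open>y\<close>, and both terms vanish by induction.\<close>

lemma emult_kill:
  "x \<in> set xs \<Longrightarrow> set xs \<subseteq> carrier R \<Longrightarrow> subm A \<Longrightarrow> subm B \<Longrightarrow> B \<subseteq> A \<Longrightarrow> scale M x A \<subseteq> B \<Longrightarrow>
    emult R M xs A B = 0"
proof (induction xs arbitrary: A B)
  case (Cons y ys)
  have y: "y \<in> carrier R" "set ys \<subseteq> carrier R" using Cons.prems by auto
  have s: "subm (scale M y A)" "subm (colon M y A B)" "subm (B <+>\<^bsub>M\<^esub> scale M y A)"
    using Cons.prems y by (auto intro!: subm_intros)
  show ?case
  proof (cases "y = x")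
    case True
    then have "B <+>\<^bsub>M\<^esub> scale M y A = B" using Cons.prems s by (intro set_add_absorb2) auto
    moreover have "colon M y A B = A" using True Cons.prems by (auto simp: colon_def scale_def)
    ultimately show ?thesis by simp
  next
    case False
    then have x: "x \<in> set ys" using Cons.prems by auto
    have "emult R M ys A (B <+>\<^bsub>M\<^esub> scale M y A) = 0"
      using Cons.prems s y set_add_upper1[OF Cons.prems(4) s(1)] scale_subset[OF y(1) Cons.prems(3)]
      by (intro Cons.IH[OF x y(2)] set_add_least) auto
    moreover have "emult R M ys (colon M y A B) B = 0"
      using Cons.prems s y subset_colon[OF y(1) Cons.prems(4,5)] scale_mono[OF colon_subset[of M y A B], of M x]
      by (intro Cons.IH[OF x y(2)]) auto
    ultimately show ?thesis by simp
  qed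
qed simp

lemma emult_self:
  assumes "set xs \<subseteq> carrier R" "subm A"
  shows "emult R M xs A A = 0"
proof (cases xs)
  case Nil
  then show ?thesis using len_self[OF assms(2)] by (simp add: zero_enat_def)
next
  case (Cons x ys)
  then show ?thesis using emult_kill[of x xs A A] assms scale_subset[of x A] by auto
qed

end

section \<open>Additivity, powers, order of the parameters, nonnegativity\<close>

context lmod
begin

text \<open>The six terms of the snake lemma for multiplication by \<open>x\<close> on \<open>0 \<rightarrow> C / B \<rightarrow> A / B \<rightarrow> A / C \<rightarrow> 0\<close>.\<close>

lemma emult_add:
  "good R \<mm> M xs A B \<Longrightarrow> subm C \<Longrightarrow> B \<subseteq> C \<Longrightarrow> C \<subseteq> A \<Longrightarrow>
    emult R M xs A B = emult R M xs A C + emult R M xs C B"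
proof (induction xs arbitrary: A B C)
  case Nil
  note D = goodD[OF Nil(1)]
  have "len R M A C \<noteq> \<infinity>" "len R M C B \<noteq> \<infinity>"
    using good_Nil_finite good_sub[OF Nil(1)] D Nil by blast+
  then show ?case using len_add[OF D(1,2) Nil(2,3,4)]
    by (cases "len R M A C"; cases "len R M C B") auto
next
  case (Cons x xs)
  note g = Cons.prems(1) and le = Cons.prems(3,4)
  note D = goodD[OF g]
  have x: "x \<in> carrier R" "set xs \<subseteq> carrier R" using D(4) by auto
  have BA: "B \<subseteq> A" using le by auto
  have s: "subm A" "subm B" "subm C" "subm (scale M x A)" "subm (scale M x C)"
    "subm (colon M x A B)" "subm (colon M x A C)" "subm (colon M x C B)"
    "subm (B <+>\<^bsub>M\<^esub> scale M x A)" "subm (C <+>\<^bsub>M\<^esub> scale M x A)" "subm (B <+>\<^bsub>M\<^esub> scale M x C)"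
    using D Cons.prems(2) x by (auto intro!: subm_intros)
  have sc: "scale M x A \<subseteq> A" "scale M x C \<subseteq> C" "scale M x C \<subseteq> scale M x A"
    using scale_subset[OF x(1)] s scale_mono[OF le(2), of M x] by blast+
  have up: "B \<subseteq> B <+>\<^bsub>M\<^esub> scale M x A" "scale M x A \<subseteq> B <+>\<^bsub>M\<^esub> scale M x A" 
     "B \<subseteq> B <+>\<^bsub>M\<^esub> scale M x C" "scale M x C \<subseteq> B <+>\<^bsub>M\<^esub> scale M x C"
    using set_add_upper1 set_add_upper2 s by auto
  have le1: "B <+>\<^bsub>M\<^esub> scale M x A \<subseteq> A" "C <+>\<^bsub>M\<^esub> scale M x A \<subseteq> A" "B <+>\<^bsub>M\<^esub> scale M x C \<subseteq> C"
    using set_add_least[OF s(1) BA sc(1)] set_add_least[OF s(1) le(2) sc(1)] set_add_least[OF s(3) le(1) sc(2)]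
    by blast+
  have le2: "B <+>\<^bsub>M\<^esub> scale M x A \<subseteq> C <+>\<^bsub>M\<^esub> scale M x A" "B <+>\<^bsub>M\<^esub> scale M x C \<subseteq> B <+>\<^bsub>M\<^esub> scale M x A"
    using set_add_mono[OF le(1) order.refl] set_add_mono[OF order.refl sc(3)] by blast+
  have col: "B \<subseteq> colon M x A B" "C \<subseteq> colon M x A C" "B \<subseteq> colon M x C B"
      "colon M x A B \<subseteq> colon M x A C" "colon M x C B \<subseteq> colon M x A B"
    using subset_colon[OF x(1)] s le BA colon_mono[OF order.refl le(1), of M x A]
      colon_mono[OF le(2) order.refl, of M x B] by blast+
  have colA: "colon M x A B \<subseteq> A" "colon M x A C \<subseteq> A" "colon M x C B \<subseteq> C" by (rule colon_subset)+
  have g1: "good R \<mm> M xs A (B <+>\<^bsub>M\<^esub> scale M x A)"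
    by (rule good_kill[OF g s(1,9) up(1) le1(1) order.refl up(2)])
  have g2: "good R \<mm> M xs C (B <+>\<^bsub>M\<^esub> scale M x C)"
    by (rule good_kill[OF g s(3,11) up(3) le1(3) le(2) up(4)])
  have g3: "good R \<mm> M xs (colon M x A C) C"
    by (rule good_kill[OF g s(7,3) le(1) col(2) colA(2)]) (auto simp: scale_colon)
  have g4: "good R \<mm> M xs (colon M x A B) B"
    by (rule good_kill[OF g s(6,2) order.refl col(1) colA(1)]) (auto simp: scale_colon)
  have mid: "subm (C \<inter> (B <+>\<^bsub>M\<^esub> scale M x A))" "subm (colon M x A B <+>\<^bsub>M\<^esub> C)"
    using s by (auto intro!: subm_intros)
  \<comment> \<open>By induction each of the four modules is cut at the image of the preceding map
    of the snake sequence. The isomorphisms \<open>i1\<close>, \<open>i2\<close> and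
    \<open>i3\<close> match each coimage with the corresponding image, and the sum
    telescopes.\<close>
  have e1: "emult R M xs A (B <+>\<^bsub>M\<^esub> scale M x A) =
      emult R M xs A (C <+>\<^bsub>M\<^esub> scale M x A) + emult R M xs (C <+>\<^bsub>M\<^esub> scale M x A) (B <+>\<^bsub>M\<^esub> scale M x A)"
    by (rule Cons.IH[OF g1 s(10) le2(1) le1(2)])
  have e2: "emult R M xs C (B <+>\<^bsub>M\<^esub> scale M x C) =
      emult R M xs C (C \<inter> (B <+>\<^bsub>M\<^esub> scale M x A)) + emult R M xs (C \<inter> (B <+>\<^bsub>M\<^esub> scale M x A)) (B <+>\<^bsub>M\<^esub> scale M x C)"
    by (rule Cons.IH[OF g2 mid(1)]) (use le1 le2 in auto)
  have e3: "emult R M xs (colon M x A C) C =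
      emult R M xs (colon M x A C) (colon M x A B <+>\<^bsub>M\<^esub> C) + emult R M xs (colon M x A B <+>\<^bsub>M\<^esub> C) C"
    by (rule Cons.IH[OF g3 mid(2) set_add_upper2[OF s(6,3)] set_add_least[OF s(7) col(4,2)]])
  have e4: "emult R M xs (colon M x A B) B =
      emult R M xs (colon M x A B) (colon M x C B) + emult R M xs (colon M x C B) B"
    by (rule Cons.IH[OF g4 s(8) col(3,5)])
  have "C <+>\<^bsub>M\<^esub> (B <+>\<^bsub>M\<^esub> scale M x A) = C <+>\<^bsub>M\<^esub> scale M x A"
    using set_add_assoc[OF s(3,2,4)] set_add_absorb2[OF s(3,2) le(1)] by simp
  then have i1: "emult R M xs (C <+>\<^bsub>M\<^esub> scale M x A) (B <+>\<^bsub>M\<^esub> scale M x A) = emult R M xs C (C \<inter> (B <+>\<^bsub>M\<^esub> scale M x A))"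
    using emult_id[OF s(3,9) x(2)] by simp
  \<comment> \<open>The connecting map: \<open>x\<close> takes \<open>C :_A x\<close> onto
    \<open>C \<inter> (B + x A)\<close> modulo \<open>B + x C\<close>, with kernel
    \<open>(B :_A x) + C\<close>.\<close>
  have i2: "emult R M xs (C \<inter> (B <+>\<^bsub>M\<^esub> scale M x A)) (B <+>\<^bsub>M\<^esub> scale M x C) =
      emult R M xs (colon M x A C) (colon M x A B <+>\<^bsub>M\<^esub> C)"
  proof -
    have *: "colon M x A (B <+>\<^bsub>M\<^esub> scale M x C) \<subseteq> colon M x A C" by (rule colon_mono[OF order.refl le1(3)])
    then have "colon M x (colon M x A C) (B <+>\<^bsub>M\<^esub> scale M x C) = colon M x A B <+>\<^bsub>M\<^esub> C"
      using colon_restrict[OF colA(2) *] colon_add_scale[OF x(1) s(1,2,3) le(2)] by simp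
    moreover have "scale M x (colon M x A C) <+>\<^bsub>M\<^esub> (B <+>\<^bsub>M\<^esub> scale M x C) = C \<inter> (B <+>\<^bsub>M\<^esub> scale M x A)"
      unfolding scale_colon by (rule modular_absorb[OF s(3,4,2,5) le(1) sc(3,2)])
    ultimately show ?thesis using emult_smult[OF x(1) s(7,11) x(2)] by simp
  qed
  have i3: "emult R M xs (colon M x A B <+>\<^bsub>M\<^esub> C) C = emult R M xs (colon M x A B) (colon M x C B)"
    using emult_id[OF s(6,3) x(2)] colon_Int[OF le(2), of M x B] by simp
  show ?case using e1 e2 e3 e4 i1 i2 i3 by simp
qed

text \<open>For a composite of two maps there is the exact sequence \<open>0 -> ker y -> ker xy ->
  ker x -> coker y -> coker xy -> coker x -> 0\<close>, here on \<open>A / B\<close>. As in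
  \<open>emult_add\<close>, the four middle modules are cut at the images, and the pieces are
  matched.\<close>

lemma emult_mult:
  assumes g: "good R \<mm> M (x \<otimes> y # xs) A B" and x: "x \<in> carrier R" "y \<in> carrier R"
  shows "emult R M (x \<otimes> y # xs) A B = emult R M (x # xs) A B + emult R M (y # xs) A B"
proof -
  note D = goodD[OF g]
  note gx = good_mult_left(1)[OF g x] and gy = good_mult_left(2)[OF g x]
  have xs: "set xs \<subseteq> carrier R" and xy: "x \<otimes> y \<in> carrier R" using D(4) x by auto
  define P Q L where "P = colon M x A B" and "Q = colon M y A B" and "L = colon M (x \<otimes> y) A B"
  have LP: "L = colon M y A P" unfolding L_def P_def using colon_colon[OF x D(1)] by simp
  define X Y Z where "X = scale M x A" and "Y = scale M y A" and "Z = scale M x Y"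
  have ZE: "scale M (x \<otimes> y) A = Z" unfolding Z_def Y_def using scale_scale[OF x D(1)] by simp
  have s: "subm A" "subm B" "subm P" "subm Q" "subm L" "subm X" "subm Y" "subm Z"
    unfolding P_def Q_def L_def X_def Y_def Z_def using D x xy by (auto intro!: subm_intros)
  have s': "subm (B <+>\<^bsub>M\<^esub> X)" "subm (B <+>\<^bsub>M\<^esub> Y)" "subm (B <+>\<^bsub>M\<^esub> Z)" "subm (P <+>\<^bsub>M\<^esub> Y)"
    "subm (P \<inter> (B <+>\<^bsub>M\<^esub> Y))"
    using s by (auto intro!: subm_intros)
  have XA: "X \<subseteq> A" "Y \<subseteq> A" "Z \<subseteq> X" "Z \<subseteq> A"
    unfolding X_def Y_def Z_def using scale_subset[OF _ s(1)] x scale_mono[of "scale M y A" A M x] by auto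
  have BP: "B \<subseteq> P" "B \<subseteq> Q" "B \<subseteq> L" "P \<subseteq> A" "Q \<subseteq> A" "L \<subseteq> A" "Q \<subseteq> L"
    unfolding P_def Q_def L_def using subset_colon[OF _ s(2) D(3)] x xy subm_smult[OF s(2) x(1)] 
      subm_carrier[OF s(1)] by (auto simp: colon_def smult_assoc1)
  have up: "B \<subseteq> B <+>\<^bsub>M\<^esub> X" "B \<subseteq> B <+>\<^bsub>M\<^esub> Y" "B \<subseteq> B <+>\<^bsub>M\<^esub> Z" "X \<subseteq> B <+>\<^bsub>M\<^esub> X" "Y \<subseteq> B <+>\<^bsub>M\<^esub> Y"
    "Z \<subseteq> B <+>\<^bsub>M\<^esub> Z"
    using set_add_upper1 set_add_upper2 s by auto
  have leA: "B <+>\<^bsub>M\<^esub> X \<subseteq> A" "B <+>\<^bsub>M\<^esub> Y \<subseteq> A" "B <+>\<^bsub>M\<^esub> Z \<subseteq> A" "P <+>\<^bsub>M\<^esub> Y \<subseteq> A"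
    using set_add_least[OF s(1)] D(3) XA BP by auto
  have leZ: "B <+>\<^bsub>M\<^esub> Z \<subseteq> B <+>\<^bsub>M\<^esub> X" "B <+>\<^bsub>M\<^esub> Y \<subseteq> P <+>\<^bsub>M\<^esub> Y"
    using set_add_mono[OF order.refl XA(3)] set_add_mono[OF BP(1) order.refl] by blast+
  have g1: "good R \<mm> M xs A (B <+>\<^bsub>M\<^esub> Z)"
    by (rule good_kill[OF g s(1) s'(3) up(3) leA(3) order.refl]) (use ZE up in simp)
  have g2: "good R \<mm> M xs L B"
    by (rule good_kill[OF g s(5,2) order.refl BP(3,6)]) (simp add: L_def scale_colon)
  have g3: "good R \<mm> M xs A (B <+>\<^bsub>M\<^esub> Y)"
    by (rule good_kill[OF gy s(1) s'(2) up(2) leA(2) order.refl]) (use up in \<open>simp add: Y_def\<close>)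
  have g4: "good R \<mm> M xs P B"
    by (rule good_kill[OF gx s(3,2) order.refl BP(1,4)]) (simp add: P_def scale_colon)
  have e1: "emult R M xs A (B <+>\<^bsub>M\<^esub> Z) = emult R M xs A (B <+>\<^bsub>M\<^esub> X) + emult R M xs (B <+>\<^bsub>M\<^esub> X) (B <+>\<^bsub>M\<^esub> Z)"
    by (rule emult_add[OF g1 s'(1) leZ(1) leA(1)])
  have e2: "emult R M xs L B = emult R M xs L Q + emult R M xs Q B"
    by (rule emult_add[OF g2 s(4) BP(2,7)])
  have e3: "emult R M xs A (B <+>\<^bsub>M\<^esub> Y) = emult R M xs A (P <+>\<^bsub>M\<^esub> Y) + emult R M xs (P <+>\<^bsub>M\<^esub> Y) (B <+>\<^bsub>M\<^esub> Y)"
    by (rule emult_add[OF g3 s'(4) leZ(2) leA(4)])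
  have e4: "emult R M xs P B = emult R M xs P (P \<inter> (B <+>\<^bsub>M\<^esub> Y)) + emult R M xs (P \<inter> (B <+>\<^bsub>M\<^esub> Y)) B"
    by (rule emult_add[OF g4 s'(5)]) (use BP up in auto)
  \<comment> \<open>Multiplication by \<open>x\<close> induces the map from the cokernel of
    \<open>y\<close> to that of \<open>x y\<close>, whose image is
    \<open>(B + X) / (B + Z)\<close>.\<close>
  have i1: "emult R M xs (B <+>\<^bsub>M\<^esub> X) (B <+>\<^bsub>M\<^esub> Z) = emult R M xs A (P <+>\<^bsub>M\<^esub> Y)"
  proof -
    have "colon M x A (B <+>\<^bsub>M\<^esub> Z) = P <+>\<^bsub>M\<^esub> Y"
      unfolding Z_def P_def by (rule colon_add_scale[OF x(1) s(1,2,7) XA(2)])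
    moreover have "X <+>\<^bsub>M\<^esub> (B <+>\<^bsub>M\<^esub> Z) = B <+>\<^bsub>M\<^esub> X"
      using set_add_comm[OF s(6) s'(3)] set_add_assoc[OF s(2,8,6)] set_add_absorb1[OF s(8,6) XA(3)] by simp
    ultimately show ?thesis using emult_smult[OF x(1) s(1) s'(3) xs] by (simp add: X_def)
  qed
  \<comment> \<open>Multiplication by \<open>y\<close> maps the kernel of \<open>x y\<close> to the
    kernel of \<open>x\<close>; the image is the part of \<open>P\<close> that lies in
    \<open>B + Y\<close>.\<close>
  have i2: "emult R M xs (P \<inter> (B <+>\<^bsub>M\<^esub> Y)) B = emult R M xs L Q"
  proof -
    have "colon M y L B = Q" unfolding Q_def using colon_restrict[OF BP(6), of M y B] BP(7) Q_def by simp
    moreover have "scale M y L <+>\<^bsub>M\<^esub> B = P \<inter> (B <+>\<^bsub>M\<^esub> Y)"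
      using modular_law[OF s(3,7,2) BP(1)] set_add_comm[OF s(7,2)]
      by (simp add: LP scale_colon Y_def[symmetric] Int_commute)
    ultimately show ?thesis using emult_smult[OF x(2) s(5,2) xs] by simp
  qed
  have "P <+>\<^bsub>M\<^esub> (B <+>\<^bsub>M\<^esub> Y) = P <+>\<^bsub>M\<^esub> Y"
    using set_add_assoc[OF s(3,2,7)] set_add_absorb2[OF s(3,2) BP(1)] by simp
  then have i3: "emult R M xs (P <+>\<^bsub>M\<^esub> Y) (B <+>\<^bsub>M\<^esub> Y) = emult R M xs P (P \<inter> (B <+>\<^bsub>M\<^esub> Y))"
    using emult_id[OF s(3) s'(2) xs] by simp
  show ?thesis using e1 e2 e3 e4 i1 i2 i3
    by (simp add: ZE P_def[symmetric] Q_def[symmetric] L_def[symmetric] X_def[symmetric] Y_def[symmetric])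
qed

lemma emult_pow:
  assumes "good R \<mm> M (x [^] (n::nat) # xs) A B" "x \<in> carrier R"
  shows "emult R M (x [^] n # xs) A B = int n * emult R M (x # xs) A B"
  using assms(1)
proof (induction n)
  case 0
  note D = goodD[OF 0]
  have "scale M \<one> A = A" "colon M \<one> A B = B" using subm_carrier[OF D(1)] D(3) by (auto simp: scale_def colon_def)
  then show ?case using emult_self D set_add_absorb1[OF D(2,1,3)] by simp
next
  case (Suc n)
  have g: "good R \<mm> M (x [^] n \<otimes> x # xs) A B" using Suc.prems by simp
  have xn: "x [^] n \<in> carrier R" using assms by simp
  show ?case using emult_mult[OF g xn assms(2)] Suc.IH[OF good_mult_left(1)[OF g xn assms(2)]]
    by (simp add: algebra_simps)
qed

text \<open>The recursion is linear in its two terms, so the parameters in front can be peeled off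
  until the power comes first.\<close>

lemma emult_pow_mid:
  assumes "good R \<mm> M (ys @ x [^] (n::nat) # zs) A B" "x \<in> carrier R"
  shows "emult R M (ys @ x [^] n # zs) A B = int n * emult R M (ys @ x # zs) A B"
  using assms(1)
proof (induction ys arbitrary: A B)
  case Nil
  then show ?case using emult_pow[OF _ assms(2)] by simp
next
  case (Cons y ys)
  then have g: "good R \<mm> M (y # ys @ x [^] n # zs) A B" by simp
  note D = goodD[OF g]
  have y: "y \<in> carrier R" using D(4) by auto
  have s: "subm (scale M y A)" "subm (B <+>\<^bsub>M\<^esub> scale M y A)" "subm (colon M y A B)"
    using D y by (auto intro!: subm_intros)
  have 1: "good R \<mm> M (ys @ x [^] n # zs) A (B <+>\<^bsub>M\<^esub> scale M y A)"
    using set_add_upper1[OF D(2) s(1)] set_add_upper2[OF D(2) s(1)] scale_subset[OF y D(1)] D(3) set_add_least[OF D(1)]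
    by (intro good_kill[OF g D(1) s(2)]) auto
  have 2: "good R \<mm> M (ys @ x [^] n # zs) (colon M y A B) B"
    by (rule good_kill[OF g s(3) D(2) order.refl subset_colon[OF y D(2,3)] colon_subset]) (auto simp: scale_colon)
  show ?case using Cons.IH[OF 1] Cons.IH[OF 2] by (simp add: algebra_simps)
qed

text \<open>The right-hand side is symmetric in \<open>x\<close> and \<open>y\<close>.\<close>

lemma emult_Cons_Cons:
  assumes g: "good R \<mm> M (x # y # xs) A B"
  defines "P \<equiv> colon M x A B" and "Q \<equiv> colon M y A B" and "X \<equiv> scale M x A" and "Y \<equiv> scale M y A"
  shows "emult R M (x # y # xs) A B =
    emult R M xs A ((B <+>\<^bsub>M\<^esub> X) <+>\<^bsub>M\<^esub> Y) + emult R M xs (P \<inter> Q) B -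
    (emult R M xs ((B <+>\<^bsub>M\<^esub> X) \<inter> (B <+>\<^bsub>M\<^esub> Y)) (B <+>\<^bsub>M\<^esub> scale M (x \<otimes> y) A) +
     emult R M xs Q (Q \<inter> (B <+>\<^bsub>M\<^esub> X)) + emult R M xs P (P \<inter> (B <+>\<^bsub>M\<^esub> Y)) +
     emult R M xs (colon M (x \<otimes> y) A B) (P <+>\<^bsub>M\<^esub> Q))"
proof -
  note D = goodD[OF g]
  have x: "x \<in> carrier R" "y \<in> carrier R" and xs: "set xs \<subseteq> carrier R" using D(4) by auto
  have gs: "good R \<mm> M (y # x # xs) A B" using good_set[OF g, of "y # x # xs"] D(4) by auto
  define L U Z where "L = colon M (x \<otimes> y) A B" and "U = colon M y A (B <+>\<^bsub>M\<^esub> X)" and "Z = scale M y X"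
  have LP: "L = colon M y A P" unfolding L_def P_def using colon_colon[OF x D(1)] by simp
  have ZE: "scale M (x \<otimes> y) A = Z" unfolding Z_def X_def using scale_scale[OF x D(1)] scale_comm[OF x D(1)] by simp
  have s: "subm A" "subm B" "subm P" "subm Q" "subm X" "subm Y" "subm Z" "subm L" "subm (scale M y P)"
    unfolding P_def Q_def L_def X_def Y_def Z_def using D x by (auto intro!: subm_intros)
  have s': "subm (B <+>\<^bsub>M\<^esub> X)" "subm (B <+>\<^bsub>M\<^esub> Y)" "subm (B <+>\<^bsub>M\<^esub> Z)" "subm (Q <+>\<^bsub>M\<^esub> X)"
    "subm (P \<inter> (B <+>\<^bsub>M\<^esub> Y))" "subm (B <+>\<^bsub>M\<^esub> scale M y P)"
    using s by (auto intro!: subm_intros)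
  have sU: "subm U" unfolding U_def using s s' x by (intro subm_intros)
  have BP: "B \<subseteq> P" "B \<subseteq> Q" "P \<subseteq> A" "Q \<subseteq> A" "L \<subseteq> A" "U \<subseteq> A"
    unfolding P_def Q_def L_def U_def using subset_colon[OF _ s(2) D(3)] x by (auto simp: colon_def)
  have XA: "X \<subseteq> A" "Y \<subseteq> A" "Z \<subseteq> X" "Z \<subseteq> Y" "scale M y P \<subseteq> P" "scale M y P \<subseteq> Y"
    unfolding X_def Y_def Z_def using scale_subset[OF _ s(1)] x scale_mono[of "scale M x A" A M y] 
      scale_subset[OF x(2) s(5)] scale_subset[OF x(2) s(3)] scale_mono[OF BP(3), of M y] by (simp_all add: X_def)
  have up: "B \<subseteq> B <+>\<^bsub>M\<^esub> X" "B \<subseteq> B <+>\<^bsub>M\<^esub> Y" "X \<subseteq> B <+>\<^bsub>M\<^esub> X" "Y \<subseteq> B <+>\<^bsub>M\<^esub> Y"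
    using set_add_upper1 set_add_upper2 s by auto
  have leA: "B <+>\<^bsub>M\<^esub> X \<subseteq> A" using set_add_least[OF s(1)] D(3) XA by auto
  have ZX: "B <+>\<^bsub>M\<^esub> Z \<subseteq> B <+>\<^bsub>M\<^esub> X" "B <+>\<^bsub>M\<^esub> scale M y P \<subseteq> B <+>\<^bsub>M\<^esub> Y" "B <+>\<^bsub>M\<^esub> scale M y P \<subseteq> P"
    using set_add_mono[OF order.refl XA(3)] set_add_mono[OF order.refl XA(6)] set_add_least[OF s(3) BP(1) XA(5)] by blast+
  have QU: "Q \<subseteq> U" unfolding Q_def U_def by (rule colon_mono[OF order.refl up(1)])
  have XU: "B <+>\<^bsub>M\<^esub> X \<subseteq> U" unfolding U_def by (rule subset_colon[OF x(2) s'(1) leA])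
  have QX: "Q <+>\<^bsub>M\<^esub> X \<subseteq> U" using QU XU up by (intro set_add_least[OF sU]) auto
  have QX': "B <+>\<^bsub>M\<^esub> X \<subseteq> Q <+>\<^bsub>M\<^esub> X" by (rule set_add_mono[OF BP(2) order.refl])
  \<comment> \<open>\<open>y\<close> kills \<open>U / (B + X)\<close> by the choice of
    \<open>U\<close>, and \<open>x\<close> kills even \<open>A / (B + X)\<close>; so both parameters
    may be dropped.\<close>
  have g1: "good R \<mm> M xs U (B <+>\<^bsub>M\<^esub> X)"
  proof (rule good_kill[of \<mm> x])
    show "good R \<mm> M (x # xs) U (B <+>\<^bsub>M\<^esub> X)"
      by (rule good_kill[OF gs sU s'(1) up(1) XU BP(6)]) (simp add: U_def scale_colon)
    have "scale M x U \<subseteq> X" unfolding X_def by (rule scale_mono[OF BP(6)])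
    then show "scale M x U \<subseteq> B <+>\<^bsub>M\<^esub> X" using up by auto
  qed (use sU s' XU in auto)
  have g2: "good R \<mm> M xs P (B <+>\<^bsub>M\<^esub> scale M y P)"
  proof (rule good_kill[of \<mm> y])
    show "good R \<mm> M (y # xs) P (B <+>\<^bsub>M\<^esub> scale M y P)"
      by (rule good_kill[OF g s(3) s'(6) _ ZX(3) BP(3)])
        (use set_add_upper1[OF s(2,9)] in \<open>auto simp: P_def scale_colon\<close>)
  qed (use s s' ZX set_add_upper2[OF s(2,9)] in auto)
  \<comment> \<open>Unfolding the recursion twice leaves two asymmetric terms:
    \<open>U / (B + X)\<close>, the kernel of \<open>y\<close> on the cokernel of \<open>x\<close>,
    and \<open>P / (B + y P)\<close>, the cokernel of \<open>y\<close> on the kernel of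
    \<open>x\<close>. Each is cut into a symmetric piece and one of two pieces that \<open>x\<close>
    and \<open>y\<close> interchange.\<close>
  have e1: "emult R M xs U (B <+>\<^bsub>M\<^esub> X) = emult R M xs U (Q <+>\<^bsub>M\<^esub> X) + emult R M xs (Q <+>\<^bsub>M\<^esub> X) (B <+>\<^bsub>M\<^esub> X)"
    by (rule emult_add[OF g1 s'(4) QX' QX])
  have e2: "emult R M xs P (B <+>\<^bsub>M\<^esub> scale M y P) = 
      emult R M xs P (P \<inter> (B <+>\<^bsub>M\<^esub> Y)) + emult R M xs (P \<inter> (B <+>\<^bsub>M\<^esub> Y)) (B <+>\<^bsub>M\<^esub> scale M y P)"
    by (rule emult_add[OF g2 s'(5)]) (use ZX in auto)
  have "Q <+>\<^bsub>M\<^esub> (B <+>\<^bsub>M\<^esub> X) = Q <+>\<^bsub>M\<^esub> X"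
    using set_add_assoc[OF s(4,2,5)] set_add_absorb2[OF s(4,2) BP(2)] by simp
  then have i1: "emult R M xs (Q <+>\<^bsub>M\<^esub> X) (B <+>\<^bsub>M\<^esub> X) = emult R M xs Q (Q \<inter> (B <+>\<^bsub>M\<^esub> X))"
    using emult_id[OF s(4) s'(1) xs] by simp
  have i2: "emult R M xs U (Q <+>\<^bsub>M\<^esub> X) = emult R M xs ((B <+>\<^bsub>M\<^esub> X) \<inter> (B <+>\<^bsub>M\<^esub> Y)) (B <+>\<^bsub>M\<^esub> Z)"
  proof -
    have *: "colon M y A (B <+>\<^bsub>M\<^esub> Z) \<subseteq> U" unfolding U_def by (rule colon_mono[OF order.refl ZX(1)])
    then have "colon M y U (B <+>\<^bsub>M\<^esub> Z) = Q <+>\<^bsub>M\<^esub> X"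
      using colon_restrict[OF BP(6) *] colon_add_scale[OF x(2) s(1,2,5) XA(1)] by (simp add: Z_def Q_def)
    moreover have "scale M y U <+>\<^bsub>M\<^esub> (B <+>\<^bsub>M\<^esub> Z) = (B <+>\<^bsub>M\<^esub> X) \<inter> (B <+>\<^bsub>M\<^esub> Y)"
      unfolding U_def scale_colon Y_def[symmetric]
      by (rule modular_absorb[OF s'(1) s(6,2,7) up(1) XA(4)]) (use XA up in auto)
    ultimately show ?thesis using emult_smult[OF x(2) sU s'(3) xs] by simp
  qed
  have i3: "emult R M xs (P \<inter> (B <+>\<^bsub>M\<^esub> Y)) (B <+>\<^bsub>M\<^esub> scale M y P) = emult R M xs L (P <+>\<^bsub>M\<^esub> Q)"
  proof -
    have *: "colon M y A (B <+>\<^bsub>M\<^esub> scale M y P) \<subseteq> L" unfolding LP by (rule colon_mono[OF order.refl ZX(3)])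
    then have "colon M y L (B <+>\<^bsub>M\<^esub> scale M y P) = P <+>\<^bsub>M\<^esub> Q"
      using colon_restrict[OF BP(5) *] colon_add_scale[OF x(2) s(1,2,3) BP(3)] set_add_comm[OF s(3,4)]
      by (simp add: Q_def)
    moreover have "scale M y L <+>\<^bsub>M\<^esub> (B <+>\<^bsub>M\<^esub> scale M y P) = P \<inter> (B <+>\<^bsub>M\<^esub> Y)"
      unfolding LP scale_colon Y_def[symmetric]
      by (rule modular_absorb[OF s(3,6,2,9) BP(1) XA(6,5)])
    ultimately show ?thesis using emult_smult[OF x(2) s(8) s'(6) xs] by simp
  qed
  have "colon M y P B = P \<inter> Q" unfolding Q_def using colon_Int[OF BP(3), of M y B] by (simp add: Int_commute)
  then show ?thesis using e1 e2 i1 i2 i3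
    by (simp add: ZE P_def[symmetric] X_def[symmetric] L_def[symmetric] Y_def[symmetric] U_def[symmetric])
qed

lemma emult_swap:
  assumes g: "good R \<mm> M (x # y # xs) A B"
  shows "emult R M (x # y # xs) A B = emult R M (y # x # xs) A B"
proof -
  note D = goodD[OF g]
  have x: "x \<in> carrier R" "y \<in> carrier R" using D(4) by auto
  have gs: "good R \<mm> M (y # x # xs) A B" using good_set[OF g, of "y # x # xs"] D(4) by auto
  have s: "subm (scale M x A)" "subm (scale M y A)" "subm (colon M x A B)" "subm (colon M y A B)"
    using D x by (auto intro!: subm_intros)
  have "(B <+>\<^bsub>M\<^esub> scale M x A) <+>\<^bsub>M\<^esub> scale M y A = (B <+>\<^bsub>M\<^esub> scale M y A) <+>\<^bsub>M\<^esub> scale M x A"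
    using set_add_assoc[OF D(2) s(1,2)] set_add_assoc[OF D(2) s(2,1)] set_add_comm[OF s(1,2)] by simp
  then show ?thesis
    unfolding emult_Cons_Cons[OF g] emult_Cons_Cons[OF gs]
    using m_comm[OF x] set_add_comm[OF s(3,4)] by (simp add: Int_commute)
qed

text \<open>Repeated swaps. The recursion removes the first parameter, whereas
  \<open>emult_take_ge\<close> divides out the last one.\<close>

lemma emult_rotate:
  "good R \<mm> M (y # ys) A B \<Longrightarrow> emult R M (y # ys) A B = emult R M (ys @ [y]) A B"
proof (induction ys arbitrary: A B)
  case (Cons z zs)
  note D = goodD[OF Cons.prems]
  have z: "z \<in> carrier R" using D(4) by auto
  have g: "good R \<mm> M (z # y # zs) A B" using good_set[OF Cons.prems, of "z # y # zs"] D(4) by auto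
  have s: "subm (scale M z A)" "subm (B <+>\<^bsub>M\<^esub> scale M z A)" "subm (colon M z A B)"
    using D z by (auto intro!: subm_intros)
  have 1: "good R \<mm> M (y # zs) A (B <+>\<^bsub>M\<^esub> scale M z A)"
    using set_add_upper1[OF D(2) s(1)] set_add_upper2[OF D(2) s(1)] scale_subset[OF z D(1)] D(3) set_add_least[OF D(1)]
    by (intro good_kill[OF g D(1) s(2)]) auto
  have 2: "good R \<mm> M (y # zs) (colon M z A B) B"
    by (rule good_kill[OF g s(3) D(2) order.refl subset_colon[OF z D(2,3)] colon_subset]) (auto simp: scale_colon)
  have "emult R M (y # z # zs) A B = emult R M (z # y # zs) A B" by (rule emult_swap[OF Cons.prems])
  also have "\<dots> = emult R M (y # zs) A (B <+>\<^bsub>M\<^esub> scale M z A) - emult R M (y # zs) (colon M z A B) B"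
    by (simp only: emult.simps)
  also have "\<dots> = emult R M ((z # zs) @ [y]) A B"
    unfolding Cons.IH[OF 1] Cons.IH[OF 2] by simp
  finally show ?case .
qed simp

text \<open>Cut at \<open>B + x A\<close>: the parameter \<open>x\<close> kills the upper part, and
  a smaller power of \<open>x\<close> kills the lower part.\<close>

lemma emult_nilpotent:
  assumes "good R \<mm> M (x # xs) A B" "scale M (x [^] (k::nat)) A \<subseteq> B"
  shows "emult R M (x # xs) A B = 0"
  using assms
proof (induction k arbitrary: A)
  case 0
  note D = goodD[OF 0(1)]
  have "scale M \<one> A = A" using subm_carrier[OF D(1)] by (auto simp: scale_def)
  then have "A = B" using 0 D(3) by auto
  then show ?case using emult_self[OF D(4,1)] by simp
next
  case (Suc k)
  note D = goodD[OF Suc.prems(1)]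
  have x: "x \<in> carrier R" using D(4) by auto
  have s: "subm (scale M x A)" "subm (B <+>\<^bsub>M\<^esub> scale M x A)" using D x by (auto intro!: subm_intros)
  have le: "B \<subseteq> B <+>\<^bsub>M\<^esub> scale M x A" "scale M x A \<subseteq> B <+>\<^bsub>M\<^esub> scale M x A" "B <+>\<^bsub>M\<^esub> scale M x A \<subseteq> A"
    using set_add_upper1[OF D(2) s(1)] set_add_upper2[OF D(2) s(1)] set_add_least[OF D(1,3) scale_subset[OF x D(1)]] by auto
  have "scale M (x [^] k) (B <+>\<^bsub>M\<^esub> scale M x A) = scale M (x [^] k) B <+>\<^bsub>M\<^esub> scale M (x [^] k) (scale M x A)"
    using x by (intro scale_set_add D s) auto
  also have "scale M (x [^] k) (scale M x A) = scale M (x [^] Suc k) A" using scale_scale[OF _ x D(1)] x by simp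
  finally have "scale M (x [^] k) (B <+>\<^bsub>M\<^esub> scale M x A) \<subseteq> B"
    using set_add_least[OF D(2) scale_subset[OF _ D(2), of "x [^] k"] Suc.prems(2)] x by simp
  moreover have "good R \<mm> M (x # xs) (B <+>\<^bsub>M\<^esub> scale M x A) B"
    by (rule good_sub[OF Suc.prems(1) s(2) D(2) order.refl le(1,3)])
  ultimately have "emult R M (x # xs) (B <+>\<^bsub>M\<^esub> scale M x A) B = 0" by (rule Suc.IH[rotated])
  moreover have "emult R M (x # xs) A (B <+>\<^bsub>M\<^esub> scale M x A) = 0"
    by (rule emult_kill[of x]) (use D s le in auto)
  ultimately show ?case using emult_add[OF Suc.prems(1) s(2) le(1,3)] by simp
qed

text \<open>Let \<open>N k\<close> be the stable value of the submodules \<open>B : x^i\<close>. On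
  \<open>N k / B\<close> the parameter \<open>x\<close> is nilpotent and the multiplicity is zero;
  on \<open>A / N k\<close> it is injective, so the recursion loses its negative term.\<close>

lemma emult_nonneg: "good R \<mm> M xs A B \<Longrightarrow> 0 \<le> emult R M xs A B"
proof (induction xs arbitrary: A B)
  case (Cons x xs)
  note g = Cons.prems
  note D = goodD[OF g]
  have x: "x \<in> carrier R" using D(4) by auto
  define N where "N i = colon M (x [^] i) A B" for i :: nat
  have N: "subm (N i)" "B \<subseteq> N i" "N i \<subseteq> A" for i
    unfolding N_def using D x by (auto intro!: subm_intros subset_colon[THEN subsetD] simp: colon_subset[THEN subsetD])
  have xa: "x [^] Suc i \<odot>\<^bsub>M\<^esub> a = x \<odot>\<^bsub>M\<^esub> (x [^] i \<odot>\<^bsub>M\<^esub> a)" "x [^] Suc i \<odot>\<^bsub>M\<^esub> a = x [^] i \<odot>\<^bsub>M\<^esub> (x \<odot>\<^bsub>M\<^esub> a)"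
    if "a \<in> A" for a and i :: nat
    using that x subm_carrier[OF D(1)] by (simp_all add: smult_assoc1 smult_swap)
  obtain k where k: "\<And>i. i \<ge> k \<Longrightarrow> N i = N k"
  proof (rule noethD[OF D(5) N])
    show "N i \<subseteq> N (Suc i)" for i
      unfolding N_def colon_def using xa(1) subm_smult[OF D(2) x] by auto
  qed blast
  \<comment> \<open>Stability says that there is no \<open>x\<close>-torsion left modulo
    \<open>N k\<close>.\<close>
  have C: "colon M x A (N k) = N k"
  proof -
    have "colon M x A (N k) = N (Suc k)"
      unfolding N_def colon_def using xa(2) subm_smult[OF D(1) x] by auto
    then show ?thesis using k[of "Suc k"] by simp
  qed
  have "emult R M (x # xs) (N k) B = 0"
    by (rule emult_nilpotent[OF good_sub[OF g N(1) D(2) order.refl N(2,3)], of k]) (simp add: N_def scale_colon)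
  moreover have "0 \<le> emult R M (x # xs) A (N k)"
  proof -
    have xs: "set xs \<subseteq> carrier R" using D(4) by auto
    have s: "subm (scale M x A)" "subm (N k <+>\<^bsub>M\<^esub> scale M x A)" using D x N by (auto intro!: subm_intros)
    have "good R \<mm> M xs A (N k <+>\<^bsub>M\<^esub> scale M x A)"
      using N(2)[of k] set_add_upper1[OF N(1)[of k] s(1)] set_add_upper2[OF N(1)[of k] s(1)]
        set_add_least[OF D(1) N(3)[of k] scale_subset[OF x D(1)]]
      by (intro good_kill[OF g D(1) s(2)]) auto
    from Cons.IH[OF this] show ?thesis using C emult_self[OF xs N(1)] by simp
  qed
  ultimately show ?case unfolding emult_add[OF g N(1,2,3), of k] by simp
qed simp

end

section \<open>The Koszul complex\<close>

lemma koszul_index_0: "koszul_index n 0 = {{}}"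
  by (auto simp: koszul_index_def card_eq_0_iff dest: finite_subset)

lemma koszul_index_gt: "n < p \<Longrightarrow> koszul_index n p = {}"
proof -
  assume "n < p"
  have "card S \<le> n" if "S \<subseteq> {..<n}" for S using card_mono[OF _ that] by simp
  then show ?thesis using \<open>n < p\<close> unfolding koszul_index_def by (auto simp: not_le[symmetric])
qed

lemma koszul_index_insert: "S \<in> koszul_index n p \<Longrightarrow> j \<in> {..<n} - S \<Longrightarrow> insert j S \<in> koszul_index n (Suc p)"
  unfolding koszul_index_def by (auto simp: finite_subset card_insert_if)

lemma koszul_index_Suc1: "S \<in> koszul_index n p \<Longrightarrow> S \<in> koszul_index (Suc n) p \<and> n \<notin> S"
  unfolding koszul_index_def by auto

lemma koszul_index_Suc2: "S \<in> koszul_index n p \<Longrightarrow> insert n S \<in> koszul_index (Suc n) (Suc p)"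
  unfolding koszul_index_def by (auto simp: finite_subset card_insert_if)

lemma koszul_index_Suc_cases:
  assumes "S \<in> koszul_index (Suc n) p"
  shows "n \<notin> S \<Longrightarrow> S \<in> koszul_index n p"
    and "n \<in> S \<Longrightarrow> \<exists>q. p = Suc q \<and> S - {n} \<in> koszul_index n q \<and> insert n (S - {n}) = S"
proof -
  have S: "S \<subseteq> {..<Suc n}" "card S = p" "finite S" using assms by (auto simp: koszul_index_def finite_subset)
  show "n \<notin> S \<Longrightarrow> S \<in> koszul_index n p" using S by (auto simp: koszul_index_def less_Suc_eq)
  show "\<exists>q. p = Suc q \<and> S - {n} \<in> koszul_index n q \<and> insert n (S - {n}) = S" if "n \<in> S"
  proof (intro exI conjI)
    show "p = Suc (card (S - {n}))" using S(2) card.remove[OF S(3) that] by simp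
    show "S - {n} \<in> koszul_index n (card (S - {n}))" using S(1) by (auto simp: koszul_index_def less_Suc_eq)
    show "insert n (S - {n}) = S" using that by auto
  qed
qed

text \<open>Here \<open>p\<close> is the degree of the target: this is the differential from degree
  \<open>p + 1\<close> to degree \<open>p\<close>.\<close>

definition koszul_d ::
    "('a, 'r) ring_scheme \<Rightarrow> ('a, 'b, 'm) module_scheme \<Rightarrow> 'a list \<Rightarrow> nat \<Rightarrow> (nat set \<Rightarrow> 'b) \<Rightarrow> nat set \<Rightarrow> 'b" where
  "koszul_d R M xs p f = (\<lambda>T \<in> koszul_index (length xs) p. koszul_coeff R M xs f T)"

definition linear_map ::
    "('a, 'r) ring_scheme \<Rightarrow> ('a, 'b, 'm) module_scheme \<Rightarrow> ('a, 'c, 'k) module_scheme \<Rightarrow> ('b \<Rightarrow> 'c) \<Rightarrow> bool" where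
  "linear_map R M N f \<longleftrightarrow> module R M \<and> module R N \<and>
     (\<forall>a\<in>carrier M. f a \<in> carrier N) \<and>
     (\<forall>a\<in>carrier M. \<forall>b\<in>carrier M. f (a \<oplus>\<^bsub>M\<^esub> b) = f a \<oplus>\<^bsub>N\<^esub> f b) \<and>
     (\<forall>r\<in>carrier R. \<forall>a\<in>carrier M. f (r \<odot>\<^bsub>M\<^esub> a) = r \<odot>\<^bsub>N\<^esub> f a)"

lemma linear_mapD:
  assumes "linear_map R M N f"
  shows "module R M" "module R N" "\<And>a. a \<in> carrier M \<Longrightarrow> f a \<in> carrier N"
    "\<And>a b. a \<in> carrier M \<Longrightarrow> b \<in> carrier M \<Longrightarrow> f (a \<oplus>\<^bsub>M\<^esub> b) = f a \<oplus>\<^bsub>N\<^esub> f b"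
    "\<And>r a. r \<in> carrier R \<Longrightarrow> a \<in> carrier M \<Longrightarrow> f (r \<odot>\<^bsub>M\<^esub> a) = r \<odot>\<^bsub>N\<^esub> f a"
  using assms unfolding linear_map_def by auto

lemma linear_map_zero_neg:
  assumes "linear_map R M N f"
  shows "f \<zero>\<^bsub>M\<^esub> = \<zero>\<^bsub>N\<^esub>" "a \<in> carrier M \<Longrightarrow> f (\<ominus>\<^bsub>M\<^esub> a) = \<ominus>\<^bsub>N\<^esub> f a"
proof -
  note D = linear_mapD[OF assms]
  interpret M: module R M by (rule D)
  interpret N: module R N by (rule D)
  show "f \<zero>\<^bsub>M\<^esub> = \<zero>\<^bsub>N\<^esub>" using D(5)[of "\<zero>\<^bsub>R\<^esub>" "\<zero>\<^bsub>M\<^esub>"] D(3)[of "\<zero>\<^bsub>M\<^esub>"] by simp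
  show "f (\<ominus>\<^bsub>M\<^esub> a) = \<ominus>\<^bsub>N\<^esub> f a" if "a \<in> carrier M"
    using D(5)[of "\<ominus>\<^bsub>R\<^esub> \<one>\<^bsub>R\<^esub>" a] that D(3)[OF that] by (simp add: M.smult_l_minus N.smult_l_minus)
qed

lemma linear_map_image_kernel:
  assumes "linear_map R M N f"
  shows "submodule (f ` carrier M) R N" "submodule Y R N \<Longrightarrow> submodule {a \<in> carrier M. f a \<in> Y} R M"
proof -
  note D = linear_mapD[OF assms]
  note Z = linear_map_zero_neg[OF assms]
  interpret M: module R M by (rule D)
  interpret N: module R N by (rule D)
  show "submodule (f ` carrier M) R N"
  proof (rule N.submoduleI)
    show "\<zero>\<^bsub>N\<^esub> \<in> f ` carrier M" using Z(1) by (metis M.M.zero_closed image_eqI)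
  qed (use D(3) in \<open>auto simp: D(4,5)[symmetric] Z(2)[symmetric]\<close>)
  show "submodule {a \<in> carrier M. f a \<in> Y} R M" if Y: "submodule Y R N"
    using N.subm_rules[OF Y] by (intro M.submoduleI) (auto simp: D(4,5) Z)
qed

context module
begin

lemma koszul_sel:
  "carrier (koszul_module M n p) = koszul_index n p \<rightarrow>\<^sub>E carrier M"
  "\<zero>\<^bsub>koszul_module M n p\<^esub> = (\<lambda>S \<in> koszul_index n p. \<zero>\<^bsub>M\<^esub>)"
  "f \<oplus>\<^bsub>koszul_module M n p\<^esub> g = (\<lambda>S \<in> koszul_index n p. f S \<oplus>\<^bsub>M\<^esub> g S)"
  "r \<odot>\<^bsub>koszul_module M n p\<^esub> f = (\<lambda>S \<in> koszul_index n p. r \<odot>\<^bsub>M\<^esub> f S)"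
  by (auto simp: koszul_module_def)

lemma koszul_mem: "f \<in> carrier (koszul_module M n p) \<Longrightarrow> S \<in> koszul_index n p \<Longrightarrow> f S \<in> carrier M"
  by (auto simp: koszul_sel)

lemma koszul_eqI:
  assumes "f \<in> carrier (koszul_module M n p)" "g \<in> carrier (koszul_module M n p)"
    and "\<And>S. S \<in> koszul_index n p \<Longrightarrow> f S = g S"
  shows "f = g"
  using assms unfolding koszul_sel by (rule PiE_ext)

lemma koszul_closed:
  "\<zero>\<^bsub>koszul_module M n p\<^esub> \<in> carrier (koszul_module M n p)"
  "f \<in> carrier (koszul_module M n p) \<Longrightarrow> g \<in> carrier (koszul_module M n p) \<Longrightarrow>
    f \<oplus>\<^bsub>koszul_module M n p\<^esub> g \<in> carrier (koszul_module M n p)"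
  "r \<in> carrier R \<Longrightarrow> f \<in> carrier (koszul_module M n p) \<Longrightarrow>
    r \<odot>\<^bsub>koszul_module M n p\<^esub> f \<in> carrier (koszul_module M n p)"
  unfolding koszul_sel by (auto simp: PiE_mem)

lemma koszul_is_module: "module R (koszul_module M n p)" (is "module R ?K")
proof (rule moduleI)
  show "cring R" by (rule R.cring_axioms)
  show "abelian_group ?K"
  proof (rule abelian_groupI)
    fix f g h assume f: "f \<in> carrier ?K" and g: "g \<in> carrier ?K"
      and h: "h \<in> carrier ?K"
    show "(f \<oplus>\<^bsub>?K\<^esub> g) \<oplus>\<^bsub>?K\<^esub> h = f \<oplus>\<^bsub>?K\<^esub> (g \<oplus>\<^bsub>?K\<^esub> h)"
      by (rule koszul_eqI[of _ n p]; (intro koszul_closed f g h)?; simp add: koszul_sel(2-4) M.a_assoc koszul_mem[OF f] koszul_mem[OF g] koszul_mem[OF h])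
  next
    fix f g assume f: "f \<in> carrier ?K" and g: "g \<in> carrier ?K"
    show "f \<oplus>\<^bsub>?K\<^esub> g = g \<oplus>\<^bsub>?K\<^esub> f"
      by (rule koszul_eqI[of _ n p]; (intro koszul_closed f g R.a_inv_closed R.one_closed R.m_closed R.a_closed)?; use f g in \<open>simp add: koszul_sel(2-4) M.a_comm koszul_mem\<close>)
  next
    fix f assume f: "f \<in> carrier ?K"
    show "\<zero>\<^bsub>?K\<^esub> \<oplus>\<^bsub>?K\<^esub> f = f"
      by (rule koszul_eqI[of _ n p]; (intro koszul_closed f R.a_inv_closed R.one_closed R.m_closed R.a_closed)?; use f in \<open>simp add: koszul_sel(2-4) koszul_mem\<close>)
    have "(\<ominus> \<one>) \<odot>\<^bsub>?K\<^esub> f \<oplus>\<^bsub>?K\<^esub> f = \<zero>\<^bsub>?K\<^esub>"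
      by (rule koszul_eqI[of _ n p]; (intro koszul_closed f R.a_inv_closed R.one_closed R.m_closed R.a_closed)?; use f in \<open>simp add: koszul_sel(2-4) koszul_mem smult_l_minus M.l_neg\<close>)
    then show "\<exists>g\<in>carrier ?K. g \<oplus>\<^bsub>?K\<^esub> f = \<zero>\<^bsub>?K\<^esub>"
      using koszul_closed(3)[of "\<ominus> \<one>" f] f by auto
  qed (auto intro: koszul_closed)
next
  fix r f assume r: "r \<in> carrier R" and f: "f \<in> carrier ?K"
  show "r \<odot>\<^bsub>?K\<^esub> f \<in> carrier ?K" by (rule koszul_closed(3)[OF r f])
next
  fix f assume f: "f \<in> carrier ?K"
  show "\<one> \<odot>\<^bsub>?K\<^esub> f = f"
    by (rule koszul_eqI[of _ n p]; (intro koszul_closed f R.a_inv_closed R.one_closed R.m_closed R.a_closed)?; use f in \<open>simp add: koszul_sel(4) koszul_mem\<close>)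
next
  fix r s f assume r: "r \<in> carrier R" and s: "s \<in> carrier R" and f: "f \<in> carrier ?K"
  show "(r \<oplus> s) \<odot>\<^bsub>?K\<^esub> f = r \<odot>\<^bsub>?K\<^esub> f \<oplus>\<^bsub>?K\<^esub> s \<odot>\<^bsub>?K\<^esub> f"
    by (rule koszul_eqI[of _ n p]; (intro koszul_closed r s f R.a_inv_closed R.one_closed R.m_closed R.a_closed)?; use r s f in \<open>simp add: koszul_sel(3,4) koszul_mem smult_l_distr\<close>)
  show "(r \<otimes> s) \<odot>\<^bsub>?K\<^esub> f = r \<odot>\<^bsub>?K\<^esub> (s \<odot>\<^bsub>?K\<^esub> f)"
    by (rule koszul_eqI[of _ n p]; (intro koszul_closed r s f R.a_inv_closed R.one_closed R.m_closed R.a_closed)?; use r s f in \<open>simp add: koszul_sel(4) koszul_mem smult_assoc1\<close>)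
next
  fix r f g assume r: "r \<in> carrier R" and f: "f \<in> carrier ?K" and g: "g \<in> carrier ?K"
  show "r \<odot>\<^bsub>?K\<^esub> (f \<oplus>\<^bsub>?K\<^esub> g) =
      r \<odot>\<^bsub>?K\<^esub> f \<oplus>\<^bsub>?K\<^esub> r \<odot>\<^bsub>?K\<^esub> g"
    by (rule koszul_eqI[of _ n p]; (intro koszul_closed r f g R.a_inv_closed R.one_closed R.m_closed R.a_closed)?; use r f g in \<open>simp add: koszul_sel(3,4) koszul_mem smult_r_distr\<close>)
qed

lemma koszul_coeff_closed:
  assumes xs: "set xs \<subseteq> carrier R" and T: "T \<in> koszul_index (length xs) p"
    and f: "f \<in> carrier (koszul_module M (length xs) (Suc p))"
  shows "(\<lambda>j. (((\<ominus> \<one>) [^] card {i \<in> T. i < j}) \<otimes> xs ! j) \<odot>\<^bsub>M\<^esub> f (insert j T)) \<in> {..<length xs} - T \<rightarrow> carrier M"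
  using koszul_mem[OF f koszul_index_insert[OF T]] xs by (auto simp: nth_mem subset_iff)

lemma koszul_d_linear:
  assumes xs: "set xs \<subseteq> carrier R"
  shows "linear_map R (koszul_module M (length xs) (Suc p)) (koszul_module M (length xs) p) (koszul_d R M xs p)"
proof -
  note cl = koszul_coeff_closed[OF xs]
  have xc: "xs ! j \<in> carrier R" if "j < length xs" for j using xs that nth_mem by auto
  have d: "koszul_d R M xs p f \<in> carrier (koszul_module M (length xs) p)"
    if "f \<in> carrier (koszul_module M (length xs) (Suc p))" for f
    unfolding koszul_d_def koszul_sel koszul_coeff_def using cl[OF _ that] by (auto intro!: M.finsum_closed)
  have add: "koszul_d R M xs p (f \<oplus>\<^bsub>koszul_module M (length xs) (Suc p)\<^esub> g) =
      koszul_d R M xs p f \<oplus>\<^bsub>koszul_module M (length xs) p\<^esub> koszul_d R M xs p g"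
    if f: "f \<in> carrier (koszul_module M (length xs) (Suc p))" and g: "g \<in> carrier (koszul_module M (length xs) (Suc p))" for f g
  proof -
    have "koszul_coeff R M xs (f \<oplus>\<^bsub>koszul_module M (length xs) (Suc p)\<^esub> g) T = koszul_coeff R M xs f T \<oplus>\<^bsub>M\<^esub> koszul_coeff R M xs g T"
      if T: "T \<in> koszul_index (length xs) p" for T
      unfolding koszul_coeff_def M.finsum_addf[OF cl[OF T f] cl[OF T g], symmetric]
      using koszul_mem[OF f koszul_index_insert[OF T]] koszul_mem[OF g koszul_index_insert[OF T]] koszul_index_insert[OF T] xc
      by (intro M.finsum_cong') (auto simp: koszul_sel smult_r_distr)
    then show ?thesis by (auto simp: koszul_d_def koszul_sel intro!: restrict_ext)
  qed
  have smult: "koszul_d R M xs p (r \<odot>\<^bsub>koszul_module M (length xs) (Suc p)\<^esub> f) =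
      r \<odot>\<^bsub>koszul_module M (length xs) p\<^esub> koszul_d R M xs p f"
    if r: "r \<in> carrier R" and f: "f \<in> carrier (koszul_module M (length xs) (Suc p))" for r f
  proof -
    have "koszul_coeff R M xs (r \<odot>\<^bsub>koszul_module M (length xs) (Suc p)\<^esub> f) T = r \<odot>\<^bsub>M\<^esub> koszul_coeff R M xs f T"
      if T: "T \<in> koszul_index (length xs) p" for T
      unfolding koszul_coeff_def using cl[OF T f] r
      by (subst finsum_smult_ldistr)
        (use koszul_mem[OF f koszul_index_insert[OF T]] koszul_index_insert[OF T] xc r
          in \<open>auto intro!: M.finsum_cong' simp: koszul_sel smult_swap[of _ r]\<close>)
    then show ?thesis by (auto simp: koszul_d_def koszul_sel intro!: restrict_ext)
  qed
  show ?thesis unfolding linear_map_def using koszul_is_module d add smult by blast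
qed

lemma koszul_boundaries_eq:
  "koszul_boundaries R M xs p = koszul_d R M xs p ` carrier (koszul_module M (length xs) (Suc p))"
  by (simp add: koszul_boundaries_def koszul_d_def)

lemma koszul_cycles_0: "koszul_cycles R M xs 0 = carrier (koszul_module M (length xs) 0)"
  by (simp add: koszul_cycles_def)

lemma koszul_cycles_Suc:
  "koszul_cycles R M xs (Suc p) = {f \<in> carrier (koszul_module M (length xs) (Suc p)).
     koszul_d R M xs p f = \<zero>\<^bsub>koszul_module M (length xs) p\<^esub>}"
proof -
  have "(\<forall>T \<subseteq> {..<length xs}. Suc (card T) = Suc p \<longrightarrow> koszul_coeff R M xs f T = \<zero>\<^bsub>M\<^esub>) \<longleftrightarrow>
     koszul_d R M xs p f = \<zero>\<^bsub>koszul_module M (length xs) p\<^esub>" (is "?l \<longleftrightarrow> ?r") for f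
  proof
    show "?l \<Longrightarrow> ?r" by (auto simp: koszul_d_def koszul_sel koszul_index_def intro!: restrict_ext)
    show ?l if ?r
    proof (intro allI impI)
      fix T assume "T \<subseteq> {..<length xs}" "Suc (card T) = Suc p"
      then have T: "T \<in> koszul_index (length xs) p" by (simp add: koszul_index_def)
      show "koszul_coeff R M xs f T = \<zero>\<^bsub>M\<^esub>" using fun_cong[OF that, of T] T by (simp add: koszul_d_def koszul_sel)
    qed
  qed
  then show ?thesis by (simp add: koszul_cycles_def)
qed

lemma subm_koszul:
  assumes xs: "set xs \<subseteq> carrier R"
  shows "submodule (koszul_boundaries R M xs p) R (koszul_module M (length xs) p)"
    "submodule (koszul_cycles R M xs p) R (koszul_module M (length xs) p)"
proof -
  show "submodule (koszul_boundaries R M xs p) R (koszul_module M (length xs) p)"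
    unfolding koszul_boundaries_eq by (rule linear_map_image_kernel(1)[OF koszul_d_linear[OF xs]])
  show "submodule (koszul_cycles R M xs p) R (koszul_module M (length xs) p)"
  proof (cases p)
    case 0
    then show ?thesis using module.carrier_is_submodule[OF koszul_is_module] by (simp add: koszul_cycles_0)
  next
    case (Suc q)
    show ?thesis using linear_map_image_kernel(2)[OF koszul_d_linear[OF xs, of q] module.subm_zero_set[OF koszul_is_module]]
      by (simp add: Suc koszul_cycles_Suc)
  qed
qed

end

text \<open>An element of the Koszul complex of \<open>ys @ [x]\<close> in degree \<open>p + 1\<close> is a pair of elements of the
  Koszul complex of \<open>ys\<close> of degrees \<open>p + 1\<close> and \<open>p\<close>, the second one collecting the coefficients of the
  \<open>e\<^sub>S\<close> with \<open>n \<in> S\<close>, where \<open>n\<close> is the length of \<open>ys\<close>.\<close>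

definition koszul_fst :: "nat \<Rightarrow> nat \<Rightarrow> (nat set \<Rightarrow> 'b) \<Rightarrow> nat set \<Rightarrow> 'b" where
  "koszul_fst n p f = (\<lambda>S \<in> koszul_index n p. f S)"

definition koszul_snd :: "nat \<Rightarrow> nat \<Rightarrow> (nat set \<Rightarrow> 'b) \<Rightarrow> nat set \<Rightarrow> 'b" where
  "koszul_snd n p f = (\<lambda>S \<in> koszul_index n p. f (insert n S))"

definition koszul_pair :: "nat \<Rightarrow> nat \<Rightarrow> (nat set \<Rightarrow> 'b) \<Rightarrow> (nat set \<Rightarrow> 'b) \<Rightarrow> nat set \<Rightarrow> 'b" where
  "koszul_pair n p a b = (\<lambda>S \<in> koszul_index (Suc n) (Suc p). if n \<in> S then b (S - {n}) else a S)"

context module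
begin

lemma koszul_fst_linear: "linear_map R (koszul_module M (Suc n) p) (koszul_module M n p) (koszul_fst n p)"
  unfolding linear_map_def using koszul_is_module koszul_index_Suc1
  by (auto simp: koszul_fst_def koszul_sel PiE_iff intro!: restrict_ext)

lemma koszul_snd_linear: "linear_map R (koszul_module M (Suc n) (Suc p)) (koszul_module M n p) (koszul_snd n p)"
  unfolding linear_map_def using koszul_is_module koszul_index_Suc2
  by (auto simp: koszul_snd_def koszul_sel PiE_iff intro!: restrict_ext)

lemma koszul_pair:
  assumes a: "a \<in> carrier (koszul_module M n (Suc p))" and b: "b \<in> carrier (koszul_module M n p)"
  shows "koszul_pair n p a b \<in> carrier (koszul_module M (Suc n) (Suc p))"
    "koszul_fst n (Suc p) (koszul_pair n p a b) = a" "koszul_snd n p (koszul_pair n p a b) = b"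
proof -
  have "(if n \<in> S then b (S - {n}) else a S) \<in> carrier M" if S: "S \<in> koszul_index (Suc n) (Suc p)" for S
    using koszul_index_Suc_cases[OF S] koszul_mem[OF a] koszul_mem[OF b] by auto
  then show *: "koszul_pair n p a b \<in> carrier (koszul_module M (Suc n) (Suc p))"
    by (auto simp: koszul_pair_def koszul_sel)
  show "koszul_fst n (Suc p) (koszul_pair n p a b) = a"
    using koszul_index_Suc1[of _ n "Suc p"]
    by (intro koszul_eqI[OF linear_mapD(3)[OF koszul_fst_linear *] a]) (auto simp: koszul_fst_def koszul_pair_def)
  have "insert n S - {n} = S" if "S \<in> koszul_index n p" for S using koszul_index_Suc1[OF that] by auto
  then show "koszul_snd n p (koszul_pair n p a b) = b"
    using koszul_index_Suc2[of _ n p]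
    by (intro koszul_eqI[OF linear_mapD(3)[OF koszul_snd_linear *] b]) (auto simp: koszul_snd_def koszul_pair_def)
qed

lemma koszul_pair_eqI:
  assumes f: "f \<in> carrier (koszul_module M (Suc n) (Suc p))" and g: "g \<in> carrier (koszul_module M (Suc n) (Suc p))"
    and eq: "koszul_fst n (Suc p) f = koszul_fst n (Suc p) g" "koszul_snd n p f = koszul_snd n p g"
  shows "f = g"
proof (rule koszul_eqI[OF f g])
  fix S assume S: "S \<in> koszul_index (Suc n) (Suc p)"
  show "f S = g S"
  proof (cases "n \<in> S")
    case True
    then have "S - {n} \<in> koszul_index n p" "insert n (S - {n}) = S" using koszul_index_Suc_cases(2)[OF S] by auto
    then show ?thesis using fun_cong[OF eq(2), of "S - {n}"] by (simp add: koszul_snd_def)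
  next
    case False
    then show ?thesis using koszul_index_Suc_cases(1)[OF S] fun_cong[OF eq(1), of S] by (simp add: koszul_fst_def)
  qed
qed

text \<open>The new index is larger than all elements of \<open>T\<close>, so the term in which it
  is removed carries the sign given by \<open>card T = p\<close>. This is the differential of a
  mapping cone of multiplication by \<open>x\<close>.\<close>

lemma koszul_fst_d:
  assumes xs: "set ys \<subseteq> carrier R" "x \<in> carrier R"
    and f: "f \<in> carrier (koszul_module M (Suc (length ys)) (Suc p))"
  shows "koszul_fst (length ys) p (koszul_d R M (ys @ [x]) p f) =
    koszul_d R M ys p (koszul_fst (length ys) (Suc p) f) \<oplus>\<^bsub>koszul_module M (length ys) p\<^esub>
    ((\<ominus> \<one>) [^] p \<otimes> x) \<odot>\<^bsub>koszul_module M (length ys) p\<^esub> koszul_snd (length ys) p f"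
proof -
  let ?n = "length ys"
  have "koszul_coeff R M (ys @ [x]) f T =
      koszul_coeff R M ys (koszul_fst ?n (Suc p) f) T \<oplus>\<^bsub>M\<^esub> ((\<ominus> \<one>) [^] p \<otimes> x) \<odot>\<^bsub>M\<^esub> f (insert ?n T)"
    if T: "T \<in> koszul_index ?n p" for T
  proof -
    have n: "{..<length (ys @ [x])} - T = insert ?n ({..<?n} - T)" "{i \<in> T. i < ?n} = T" "card T = p"
      using T by (auto simp: koszul_index_def)
    have T': "T \<in> koszul_index (length (ys @ [x])) p" using koszul_index_Suc1[OF T] by simp
    have xs': "set (ys @ [x]) \<subseteq> carrier R" using xs by auto
    have f': "f \<in> carrier (koszul_module M (length (ys @ [x])) (Suc p))" using f by simp
    have fs: "koszul_fst ?n (Suc p) f \<in> carrier (koszul_module M ?n (Suc p))"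
      by (rule linear_mapD(3)[OF koszul_fst_linear f])
    note cl = koszul_coeff_closed[OF xs' T' f', unfolded n(1)]
    have "koszul_coeff R M (ys @ [x]) f T = ((\<ominus> \<one>) [^] p \<otimes> x) \<odot>\<^bsub>M\<^esub> f (insert ?n T) \<oplus>\<^bsub>M\<^esub>
      (\<Oplus>\<^bsub>M\<^esub> j \<in> {..<?n} - T. (((\<ominus> \<one>) [^] card {i \<in> T. i < j}) \<otimes> (ys @ [x]) ! j) \<odot>\<^bsub>M\<^esub> f (insert j T))"
      unfolding koszul_coeff_def n(1) by (subst M.finsum_insert) (use cl n in auto)
    also have "(\<Oplus>\<^bsub>M\<^esub> j \<in> {..<?n} - T. (((\<ominus> \<one>) [^] card {i \<in> T. i < j}) \<otimes> (ys @ [x]) ! j) \<odot>\<^bsub>M\<^esub> f (insert j T)) =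
        koszul_coeff R M ys (koszul_fst ?n (Suc p) f) T"
      unfolding koszul_coeff_def
      by (rule M.finsum_cong'[OF refl koszul_coeff_closed[OF xs(1) T fs]])
        (use koszul_index_insert[OF T] in \<open>auto simp: koszul_fst_def nth_append\<close>)
    finally show ?thesis
      using M.finsum_closed[OF koszul_coeff_closed[OF xs(1) T fs]] cl n
      by (subst M.a_comm) (auto simp: koszul_coeff_def[symmetric])
  qed
  then show ?thesis
    using koszul_index_Suc1
    by (auto simp: koszul_fst_def[of _ p] koszul_d_def koszul_sel koszul_snd_def intro!: restrict_ext)
qed

text \<open>The new index is never counted among the elements smaller than some \<open>j\<close> in
  \<open>ys\<close>, so its presence does not affect the signs.\<close>

lemma koszul_snd_d:
  assumes xs: "set ys \<subseteq> carrier R" "x \<in> carrier R"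
    and f: "f \<in> carrier (koszul_module M (Suc (length ys)) (Suc (Suc p)))"
  shows "koszul_snd (length ys) p (koszul_d R M (ys @ [x]) (Suc p) f) =
    koszul_d R M ys p (koszul_snd (length ys) (Suc p) f)"
proof -
  let ?n = "length ys"
  have "koszul_coeff R M (ys @ [x]) f (insert ?n S) = koszul_coeff R M ys (koszul_snd ?n (Suc p) f) S"
    if S: "S \<in> koszul_index ?n p" for S
  proof -
    have n: "{..<length (ys @ [x])} - insert ?n S = {..<?n} - S" using S by (auto simp: koszul_index_def)
    have fs: "koszul_snd ?n (Suc p) f \<in> carrier (koszul_module M ?n (Suc p))"
      by (rule linear_mapD(3)[OF koszul_snd_linear f])
    have card: "{i. (i = ?n \<or> i \<in> S) \<and> i < j} = {i \<in> S. i < j}" if "j < ?n" for j using that by auto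
    show ?thesis
      unfolding koszul_coeff_def n
      by (rule M.finsum_cong'[OF refl koszul_coeff_closed[OF xs(1) S fs]])
        (use koszul_index_insert[OF S] in \<open>auto simp: koszul_snd_def nth_append card insert_commute\<close>)
  qed
  then show ?thesis
    using koszul_index_Suc2 by (auto simp: koszul_snd_def[of _ p] koszul_d_def intro!: restrict_ext)
qed

end

lemma koszul_module_0: "koszul_module M (Suc n) 0 = koszul_module M n 0"
  by (simp add: koszul_module_def koszul_index_0)

lemma (in module) koszul_fst_0: "f \<in> carrier (koszul_module M n 0) \<Longrightarrow> koszul_fst n 0 f = f"
  by (rule koszul_eqI[of _ n 0]) (auto simp: koszul_fst_def koszul_sel PiE_iff)

context cring
begin

lemma sign_closed: "(\<ominus> \<one>) [^] (p::nat) \<in> carrier R"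
  by simp

lemma sign_square: "(\<ominus> \<one>) [^] (p::nat) \<otimes> (\<ominus> \<one>) [^] p = \<one>"
proof -
  have "(\<ominus> \<one>) \<otimes> (\<ominus> \<one>) = \<one>" by (simp add: l_minus r_minus)
  then have "((\<ominus> \<one>) \<otimes> (\<ominus> \<one>)) [^] p = \<one>" by simp
  then show ?thesis by (subst (asm) nat_pow_distrib) simp_all
qed

lemma sign_Suc: "(\<ominus> \<one>) [^] Suc p = \<ominus> ((\<ominus> \<one>) [^] (p::nat))"
  by (simp add: r_minus)

end

lemma (in module) sign_sign:
  "a \<in> carrier M \<Longrightarrow> (\<ominus> \<one>) [^] (p::nat) \<odot>\<^bsub>M\<^esub> ((\<ominus> \<one>) [^] p \<odot>\<^bsub>M\<^esub> a) = a"
  by (simp add: smult_assoc1[symmetric] R.sign_square)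

context module
begin

text \<open>The induction appends one parameter and so avoids a double sum. On first components the
  two cross terms have the signs of degrees \<open>q + 1\<close> and \<open>q\<close> and cancel; on
  second components the differential is that of \<open>ys\<close>. In degree 0 there is no second
  component.\<close>

lemma koszul_complex:
  "set xs \<subseteq> carrier R \<Longrightarrow> koszul_boundaries R M xs p \<subseteq> koszul_cycles R M xs p"
proof (induction xs arbitrary: p rule: rev_induct)
  case Nil
  have "koszul_d R M [] q f = \<zero>\<^bsub>koszul_module M 0 q\<^esub>" for q f
    by (auto simp: koszul_d_def koszul_coeff_def koszul_sel intro!: restrict_ext)
  moreover have "\<zero>\<^bsub>koszul_module M 0 p\<^esub> \<in> koszul_cycles R M [] p"
    using module.subm_zero[OF koszul_is_module subm_koszul(2)[of "[]" p]] by simp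
  ultimately show ?case by (auto simp: koszul_boundaries_eq)
next
  case (snoc x ys)
  let ?n = "length ys"
  have xs: "set ys \<subseteq> carrier R" "x \<in> carrier R" "set (ys @ [x]) \<subseteq> carrier R" using snoc.prems by auto
  note lin' = koszul_d_linear[OF xs(3), simplified] and lin = koszul_d_linear[OF xs(1)]
  have dd: "koszul_d R M ys q (koszul_d R M ys (Suc q) f) = \<zero>\<^bsub>koszul_module M ?n q\<^esub>"
    if "f \<in> carrier (koszul_module M ?n (Suc (Suc q)))" for q f
    using snoc.IH[OF xs(1), of "Suc q"] that unfolding koszul_boundaries_eq koszul_cycles_Suc by blast
  show ?case
  proof (cases p)
    case 0
    then show ?thesis using linear_mapD(3)[OF lin', of _ 0] by (auto simp: koszul_boundaries_eq koszul_cycles_0)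
  next
    case (Suc q)
    have "koszul_d R M (ys @ [x]) q (koszul_d R M (ys @ [x]) (Suc q) f) = \<zero>\<^bsub>koszul_module M (Suc ?n) q\<^esub>"
      if f: "f \<in> carrier (koszul_module M (Suc ?n) (Suc (Suc q)))" for f
    proof -
      interpret K: module R "koszul_module M ?n q" by (rule koszul_is_module)
      interpret K1: module R "koszul_module M ?n (Suc q)" by (rule koszul_is_module)
      interpret K': module R "koszul_module M (Suc ?n) q" by (rule koszul_is_module)
      let ?g = "koszul_d R M (ys @ [x]) (Suc q) f"
      have g: "?g \<in> carrier (koszul_module M (Suc ?n) (Suc q))" by (rule linear_mapD(3)[OF lin' f])
      then have dg: "koszul_d R M (ys @ [x]) q ?g \<in> carrier (koszul_module M (Suc ?n) q)" by (rule linear_mapD(3)[OF lin'])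
      have ff: "koszul_fst ?n (Suc (Suc q)) f \<in> carrier (koszul_module M ?n (Suc (Suc q)))"
        and sf: "koszul_snd ?n (Suc q) f \<in> carrier (koszul_module M ?n (Suc q))"
        using linear_mapD(3)[OF koszul_fst_linear f] linear_mapD(3)[OF koszul_snd_linear f] by auto
      let ?s = "koszul_snd ?n (Suc q) f"
      have ds: "koszul_d R M ys q ?s \<in> carrier (koszul_module M ?n q)" by (rule linear_mapD(3)[OF lin sf])
      have c: "(\<ominus> \<one>) [^] Suc q \<otimes> x \<in> carrier R" "(\<ominus> \<one>) [^] q \<otimes> x \<in> carrier R" using xs(2) by auto
      have "koszul_d R M ys q (koszul_fst ?n (Suc q) ?g) = koszul_d R M ys q (koszul_d R M ys (Suc q) (koszul_fst ?n (Suc (Suc q)) f))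
          \<oplus>\<^bsub>koszul_module M ?n q\<^esub> koszul_d R M ys q (((\<ominus> \<one>) [^] Suc q \<otimes> x) \<odot>\<^bsub>koszul_module M ?n (Suc q)\<^esub> ?s)"
        unfolding koszul_fst_d[OF xs(1,2) f]
        by (rule linear_mapD(4)[OF lin]) (use linear_mapD(3)[OF lin ff] K1.smult_closed[OF c(1) sf] in auto)
      also have "\<dots> = ((\<ominus> \<one>) [^] Suc q \<otimes> x) \<odot>\<^bsub>koszul_module M ?n q\<^esub> koszul_d R M ys q ?s"
        unfolding dd[OF ff] linear_mapD(5)[OF lin c(1) sf] using ds c by simp
      finally have 1: "koszul_d R M ys q (koszul_fst ?n (Suc q) ?g) =
          ((\<ominus> \<one>) [^] Suc q \<otimes> x) \<odot>\<^bsub>koszul_module M ?n q\<^esub> koszul_d R M ys q ?s" .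
      have "koszul_fst ?n q (koszul_d R M (ys @ [x]) q ?g) =
          ((\<ominus> \<one>) [^] Suc q \<otimes> x \<oplus> (\<ominus> \<one>) [^] q \<otimes> x) \<odot>\<^bsub>koszul_module M ?n q\<^esub> koszul_d R M ys q ?s"
        unfolding koszul_fst_d[OF xs(1,2) g] 1 koszul_snd_d[OF xs(1,2) f] K.smult_l_distr[OF c ds] ..
      also have "(\<ominus> \<one>) [^] Suc q \<otimes> x \<oplus> (\<ominus> \<one>) [^] q \<otimes> x = \<zero>"
        unfolding R.sign_Suc using xs(2) by (simp add: R.l_minus R.l_neg)
      finally have fst0: "koszul_fst ?n q (koszul_d R M (ys @ [x]) q ?g) = \<zero>\<^bsub>koszul_module M ?n q\<^esub>" using ds by simp
      show ?thesis
      proof (cases q)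
        case 0
        then show ?thesis using fst0 dg koszul_fst_0 by (simp add: koszul_module_0)
      next
        case (Suc r)
        have "koszul_snd ?n r (koszul_d R M (ys @ [x]) q ?g) = koszul_d R M ys r (koszul_snd ?n q ?g)"
          using koszul_snd_d[OF xs(1,2)] g unfolding Suc by blast
        also have "koszul_snd ?n q ?g = koszul_d R M ys q ?s" by (rule koszul_snd_d[OF xs(1,2) f])
        also have "koszul_d R M ys r \<dots> = \<zero>\<^bsub>koszul_module M ?n r\<^esub>" using dd sf unfolding Suc by blast
        finally have snd0: "koszul_snd ?n r (koszul_d R M (ys @ [x]) q ?g) = \<zero>\<^bsub>koszul_module M ?n r\<^esub>" .
        show ?thesis unfolding Suc
        proof (rule koszul_pair_eqI[OF dg[unfolded Suc] K'.M.zero_closed[unfolded Suc]])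
          show "koszul_fst ?n (Suc r) (koszul_d R M (ys @ [x]) (Suc r) (koszul_d R M (ys @ [x]) (Suc (Suc r)) f)) =
              koszul_fst ?n (Suc r) \<zero>\<^bsub>koszul_module M (Suc ?n) (Suc r)\<^esub>"
            by (rule trans[OF fst0[unfolded Suc] linear_map_zero_neg(1)[OF koszul_fst_linear, symmetric]])
          show "koszul_snd ?n r (koszul_d R M (ys @ [x]) (Suc r) (koszul_d R M (ys @ [x]) (Suc (Suc r)) f)) =
              koszul_snd ?n r \<zero>\<^bsub>koszul_module M (Suc ?n) (Suc r)\<^esub>"
            by (rule trans[OF snd0[unfolded Suc] linear_map_zero_neg(1)[OF koszul_snd_linear, symmetric]])
        qed
      qed
    qed
    then show ?thesis using linear_mapD(3)[OF lin', of _ "Suc q"]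
      by (auto simp: koszul_boundaries_eq koszul_cycles_Suc Suc)
  qed
qed

end

section \<open>Koszul homology after appending one parameter\<close>

context module
begin

context
  fixes ys :: "'a list" and x :: 'a and n :: nat
  assumes ys: "set ys \<subseteq> carrier R" and x: "x \<in> carrier R" and n: "n = length ys"
begin

private abbreviation "K p \<equiv> koszul_module M n p"
private abbreviation "K' p \<equiv> koszul_module M (Suc n) p"
private abbreviation "Z p \<equiv> koszul_cycles R M ys p"
private abbreviation "Z' p \<equiv> koszul_cycles R M (ys @ [x]) p"
private abbreviation "B p \<equiv> koszul_boundaries R M ys p"
private abbreviation "B' p \<equiv> koszul_boundaries R M (ys @ [x]) p"
private abbreviation "d p \<equiv> koszul_d R M ys p"
private abbreviation "d' p \<equiv> koszul_d R M (ys @ [x]) p"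

private lemma xs: "set (ys @ [x]) \<subseteq> carrier R" "length (ys @ [x]) = Suc n"
  using ys x n by auto

private lemma subm_Z: "submodule (Z p) R (K p)"
  "submodule (B p) R (K p)"
  "submodule (Z' p) R (K' p)"
  "submodule (B' p) R (K' p)"
  using subm_koszul[OF ys, of p] subm_koszul[OF xs(1), of p] xs(2) n by auto

text \<open>Intermediate between cycles and boundaries of \<open>ys @ [x]\<close>: it exhibits \<open>H\<^sub>p\<^sub>+\<^sub>1(ys @ [x]; M)\<close> as an
  extension of \<open>0 : x\<close> on \<open>H\<^sub>p(ys; M)\<close> by \<open>H\<^sub>p\<^sub>+\<^sub>1(ys; M) / x H\<^sub>p\<^sub>+\<^sub>1(ys; M)\<close>.\<close>

definition koszul_mid :: "nat \<Rightarrow> (nat set \<Rightarrow> 'c) set" where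
  "koszul_mid p = {f \<in> Z' (Suc p). koszul_snd n p f \<in> B p}"

private lemma d_lin: "linear_map R (K (Suc p)) (K p) (d p)"
  "linear_map R (K' (Suc p)) (K' p) (d' p)"
  using koszul_d_linear[OF ys, of p] koszul_d_linear[OF xs(1), of p] xs(2) n by auto

private lemma sx: "(\<ominus> \<one>) [^] (p::nat) \<otimes> x \<in> carrier R"
  using x by simp

private lemma d_pair:
  assumes a: "a \<in> carrier (K (Suc p))" and b: "b \<in> carrier (K p)"
  shows "koszul_fst n p (d' p (koszul_pair n p a b)) =
      d p a \<oplus>\<^bsub>K p\<^esub> ((\<ominus> \<one>) [^] p \<otimes> x) \<odot>\<^bsub>K p\<^esub> b"
  using koszul_fst_d[OF ys x, of "koszul_pair n p a b" p] koszul_pair[OF a b] n by simp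

private lemma snd_d_pair:
  assumes a: "a \<in> carrier (K (Suc (Suc p)))" and b: "b \<in> carrier (K (Suc p))"
  shows "koszul_snd n p (d' (Suc p) (koszul_pair n (Suc p) a b)) = d p b"
  using koszul_snd_d[OF ys x, of "koszul_pair n (Suc p) a b" p] koszul_pair[OF a b] n by simp

text \<open>The second component of the differential of \<open>(a, b)\<close> is \<open>d b\<close>,
  which is zero since \<open>b\<close> is a cycle; \<open>eq\<close> is the vanishing of the first
  component.\<close>

private lemma cycle_pair:
  assumes a: "a \<in> carrier (K (Suc p))" and b: "b \<in> Z p"
    and eq: "d p a \<oplus>\<^bsub>K p\<^esub> ((\<ominus> \<one>) [^] p \<otimes> x) \<odot>\<^bsub>K p\<^esub> b = \<zero>\<^bsub>K p\<^esub>"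
  shows "koszul_pair n p a b \<in> Z' (Suc p)"
proof -
  interpret K': module R "K' p" by (rule koszul_is_module)
  have bc: "b \<in> carrier (K p)" using b module.subm_carrier[OF koszul_is_module subm_Z(1)] by blast
  let ?f = "koszul_pair n p a b"
  have f: "?f \<in> carrier (K' (Suc p))" by (rule koszul_pair(1)[OF a bc])
  have df: "d' p ?f \<in> carrier (K' p)" by (rule linear_mapD(3)[OF d_lin(2) f])
  have fst0: "koszul_fst n p (d' p ?f) = \<zero>\<^bsub>K p\<^esub>"
    using d_pair[OF a bc] eq by simp
  have "d' p ?f = \<zero>\<^bsub>K' p\<^esub>"
  proof (cases p)
    case 0
    then show ?thesis using fst0 df koszul_fst_0 by (simp add: koszul_module_0)
  next
    case (Suc r)
    have "d r b = \<zero>\<^bsub>K r\<^esub>" using b n unfolding Suc koszul_cycles_Suc by blast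
    then have snd0: "koszul_snd n r (d' (Suc r) (koszul_pair n (Suc r) a b)) = \<zero>\<^bsub>K r\<^esub>"
      using snd_d_pair[of a r b] a bc unfolding Suc by simp
    show ?thesis unfolding Suc
    proof (rule koszul_pair_eqI[OF df[unfolded Suc] K'.M.zero_closed[unfolded Suc]])
      show "koszul_fst n (Suc r) (d' (Suc r) (koszul_pair n (Suc r) a b)) =
          koszul_fst n (Suc r) \<zero>\<^bsub>K' (Suc r)\<^esub>"
        by (rule trans[OF fst0[unfolded Suc] linear_map_zero_neg(1)[OF koszul_fst_linear, symmetric]])
      show "koszul_snd n r (d' (Suc r) (koszul_pair n (Suc r) a b)) =
          koszul_snd n r \<zero>\<^bsub>K' (Suc r)\<^esub>"
        by (rule trans[OF snd0 linear_map_zero_neg(1)[OF koszul_snd_linear, symmetric]])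
    qed
  qed
  then show ?thesis unfolding koszul_cycles_Suc using f xs(2) by simp
qed

private lemma cycleD:
  assumes f: "f \<in> Z' (Suc p)"
  shows "f \<in> carrier (K' (Suc p))"
    "d p (koszul_fst n (Suc p) f) \<oplus>\<^bsub>K p\<^esub>
      ((\<ominus> \<one>) [^] p \<otimes> x) \<odot>\<^bsub>K p\<^esub> koszul_snd n p f = \<zero>\<^bsub>K p\<^esub>"
    "koszul_snd n p f \<in> Z p"
proof -
  show fc: "f \<in> carrier (K' (Suc p))" using f n unfolding koszul_cycles_Suc by simp
  have df: "d' p f = \<zero>\<^bsub>K' p\<^esub>" using f n unfolding koszul_cycles_Suc by simp
  show "d p (koszul_fst n (Suc p) f) \<oplus>\<^bsub>K p\<^esub>
      ((\<ominus> \<one>) [^] p \<otimes> x) \<odot>\<^bsub>K p\<^esub> koszul_snd n p f = \<zero>\<^bsub>K p\<^esub>"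
    using koszul_fst_d[OF ys x, of f p] fc df linear_map_zero_neg(1)[OF koszul_fst_linear, of n p] n by simp
  have sf: "koszul_snd n p f \<in> carrier (K p)" by (rule linear_mapD(3)[OF koszul_snd_linear fc])
  show "koszul_snd n p f \<in> Z p"
  proof (cases p)
    case 0
    then show ?thesis using sf n by (simp add: koszul_cycles_0)
  next
    case (Suc r)
    then have "d r (koszul_snd n p f) = \<zero>\<^bsub>K r\<^esub>"
      using koszul_snd_d[OF ys x, of f r] fc df linear_map_zero_neg(1)[OF koszul_snd_linear, of n r] n by simp
    then show ?thesis using sf n unfolding Suc koszul_cycles_Suc by simp
  qed
qed

text \<open>A cycle \<open>b\<close> of \<open>ys\<close> is the second component of a cycle exactly
  if \<open>x b\<close> is a boundary, since a suitable first component \<open>a\<close> has to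
  satisfy \<open>d a = - (-1)^p x b\<close>.\<close>

lemma sq_iso_koszul_snd:
  "sq_iso R (K' (Suc p)) (K p) (koszul_snd n p)
     (Z' (Suc p)) (koszul_mid p)
     (colon (K p) x (Z p) (B p)) (B p)"
proof -
  interpret K: module R "K p" by (rule koszul_is_module)
  interpret K1: module R "K (Suc p)" by (rule koszul_is_module)
  interpret K': module R "K' (Suc p)" by (rule koszul_is_module)
  note S = linear_mapD[OF koszul_snd_linear[of n p]]
  note cx = koszul_complex[OF ys, of p]
  have sub: "K.subm (colon (K p) x (Z p) (B p))"
    using subm_Z x by (intro K.subm_intros)
  have le: "B p \<subseteq> colon (K p) x (Z p) (B p)"
    by (rule K.subset_colon[OF x subm_Z(2) cx])
  have mid: "K'.subm (koszul_mid p)"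
  proof -
    have "koszul_mid p = Z' (Suc p) \<inter>
        {f \<in> carrier (K' (Suc p)). koszul_snd n p f \<in> B p}"
      using K'.subm_sub[OF subm_Z(3)] unfolding koszul_mid_def by blast
    then show ?thesis
      using K'.subm_Int[OF subm_Z(3) linear_map_image_kernel(2)[OF koszul_snd_linear subm_Z(2)]] by simp
  qed
  have img: "koszul_snd n p ` Z' (Suc p) =
      colon (K p) x (Z p) (B p)"
  proof (intro subset_antisym subsetI)
    fix b assume "b \<in> koszul_snd n p ` Z' (Suc p)"
    then obtain f where f: "f \<in> Z' (Suc p)" "b = koszul_snd n p f" by blast
    note C = cycleD[OF f(1)]
    have b: "b \<in> carrier (K p)" "b \<in> Z p" using C(3) K.subm_carrier[OF subm_Z(1)] f(2) by auto
    let ?u = "d p (koszul_fst n (Suc p) f)"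
    have u: "?u \<in> B p" "?u \<in> carrier (K p)"
      unfolding koszul_boundaries_eq using linear_mapD(3)[OF koszul_fst_linear C(1)] linear_mapD(3)[OF d_lin(1)] n by auto
    have "((\<ominus> \<one>) [^] p \<otimes> x) \<odot>\<^bsub>K p\<^esub> b \<in> B p"
      using K.subm_cancel'[OF subm_Z(2) _ u(1)] C(2) K.subm_zero[OF subm_Z(2)] K.smult_closed[OF sx b(1)] f(2) by metis
    then have "(\<ominus> \<one>) [^] p \<odot>\<^bsub>K p\<^esub> (((\<ominus> \<one>) [^] p \<otimes> x) \<odot>\<^bsub>K p\<^esub> b) \<in> B p"
      by (rule K.subm_smult[OF subm_Z(2) R.sign_closed])
    then have "x \<odot>\<^bsub>K p\<^esub> b \<in> B p"
      using K.sign_sign[of "x \<odot>\<^bsub>K p\<^esub> b" p] x b by (simp add: K.smult_assoc1)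
    then show "b \<in> colon (K p) x (Z p) (B p)"
      using b by (simp add: colon_def)
  next
    fix b assume "b \<in> colon (K p) x (Z p) (B p)"
    then have b: "b \<in> Z p" "x \<odot>\<^bsub>K p\<^esub> b \<in> B p"
      by (auto simp: colon_def)
    have bc: "b \<in> carrier (K p)" using b(1) K.subm_carrier[OF subm_Z(1)] by auto
    obtain a where a: "a \<in> carrier (K (Suc p))" "d p a = x \<odot>\<^bsub>K p\<^esub> b"
      using b(2) n unfolding koszul_boundaries_eq by auto
    \<comment> \<open>From \<open>d a = x b\<close>, the factor \<open>- (-1)^p\<close> produces the
      first component that makes the differential of the pair vanish.\<close>
    let ?a = "\<ominus>\<^bsub>K (Suc p)\<^esub> ((\<ominus> \<one>) [^] p \<odot>\<^bsub>K (Suc p)\<^esub> a)"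
    have ac: "(\<ominus> \<one>) [^] p \<odot>\<^bsub>K (Suc p)\<^esub> a \<in> carrier (K (Suc p))"
      using a(1) by simp
    have "d p ?a = \<ominus>\<^bsub>K p\<^esub> ((\<ominus> \<one>) [^] p \<odot>\<^bsub>K p\<^esub> (x \<odot>\<^bsub>K p\<^esub> b))"
      unfolding linear_map_zero_neg(2)[OF d_lin(1) ac] linear_mapD(5)[OF d_lin(1) R.sign_closed a(1)] a(2) ..
    then have "d p ?a \<oplus>\<^bsub>K p\<^esub> ((\<ominus> \<one>) [^] p \<otimes> x) \<odot>\<^bsub>K p\<^esub> b = \<zero>\<^bsub>K p\<^esub>"
      using x bc by (simp add: K.smult_assoc1 K.M.l_neg)
    then have "koszul_pair n p ?a b \<in> Z' (Suc p)"
      using ac by (intro cycle_pair b(1)) auto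
    moreover have "koszul_snd n p (koszul_pair n p ?a b) = b" using ac bc by (intro koszul_pair(3)) auto
    ultimately show "b \<in> koszul_snd n p ` Z' (Suc p)" by (metis image_eqI)
  qed
  show ?thesis
  proof (rule sq_isoI[OF K'.module_axioms K.module_axioms subm_Z(3) mid sub subm_Z(2) _ _ _ _ le])
    show "colon (K p) x (Z p) (B p) =
      koszul_snd n p ` Z' (Suc p) <+>\<^bsub>K p\<^esub> B p"
      unfolding img using K.set_add_absorb2[OF sub subm_Z(2) le] by simp
    show "koszul_mid p = {f \<in> Z' (Suc p). koszul_snd n p f \<in> B p}"
      by (rule koszul_mid_def)
  qed (use S(4,5) K'.subm_carrier[OF subm_Z(3)] in auto)
qed

lemma koszul_mid_le: "B' (Suc p) \<subseteq> koszul_mid p" "koszul_mid p \<subseteq> Z' (Suc p)"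
proof -
  show "koszul_mid p \<subseteq> Z' (Suc p)" unfolding koszul_mid_def by blast
  show "B' (Suc p) \<subseteq> koszul_mid p"
  proof
    fix f assume f: "f \<in> B' (Suc p)"
    then obtain g where g: "g \<in> carrier (K' (Suc (Suc p)))" "f = d' (Suc p) g"
      using n unfolding koszul_boundaries_eq by auto
    have "koszul_snd n p f = d p (koszul_snd n (Suc p) g)" using koszul_snd_d[OF ys x, of g p] g n by simp
    then have "koszul_snd n p f \<in> B p"
      unfolding koszul_boundaries_eq using linear_mapD(3)[OF koszul_snd_linear g(1)] n by auto
    then show "f \<in> koszul_mid p" unfolding koszul_mid_def using f koszul_complex[OF xs(1)] by blast
  qed
qed

text \<open>If the second component of a cycle is a boundary \<open>d b\<close>, then subtracting
  the boundary of \<open>(0, b)\<close> leaves a pair \<open>(a, 0)\<close> with \<open>a\<close> a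
  cycle. Such a pair is itself a boundary exactly if \<open>a = d c + x z\<close> for some cycle
  \<open>z\<close>.\<close>

lemma sq_iso_koszul_fst:
  "sq_iso R (K (Suc p)) (K' (Suc p))
     (\<lambda>a. koszul_pair n p a \<zero>\<^bsub>K p\<^esub>)
     (Z (Suc p))
     (B (Suc p) <+>\<^bsub>K (Suc p)\<^esub> scale (K (Suc p)) x (Z (Suc p)))
     (koszul_mid p) (B' (Suc p))"
proof -
  interpret K: module R "K p" by (rule koszul_is_module)
  interpret K1: module R "K (Suc p)" by (rule koszul_is_module)
  interpret K2: module R "K (Suc (Suc p))" by (rule koszul_is_module)
  interpret K': module R "K' (Suc p)" by (rule koszul_is_module)
  let ?i = "\<lambda>a. koszul_pair n p a \<zero>\<^bsub>K p\<^esub>"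
  let ?Z = "Z (Suc p)" and ?B = "B (Suc p)" and ?B' = "B' (Suc p)"
  note i = koszul_pair[OF _ K.M.zero_closed]
  have Zc: "a \<in> carrier (K (Suc p))" if "a \<in> ?Z" for a using that K1.subm_carrier[OF subm_Z(1)] by auto
  have Zd: "d p a = \<zero>\<^bsub>K p\<^esub>" if "a \<in> ?Z" for a
    using that n unfolding koszul_cycles_Suc by blast
  have ZI: "a \<in> ?Z" if "a \<in> carrier (K (Suc p))" "d p a = \<zero>\<^bsub>K p\<^esub>" for a
    using that n unfolding koszul_cycles_Suc by blast
  have mid: "K'.subm (koszul_mid p)" using sq_isoD(4)[OF sq_iso_koszul_snd] .
  have sB: "K1.subm (?B <+>\<^bsub>K (Suc p)\<^esub> scale (K (Suc p)) x ?Z)"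
    using subm_Z x by (intro K1.subm_intros)
  note F = linear_mapD[OF koszul_fst_linear[of n "Suc p"]] and S = linear_mapD[OF koszul_snd_linear[of n p]]
  note F2 = linear_mapD[OF koszul_fst_linear[of n "Suc (Suc p)"]] and S2 = linear_mapD[OF koszul_snd_linear[of n "Suc p"]]
  note d = linear_mapD[OF d_lin(1)] and d' = linear_mapD[OF d_lin(2)]
  have iadd: "?i (a \<oplus>\<^bsub>K (Suc p)\<^esub> b) = ?i a \<oplus>\<^bsub>K' (Suc p)\<^esub> ?i b"
    if "a \<in> carrier (K (Suc p))" "b \<in> carrier (K (Suc p))" for a b
    by (rule koszul_pair_eqI[where n = n and p = p]) (use that i in \<open>simp_all add: F(4) S(4)\<close>)
  have ismult: "?i (r \<odot>\<^bsub>K (Suc p)\<^esub> a) = r \<odot>\<^bsub>K' (Suc p)\<^esub> ?i a"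
    if "a \<in> carrier (K (Suc p))" "r \<in> carrier R" for r a
    by (rule koszul_pair_eqI[where n = n and p = p]) (use that i in \<open>simp_all add: F(5) S(5)\<close>)
  have imid: "?i a \<in> koszul_mid p" if a: "a \<in> ?Z" for a
  proof -
    have "?i a \<in> Z' (Suc p)"
      by (rule cycle_pair[OF Zc[OF a] K.subm_zero[OF subm_Z(1)]]) (use Zd[OF a] sx in simp)
    then show ?thesis unfolding koszul_mid_def using i(3)[OF Zc[OF a]] K.subm_zero[OF subm_Z(2)] by simp
  qed
  have img: "koszul_mid p = ?i ` ?Z <+>\<^bsub>K' (Suc p)\<^esub> ?B'"
  proof
    show "?i ` ?Z <+>\<^bsub>K' (Suc p)\<^esub> ?B' \<subseteq> koszul_mid p"
      using imid by (intro K'.set_add_least[OF mid] koszul_mid_le) auto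
    show "koszul_mid p \<subseteq> ?i ` ?Z <+>\<^bsub>K' (Suc p)\<^esub> ?B'"
    proof
      fix f assume f: "f \<in> koszul_mid p"
      then have fZ: "f \<in> Z' (Suc p)" using koszul_mid_le by blast
      note C = cycleD[OF fZ]
      obtain b where b: "b \<in> carrier (K (Suc p))" "koszul_snd n p f = d p b"
        using f n unfolding koszul_mid_def koszul_boundaries_eq by auto
      \<comment> \<open>The differential of this pair has second component \<open>d b\<close>, the
        one of \<open>f\<close>, so it removes that component from \<open>f\<close>.\<close>
      let ?g = "koszul_pair n (Suc p) \<zero>\<^bsub>K (Suc (Suc p))\<^esub> b"
      have g: "?g \<in> carrier (K' (Suc (Suc p)))" by (rule koszul_pair(1)[OF K2.M.zero_closed b(1)])
      let ?h = "d' (Suc p) ?g"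
      have h: "?h \<in> ?B'" "?h \<in> carrier (K' (Suc p))"
        unfolding koszul_boundaries_eq using g d'(3)[OF g] n by auto
      let ?a = "koszul_fst n (Suc p) f \<ominus>\<^bsub>K (Suc p)\<^esub> koszul_fst n (Suc p) ?h"
      have a: "?a \<in> carrier (K (Suc p))" using F(3)[OF C(1)] F(3)[OF h(2)] by simp
      have f_eq: "f = ?i ?a \<oplus>\<^bsub>K' (Suc p)\<^esub> ?h"
      proof (rule koszul_pair_eqI)
        show "koszul_fst n (Suc p) f = koszul_fst n (Suc p) (?i ?a \<oplus>\<^bsub>K' (Suc p)\<^esub> ?h)"
          using F(4)[OF i(1)[OF a] h(2)] i(2)[OF a] F(3)[OF C(1)] F(3)[OF h(2)]
          by (simp add: a_minus_def K1.M.a_assoc K1.M.l_neg)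
        show "koszul_snd n p f = koszul_snd n p (?i ?a \<oplus>\<^bsub>K' (Suc p)\<^esub> ?h)"
          using S(4)[OF i(1)[OF a] h(2)] i(3)[OF a] snd_d_pair[OF K2.M.zero_closed b(1)] b(2) d(3)[OF b(1)] by simp
      qed (use C(1) i(1)[OF a] h(2) in auto)
      have "?i ?a \<in> Z' (Suc p)"
        by (rule K'.subm_cancel[OF subm_Z(3), of _ ?h])
          (use fZ f_eq h koszul_complex[OF xs(1)] i(1)[OF a] in auto)
      from cycleD(2)[OF this] have "d p ?a = \<zero>\<^bsub>K p\<^esub>"
        using i(2,3)[OF a] d(3)[OF a] sx[of p] by simp
      then have aZ: "?a \<in> ?Z" by (rule ZI[OF a])
      then show "f \<in> ?i ` ?Z <+>\<^bsub>K' (Suc p)\<^esub> ?B'"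
        by (subst f_eq, intro set_addI imageI aZ h(1))
    qed
  qed
  have ker: "?B <+>\<^bsub>K (Suc p)\<^esub> scale (K (Suc p)) x ?Z = {a \<in> ?Z. ?i a \<in> ?B'}"
  proof (intro subset_antisym subsetI)
    fix a assume "a \<in> ?B <+>\<^bsub>K (Suc p)\<^esub> scale (K (Suc p)) x ?Z"
    then obtain c z where c: "c \<in> carrier (K (Suc (Suc p)))" "z \<in> ?Z"
      "a = d (Suc p) c \<oplus>\<^bsub>K (Suc p)\<^esub> x \<odot>\<^bsub>K (Suc p)\<^esub> z"
      using n by (auto simp: koszul_boundaries_eq scale_def elim!: set_addE)
    have dc: "d (Suc p) c \<in> ?B" unfolding koszul_boundaries_eq using c n by auto
    have aZ: "a \<in> ?Z"
      unfolding c(3) using K1.subm_add[OF subm_Z(1)] K1.subm_smult[OF subm_Z(1) x c(2)] koszul_complex[OF ys] dc by blast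
    \<comment> \<open>The sign cancels the one in the cross term of the differential, which
      therefore becomes \<open>x z\<close>.\<close>
    let ?z = "(\<ominus> \<one>) [^] Suc p \<odot>\<^bsub>K (Suc p)\<^esub> z"
    have z: "?z \<in> ?Z" by (rule K1.subm_smult[OF subm_Z(1) R.sign_closed c(2)])
    have zc: "z \<in> carrier (K (Suc p))" "?z \<in> carrier (K (Suc p))" using Zc z c by auto
    let ?g = "koszul_pair n (Suc p) c ?z"
    have g: "?g \<in> carrier (K' (Suc (Suc p)))" by (rule koszul_pair(1)[OF c(1) zc(2)])
    have "d' (Suc p) ?g = ?i a"
    proof (rule koszul_pair_eqI)
      have "((\<ominus> \<one>) [^] Suc p \<otimes> x) \<odot>\<^bsub>K (Suc p)\<^esub> ?z = x \<odot>\<^bsub>K (Suc p)\<^esub> z"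
        using K1.sign_sign[of "x \<odot>\<^bsub>K (Suc p)\<^esub> z" "Suc p"] zc x
          K1.smult_swap[OF x R.sign_closed[of "Suc p"] zc(1)] K1.smult_assoc1[OF R.sign_closed[of "Suc p"] x zc(2)] by simp
      then show "koszul_fst n (Suc p) (d' (Suc p) ?g) = koszul_fst n (Suc p) (?i a)"
        using d_pair[OF c(1) zc(2)] i(2)[OF Zc[OF aZ]] c(3) by simp
      show "koszul_snd n p (d' (Suc p) ?g) = koszul_snd n p (?i a)"
        using snd_d_pair[OF c(1) zc(2)] Zd[OF z] i(3)[OF Zc[OF aZ]] by simp
    qed (use d'(3)[OF g] i(1)[OF Zc[OF aZ]] in auto)
    then have "?i a \<in> ?B'" unfolding koszul_boundaries_eq using g n by (metis image_eqI length_append_singleton)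
    then show "a \<in> {a \<in> ?Z. ?i a \<in> ?B'}" using aZ by blast
  next
    fix a assume "a \<in> {a \<in> ?Z. ?i a \<in> ?B'}"
    then have a: "a \<in> ?Z" "?i a \<in> ?B'" by auto
    obtain g where g: "g \<in> carrier (K' (Suc (Suc p)))" "?i a = d' (Suc p) g"
      using a(2) n unfolding koszul_boundaries_eq by auto
    let ?s = "koszul_snd n (Suc p) g" and ?f = "koszul_fst n (Suc (Suc p)) g"
    have "d p ?s = \<zero>\<^bsub>K p\<^esub>"
      using koszul_snd_d[OF ys x, of g p] g n i(3)[OF Zc[OF a(1)]] by simp
    then have s: "?s \<in> ?Z" by (rule ZI[OF S2(3)[OF g(1)]])
    have "a = d (Suc p) ?f \<oplus>\<^bsub>K (Suc p)\<^esub> ((\<ominus> \<one>) [^] Suc p \<otimes> x) \<odot>\<^bsub>K (Suc p)\<^esub> ?s"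
      using koszul_fst_d[OF ys x, of g "Suc p"] g n i(2)[OF Zc[OF a(1)]] by simp
    also have "((\<ominus> \<one>) [^] Suc p \<otimes> x) \<odot>\<^bsub>K (Suc p)\<^esub> ?s =
        x \<odot>\<^bsub>K (Suc p)\<^esub> ((\<ominus> \<one>) [^] Suc p \<odot>\<^bsub>K (Suc p)\<^esub> ?s)"
      using K1.smult_assoc1[OF R.sign_closed[of "Suc p"] x] K1.smult_swap[OF x R.sign_closed[of "Suc p"]] Zc[OF s] by simp
    finally show "a \<in> ?B <+>\<^bsub>K (Suc p)\<^esub> scale (K (Suc p)) x ?Z"
      using F2(3)[OF g(1)] n K1.subm_smult[OF subm_Z(1) R.sign_closed[of "Suc p"] s]
      by (auto simp: koszul_boundaries_eq scale_def intro!: set_addI)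
  qed
  show ?thesis
    by (rule sq_isoI[OF K1.module_axioms K'.module_axioms subm_Z(1) sB mid subm_Z(4) _ _ img ker koszul_mid_le(1)])
      (use iadd ismult Zc in auto)
qed

text \<open>In degree 0 every element is a cycle and no second component exists, so only the
  cokernel of \<open>x\<close> on the homology of \<open>ys\<close> remains.\<close>

lemma koszul_boundaries_snoc_0:
  "B' 0 = B 0 <+>\<^bsub>K 0\<^esub>
     scale (K 0) x (Z 0)"
proof (intro subset_antisym subsetI)
  interpret K: module R "K 0" by (rule koszul_is_module)
  fix f assume "f \<in> B' 0"
  then obtain g where g: "g \<in> carrier (K' (Suc 0))" "f = d' 0 g"
    using n unfolding koszul_boundaries_eq by auto
  have "f \<in> carrier (K 0)" using linear_mapD(3)[OF d_lin(2) g(1)] g(2) by (simp add: koszul_module_0)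
  then have "f = d 0 (koszul_fst n (Suc 0) g) \<oplus>\<^bsub>K 0\<^esub> x \<odot>\<^bsub>K 0\<^esub> koszul_snd n 0 g"
    using koszul_fst_d[OF ys x, of g 0] g koszul_fst_0 n x by simp
  then show "f \<in> B 0 <+>\<^bsub>K 0\<^esub> scale (K 0) x (Z 0)"
    using linear_mapD(3)[OF koszul_fst_linear g(1)] linear_mapD(3)[OF koszul_snd_linear g(1)] n
    by (auto simp: koszul_boundaries_eq koszul_cycles_0 scale_def intro!: set_addI)
next
  interpret K: module R "K 0" by (rule koszul_is_module)
  fix f assume "f \<in> B 0 <+>\<^bsub>K 0\<^esub> scale (K 0) x (Z 0)"
  then obtain a b where ab: "a \<in> carrier (K (Suc 0))" "b \<in> carrier (K 0)"
    "f = d 0 a \<oplus>\<^bsub>K 0\<^esub> x \<odot>\<^bsub>K 0\<^esub> b"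
    using n by (auto simp: koszul_boundaries_eq koszul_cycles_0 scale_def elim!: set_addE)
  have g: "koszul_pair n 0 a b \<in> carrier (K' (Suc 0))" by (rule koszul_pair(1)[OF ab(1,2)])
  have "d' 0 (koszul_pair n 0 a b) = f"
    using d_pair[OF ab(1,2)] ab(3) x koszul_fst_0 linear_mapD(3)[OF d_lin(2) g] by (simp add: koszul_module_0)
  then show "f \<in> B' 0"
    unfolding koszul_boundaries_eq using g n by (metis image_eqI length_append_singleton)
qed

end

end

section \<open>Serre multiplicities as iterated length differences\<close>

text \<open>Each \<open>k p\<close> comes in through \<open>e (Suc p)\<close>, one degree higher,
  and so with the opposite sign; in the top degree only \<open>h (Suc n)\<close> is left
  over.\<close>

lemma alternating_sum:
  fixes e h k :: "nat \<Rightarrow> int"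
  assumes "e 0 = h 0" "\<And>p. e (Suc p) = k p + h (Suc p)"
  shows "(\<Sum>p\<le>Suc n. (- 1) ^ p * e p) = (\<Sum>p\<le>n. (- 1) ^ p * (h p - k p)) + (- 1) ^ Suc n * h (Suc n)"
  by (induction n) (simp_all add: assms algebra_simps)

context module
begin

lemma koszul_module_gt:
  assumes "n < p" "submodule A R (koszul_module M n p)"
  shows "A = {\<zero>\<^bsub>koszul_module M n p\<^esub>}"
proof -
  interpret K: module R "koszul_module M n p" by (rule koszul_is_module)
  have "carrier (koszul_module M n p) = {\<zero>\<^bsub>koszul_module M n p\<^esub>}"
    using koszul_index_gt[OF assms(1)] by (simp add: koszul_sel restrict_def)
  then show ?thesis using K.subm_sub[OF assms(2)] K.subm_zero[OF assms(2)] by blast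
qed

text \<open>For the empty sequence the only index of degree 0 is the empty set and all differentials
  vanish, so an element of \<open>M\<close> becomes a one-entry family.\<close>

lemma sq_iso_koszul_Nil:
  "sq_iso R M (koszul_module M 0 0) (\<lambda>m. \<lambda>S \<in> koszul_index 0 0. m) (carrier M) {\<zero>\<^bsub>M\<^esub>}
     (koszul_cycles R M [] 0) (koszul_boundaries R M [] 0)"
proof -
  interpret K: module R "koszul_module M 0 0" by (rule koszul_is_module)
  have d: "koszul_d R M [] q f = \<zero>\<^bsub>koszul_module M 0 q\<^esub>" for q f
    by (auto simp: koszul_d_def koszul_coeff_def koszul_sel intro!: restrict_ext)
  have sB: "K.subm (koszul_boundaries R M [] 0)" using subm_koszul(1)[of "[]" 0] by simp
  have B: "koszul_boundaries R M [] 0 = {\<zero>\<^bsub>koszul_module M 0 0\<^esub>}"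
    using K.subm_zero[OF sB] by (auto simp: koszul_boundaries_eq d)
  have Z: "koszul_cycles R M [] 0 = carrier (koszul_module M 0 0)" by (simp add: koszul_cycles_0)
  have car: "(\<lambda>S \<in> koszul_index 0 0. m) \<in> carrier (koszul_module M 0 0)" if "m \<in> carrier M" for m
    using that by (simp add: koszul_sel)
  have img: "(\<lambda>m. \<lambda>S \<in> koszul_index 0 0. m) ` carrier M = carrier (koszul_module M 0 0)"
  proof
    show "carrier (koszul_module M 0 0) \<subseteq> (\<lambda>m. \<lambda>S \<in> koszul_index 0 0. m) ` carrier M"
    proof
      fix f assume f: "f \<in> carrier (koszul_module M 0 0)"
      have "f {} \<in> carrier M" using koszul_mem[OF f] by (simp add: koszul_index_0)
      moreover have "f = (\<lambda>S \<in> koszul_index 0 0. f {})"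
        by (rule koszul_eqI[OF f car]) (use calculation in \<open>simp_all add: koszul_index_0\<close>)
      ultimately show "f \<in> (\<lambda>m. \<lambda>S \<in> koszul_index 0 0. m) ` carrier M" by blast
    qed
  qed (use car in blast)
  show ?thesis
  proof (rule sq_isoI[OF module_axioms K.module_axioms carrier_is_submodule subm_zero_set])
    show "K.subm (koszul_cycles R M [] 0)" unfolding Z by (rule K.carrier_is_submodule)
    show "K.subm (koszul_boundaries R M [] 0)" by (rule sB)
    show "koszul_cycles R M [] 0 = (\<lambda>m. \<lambda>S \<in> koszul_index 0 0. m) ` carrier M <+>\<^bsub>koszul_module M 0 0\<^esub> koszul_boundaries R M [] 0"
      unfolding img Z B using K.set_add_absorb2[OF K.carrier_is_submodule K.subm_zero_set] by simp
    show "koszul_boundaries R M [] 0 \<subseteq> koszul_cycles R M [] 0" unfolding B Z by simp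
    have "(\<lambda>S \<in> koszul_index 0 0. m) = \<zero>\<^bsub>koszul_module M 0 0\<^esub> \<longleftrightarrow> m = \<zero>\<^bsub>M\<^esub>" for m
      by (auto simp: koszul_sel koszul_index_0 dest: fun_cong[where x = "{}"])
    then show "{\<zero>\<^bsub>M\<^esub>} = {m \<in> carrier M. (\<lambda>S \<in> koszul_index 0 0. m) \<in> koszul_boundaries R M [] 0}"
      unfolding B by auto
  qed (auto simp: koszul_sel intro!: restrict_ext)
qed

end

context lmod
begin

lemma good_trivial:
  assumes "subm A" "set xs \<subseteq> carrier R"
  shows "good R \<mm> M xs A A"
proof -
  have "noeth R M A A"
  proof (rule noethI)
    fix N :: "nat \<Rightarrow> _" assume "\<And>i. A \<subseteq> N i" "\<And>i. N i \<subseteq> A"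
    then have "N i = A" for i by (simp add: subset_antisym)
    then show "\<exists>k. \<forall>i\<ge>k. N i = N k" by simp
  qed
  moreover have "a [^] (0::nat) \<in> par R M xs A A" if "a \<in> \<mm>" for a
    using par_upper(2)[OF assms(2,1,1)] subm_carrier[OF assms(1)] by (auto simp: ann_sq_def)
  ultimately show ?thesis unfolding good_def using assms by blast
qed

text \<open>Both the cokernel and the kernel of \<open>x\<close> are killed by \<open>x\<close>,
  which may therefore be dropped from the parameters; the recursion of \<open>emult\<close> never
  leaves the good subquotients.\<close>

lemma good_scale_colon:
  assumes g: "good R \<mm> M (x # xs) A B"
  shows "good R \<mm> M xs A (B <+>\<^bsub>M\<^esub> scale M x A)" "good R \<mm> M xs (colon M x A B) B"
proof -
  note D = goodD[OF g]
  have x: "x \<in> carrier R" using D(4) by auto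
  have s: "subm (scale M x A)" "subm (B <+>\<^bsub>M\<^esub> scale M x A)" "subm (colon M x A B)"
    using D x by (auto intro!: subm_intros)
  show "good R \<mm> M xs A (B <+>\<^bsub>M\<^esub> scale M x A)"
    by (rule good_kill[OF g D(1) s(2) set_add_upper1[OF D(2) s(1)] set_add_least[OF D(1,3) scale_subset[OF x D(1)]]
      order.refl set_add_upper2[OF D(2) s(1)]])
  show "good R \<mm> M xs (colon M x A B) B"
    by (rule good_kill[OF g s(3) D(2) order.refl subset_colon[OF x D(2,3)] colon_subset]) (simp add: scale_colon)
qed

text \<open>The alternating sum of the \<open>e(zs; H\<^sub>p(xs; M))\<close> does not change when the first element of \<open>zs\<close> is
  appended to \<open>xs\<close>. It is \<open>e(zs; M)\<close> for empty \<open>xs\<close> and Serre's multiplicity for empty \<open>zs\<close>.\<close>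

lemma koszul_emult:
  assumes "good R \<mm> M (xs @ zs) (carrier M) {\<zero>\<^bsub>M\<^esub>}"
  shows "(\<forall>p. good R \<mm> (koszul_module M (length xs) p) zs (koszul_cycles R M xs p) (koszul_boundaries R M xs p)) \<and>
    (\<Sum>p\<le>length xs. (- 1) ^ p *
      emult R (koszul_module M (length xs) p) zs (koszul_cycles R M xs p) (koszul_boundaries R M xs p)) =
    emult R M (xs @ zs) (carrier M) {\<zero>\<^bsub>M\<^esub>}"
  using assms
proof (induction xs arbitrary: zs rule: rev_induct)
  case Nil
  have zs: "set zs \<subseteq> carrier R" using goodD(4)[OF Nil] by simp
  have "good R \<mm> (koszul_module M 0 p) zs (koszul_cycles R M [] p) (koszul_boundaries R M [] p)" for p
  proof (cases p)
    case 0
    then show ?thesis using Nil sq_iso_good[OF sq_iso_koszul_Nil] by simp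
  next
    case (Suc q)
    interpret K: lmod R \<mm> "koszul_module M 0 p" by (intro lmod.intro noetherian_local_ring_axioms koszul_is_module)
    have "koszul_cycles R M [] p = {\<zero>\<^bsub>koszul_module M 0 p\<^esub>}" "koszul_boundaries R M [] p = {\<zero>\<^bsub>koszul_module M 0 p\<^esub>}"
      using koszul_module_gt[of 0 p] subm_koszul[of "[]" p] Suc by auto
    then show ?thesis using K.good_trivial[OF K.subm_zero_set zs] by simp
  qed
  then show ?case using sq_iso_emult[OF sq_iso_koszul_Nil zs] by simp
next
  case (snoc x ys)
  have g: "good R \<mm> M (ys @ x # zs) (carrier M) {\<zero>\<^bsub>M\<^esub>}" using snoc.prems by simp
  have ys: "set ys \<subseteq> carrier R" and x: "x \<in> carrier R" and zs: "set zs \<subseteq> carrier R" using goodD(4)[OF g] by auto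
  define n where "n = length ys"
  note IH = snoc.IH[OF g, folded n_def]
  define Z where "Z p = koszul_cycles R M ys p" for p
  define B where "B p = koszul_boundaries R M ys p" for p
  define Z' where "Z' p = koszul_cycles R M (ys @ [x]) p" for p
  define B' where "B' p = koszul_boundaries R M (ys @ [x]) p" for p
  define K where "K p = koszul_module M n p" for p
  define K' where "K' p = koszul_module M (Suc n) p" for p
  have K: "lmod R \<mm> (K p)" and K': "lmod R \<mm> (K' p)" for p
    unfolding K_def K'_def by (intro lmod.intro noetherian_local_ring_axioms koszul_is_module)+
  have gZ: "good R \<mm> (K p) (x # zs) (Z p) (B p)" for p using IH by (simp add: K_def Z_def B_def)
  define h where "h p = emult R (K p) zs (Z p) (B p <+>\<^bsub>K p\<^esub> scale (K p) x (Z p))" for p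
  define k where "k p = emult R (K p) zs (colon (K p) x (Z p) (B p)) (B p)" for p
  define e where "e p = emult R (K' p) zs (Z' p) (B' p)" for p
  have eq0: "K' 0 = K 0" "Z' 0 = Z 0" "B' 0 = B 0 <+>\<^bsub>K 0\<^esub> scale (K 0) x (Z 0)"
    using koszul_boundaries_snoc_0[OF ys x n_def] n_def
    by (simp_all add: K_def K'_def Z_def Z'_def B_def B'_def koszul_module_0 koszul_cycles_0)
  have good0: "good R \<mm> (K' 0) zs (Z' 0) (B' 0)"
    unfolding eq0 by (rule lmod.good_scale_colon(1)[OF K gZ])
  have e0: "e 0 = h 0" by (simp add: e_def h_def eq0)
  have step: "good R \<mm> (K' (Suc p)) zs (Z' (Suc p)) (B' (Suc p)) \<and> e (Suc p) = k p + h (Suc p)" for p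
  proof -
    interpret K': lmod R \<mm> "K' (Suc p)" by (rule K')
    let ?C = "koszul_mid ys x n p"
    note i1 = sq_iso_koszul_snd[OF ys x n_def, of p, folded K_def K'_def Z_def B_def Z'_def B'_def]
    note i2 = sq_iso_koszul_fst[OF ys x n_def, of p, folded K_def K'_def Z_def B_def Z'_def B'_def]
    have g1: "good R \<mm> (K' (Suc p)) zs (Z' (Suc p)) ?C"
      using sq_iso_good[OF i1] lmod.good_scale_colon(2)[OF K gZ] by blast
    have g2: "good R \<mm> (K' (Suc p)) zs ?C (B' (Suc p))"
      using sq_iso_good[OF i2] lmod.good_scale_colon(1)[OF K gZ] by blast
    have g3: "good R \<mm> (K' (Suc p)) zs (Z' (Suc p)) (B' (Suc p))"
      by (rule K'.good_ext[OF g1 g2 m_carrier])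
    have "e (Suc p) = emult R (K' (Suc p)) zs (Z' (Suc p)) ?C + emult R (K' (Suc p)) zs ?C (B' (Suc p))"
      unfolding e_def by (rule K'.emult_add[OF g3 goodD(1)[OF g2] goodD(3)[OF g2] goodD(3)[OF g1]])
    also have "\<dots> = k p + h (Suc p)"
      unfolding k_def h_def using sq_iso_emult[OF i1 zs] sq_iso_emult[OF i2 zs] by simp
    finally show ?thesis using g3 by blast
  qed
  have good: "good R \<mm> (K' p) zs (Z' p) (B' p)" for p using good0 step by (cases p) auto
  \<comment> \<open>The sum for \<open>ys\<close> ends at degree \<open>n\<close>. In degree
    \<open>n + 1\<close> its Koszul module is zero, so the leftover of
    \<open>alternating_sum\<close> disappears.\<close>
  have top: "h (Suc n) = 0"
  proof -
    interpret Kn: lmod R \<mm> "K (Suc n)" by (rule K)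
    note D = goodD[OF lmod.good_scale_colon(1)[OF K gZ[of "Suc n"]]]
    have "Z (Suc n) = B (Suc n) <+>\<^bsub>K (Suc n)\<^esub> scale (K (Suc n)) x (Z (Suc n))"
      using koszul_module_gt[of n "Suc n"] D(1,2) unfolding K_def by auto
    then show ?thesis unfolding h_def using Kn.emult_self[OF zs D(1)] by simp
  qed
  have "(\<Sum>p\<le>Suc n. (- 1) ^ p * e p) = (\<Sum>p\<le>n. (- 1) ^ p * (h p - k p)) + (- 1) ^ Suc n * h (Suc n)"
    by (rule alternating_sum) (use e0 step in auto)
  also have "\<dots> = (\<Sum>p\<le>n. (- 1) ^ p * emult R (K p) (x # zs) (Z p) (B p))"
    using top by (simp add: h_def k_def)
  also have "\<dots> = emult R M (ys @ x # zs) (carrier M) {\<zero>\<^bsub>M\<^esub>}"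
    using IH by (simp add: K_def Z_def B_def del: emult.simps)
  finally have "(\<Sum>p\<le>Suc n. (- 1) ^ p * e p) = emult R M (ys @ x # zs) (carrier M) {\<zero>\<^bsub>M\<^esub>}" .
  moreover have "length (ys @ [x]) = Suc n" by (simp add: n_def)
  ultimately show ?case using good unfolding e_def K'_def Z'_def B'_def by simp
qed

lemma serre_mult_eq:
  assumes g: "good R \<mm> M xs (carrier M) {\<zero>\<^bsub>M\<^esub>}"
  shows "serre_mult R M xs = emult R M xs (carrier M) {\<zero>\<^bsub>M\<^esub>}"
proof -
  have xs: "set xs \<subseteq> carrier R" using goodD(4)[OF g] .
  have "int_length R (koszul_homology R M xs p) =
      emult R (koszul_module M (length xs) p) [] (koszul_cycles R M xs p) (koszul_boundaries R M xs p)" for p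
    unfolding int_length_def koszul_homology_def
    using module.module_length_quotient[OF koszul_is_module subm_koszul(2,1)[OF xs, of p] koszul_complex[OF xs]] by simp
  then show ?thesis using koszul_emult[of xs "[]"] g by (simp add: serre_mult_def)
qed

text \<open>For a module of cosets such as \<open>F (Suc i) / F i\<close>, this brings Serre's
  multiplicity back to submodules of \<open>M\<close>.\<close>

lemma serre_mult_iso:
  assumes N: "module R N" and iso: "sq_iso R M N f A B (carrier N) {\<zero>\<^bsub>N\<^esub>}" and g: "good R \<mm> M xs A B"
  shows "serre_mult R N xs = emult R M xs A B"
proof -
  interpret N: lmod R \<mm> N by (intro lmod.intro noetherian_local_ring_axioms N)
  show ?thesis using N.serre_mult_eq sq_iso_good[OF iso] sq_iso_emult[OF iso goodD(4)[OF g]] g by simp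
qed

lemma serre_mult_restrict:
  assumes A: "subm A" and g: "good R \<mm> M xs A {\<zero>\<^bsub>M\<^esub>}"
  shows "serre_mult R (M\<lparr>carrier := A\<rparr>) xs = emult R M xs A {\<zero>\<^bsub>M\<^esub>}"
proof -
  have m: "module R (M\<lparr>carrier := A\<rparr>)" by (rule submodule.submodule_is_module[OF A module_axioms])
  interpret A: lmod R \<mm> "M\<lparr>carrier := A\<rparr>" by (intro lmod.intro noetherian_local_ring_axioms m)
  have iso: "sq_iso R (M\<lparr>carrier := A\<rparr>) M (\<lambda>a. a) A {\<zero>\<^bsub>M\<^esub>} A {\<zero>\<^bsub>M\<^esub>}"
    by (rule sq_iso_restrict[OF A A subm_zero_set]) (use subm_zero[OF A] in auto)
  show ?thesis
    using A.serre_mult_eq[of xs] sq_iso_good[OF iso] g sq_iso_emult[OF iso goodD(4)[OF g]] by simp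
qed

end

section \<open>Quotients by a sequence of ring elements\<close>

lemma sq_iso_lin:
  assumes iso: "sq_iso R M N f A B A' B'" and xs: "set xs \<subseteq> carrier R"
  shows "sq_iso R M N f A (lin M xs A B) A' (lin N xs A' B')"
  using xs
proof (induction xs)
  case (Cons x xs)
  note D = sq_isoD[OF iso]
  interpret M: module R M by (rule D)
  interpret N: module R N by (rule D)
  have x: "x \<in> carrier R" "set xs \<subseteq> carrier R" using Cons.prems by auto
  show ?case
    using sq_iso_scale[OF Cons.IH[OF x(2)] x(1)]
      M.set_add_comm[OF M.subm_scale[OF x(1) D(3)] M.subm_lin[OF x(2) D(3,4)]]
      N.set_add_comm[OF N.subm_scale[OF x(1) D(6)] N.subm_lin[OF x(2) D(6,7)]] by simp
qed (use iso in simp)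

context module
begin

lemma seq_smult_eq_lin:
  assumes xs: "set xs \<subseteq> carrier R"
  shows "seq_smult R M xs = lin M xs (carrier M) {\<zero>\<^bsub>M\<^esub>}"
proof
  have L: "subm (lin M xs (carrier M) {\<zero>\<^bsub>M\<^esub>})" by (rule subm_lin[OF xs carrier_is_submodule subm_zero_set])
  have "{x \<odot>\<^bsub>M\<^esub> m | x m. x \<in> set xs \<and> m \<in> carrier M} \<subseteq> lin M xs (carrier M) {\<zero>\<^bsub>M\<^esub>}"
    using lin_upper[OF xs carrier_is_submodule subm_zero_set] by (auto simp: scale_def)
  with L show "seq_smult R M xs \<subseteq> lin M xs (carrier M) {\<zero>\<^bsub>M\<^esub>}"
    unfolding seq_smult_def gen_submodule_def by blast
  have "lin M xs (carrier M) {\<zero>\<^bsub>M\<^esub>} \<subseteq> N"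
    if N: "subm N" "{x \<odot>\<^bsub>M\<^esub> m | x m. x \<in> set xs \<and> m \<in> carrier M} \<subseteq> N" for N
    using N subm_zero[OF N(1)] by (intro lin_least) (auto simp: scale_def)
  then show "lin M xs (carrier M) {\<zero>\<^bsub>M\<^esub>} \<subseteq> seq_smult R M xs"
    unfolding seq_smult_def gen_submodule_def by blast
qed

lemma module_length_seq_smult:
  assumes N: "module R N" and iso: "sq_iso R M N f A B (carrier N) {\<zero>\<^bsub>N\<^esub>}" and xs: "set xs \<subseteq> carrier R"
  shows "module_length R (quotient_module N (seq_smult R N xs)) = len R M A (lin M xs A B)"
proof -
  interpret N: module R N by (rule N)
  show ?thesis
    using N.module_length_quotient_carrier[OF N.subm_lin[OF xs N.carrier_is_submodule N.subm_zero_set]]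
      sq_iso_len[OF sq_iso_lin[OF iso xs]] N.seq_smult_eq_lin[OF xs] by simp
qed

lemma module_length_seq_smult_carrier:
  assumes xs: "set xs \<subseteq> carrier R"
  shows "module_length R (quotient_module M (seq_smult R M xs)) = len R M (carrier M) (lin M xs (carrier M) {\<zero>\<^bsub>M\<^esub>})"
  using module_length_quotient_carrier[OF subm_lin[OF xs carrier_is_submodule subm_zero_set]] seq_smult_eq_lin[OF xs] by simp

end

section \<open>Dimension\<close>

definition prime_chain :: "('a, 'r) ring_scheme \<Rightarrow> 'a set \<Rightarrow> nat \<Rightarrow> bool" where
  "prime_chain R I n \<longleftrightarrow>
     (\<exists>P. (\<forall>i\<le>n. primeideal (P i) R \<and> I \<subseteq> P i) \<and> (\<forall>i<n. P i \<subset> P (Suc i)))"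

lemma module_dim_eq_Sup:
  "module_dim R M = Sup (insert (- 1) {ereal (real n) | n. prime_chain R (annihilator R M) n})"
  unfolding module_dim_def prime_chain_def by simp

lemma prime_chain_antimono: "prime_chain R I n \<Longrightarrow> J \<subseteq> I \<Longrightarrow> prime_chain R J n"
  unfolding prime_chain_def by (meson order.trans)

lemma prime_chain_le_dim: "prime_chain R (annihilator R M) n \<Longrightarrow> ereal (real n) \<le> module_dim R M"
  unfolding module_dim_eq_Sup by (intro Sup_upper) auto

lemma module_dim_mono: "annihilator R M \<subseteq> annihilator R N \<Longrightarrow> module_dim R N \<le> module_dim R M"
  unfolding module_dim_eq_Sup using prime_chain_antimono by (intro Sup_subset_mono) blast

text \<open>A finite bound leaves only finitely many lengths of prime chains, so either there is no
  prime at all or the supremum is attained. The attaining chain is the witness that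
  \<open>module_dim_quotient\<close> works with.\<close>

lemma module_dim_cases:
  assumes "module_dim R M \<le> ereal (real d)"
  obtains (neg) "module_dim R M = - 1" "nat_dim R M = 0"
  | (nat) "module_dim R M = ereal (real (nat_dim R M))" "prime_chain R (annihilator R M) (nat_dim R M)"
proof (cases "{n. prime_chain R (annihilator R M) n} = {}")
  case True
  then have "module_dim R M = - 1" unfolding module_dim_eq_Sup by simp
  moreover from this have "nat_dim R M = 0" by (simp add: nat_dim_def)
  ultimately show ?thesis by (rule neg)
next
  case False
  let ?S = "{n. prime_chain R (annihilator R M) n}"
  have bd: "n \<le> d" if "n \<in> ?S" for n
    using order.trans[OF prime_chain_le_dim assms, of n] that by simp
  then have fin: "finite ?S" by (meson finite_nat_set_iff_bounded_le)
  have max: "prime_chain R (annihilator R M) (Max ?S)" using Max_in[OF fin False] by simp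
  have eq: "module_dim R M = ereal (real (Max ?S))"
  proof (rule antisym)
    show "module_dim R M \<le> ereal (real (Max ?S))"
      unfolding module_dim_eq_Sup
    proof (rule Sup_least)
      fix y assume "y \<in> insert (- 1) {ereal (real n) | n. prime_chain R (annihilator R M) n}"
      then show "y \<le> ereal (real (Max ?S))"
      proof
        assume "y = - 1"
        then show ?thesis by (simp add: one_ereal_def)
      qed (use Max_ge[OF fin] in auto)
    qed
    show "ereal (real (Max ?S)) \<le> module_dim R M" by (rule prime_chain_le_dim[OF max])
  qed
  then have "nat_dim R M = Max ?S" by (simp add: nat_dim_def)
  then show ?thesis using eq max by (intro nat) auto
qed

lemma (in module) annihilator_eq: "annihilator R M = ann_sq R M (carrier M) {\<zero>\<^bsub>M\<^esub>}"
  by (simp add: annihilator_def ann_sq_def)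

lemma (in module) annihilator_restrict: "annihilator R (M\<lparr>carrier := A\<rparr>) = ann_sq R M A {\<zero>\<^bsub>M\<^esub>}"
  by (simp add: annihilator_def ann_sq_def)

lemma (in module) annihilator_restrict_quotient:
  assumes "subm A" "subm B" "B \<subseteq> A"
  shows "annihilator R (quotient_module (M\<lparr>carrier := A\<rparr>) B) = ann_sq R M A B"
  using sq_iso_ann[OF restrict_quotient(2)[OF assms]] module.annihilator_eq[OF restrict_quotient(1)[OF assms]] by simp

text \<open>A chain of primes that witnesses \<open>dim A\<close> starts above \<open>Ann A\<close>, which contains the product of
  \<open>Ann (A / B)\<close> and \<open>Ann B\<close>.\<close>

lemma (in module) module_dim_quotient:
  assumes s: "subm A" "subm B" "B \<subseteq> A"
    and dA: "module_dim R (M\<lparr>carrier := A\<rparr>) = ereal (real n)" "prime_chain R (annihilator R (M\<lparr>carrier := A\<rparr>)) n"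
    and less: "module_dim R (M\<lparr>carrier := B\<rparr>) < module_dim R (M\<lparr>carrier := A\<rparr>)"
  shows "module_dim R (quotient_module (M\<lparr>carrier := A\<rparr>) B) = ereal (real n)"
proof (rule antisym)
  have "ann_sq R M A {\<zero>\<^bsub>M\<^esub>} \<subseteq> ann_sq R M A B" using subm_zero[OF s(2)] by (auto simp: ann_sq_def)
  then show "module_dim R (quotient_module (M\<lparr>carrier := A\<rparr>) B) \<le> ereal (real n)"
    unfolding dA(1)[symmetric] by (intro module_dim_mono) (simp add: annihilator_restrict annihilator_restrict_quotient[OF s])
  from dA(2) obtain P where P: "\<forall>i\<le>n. primeideal (P i) R \<and> ann_sq R M A {\<zero>\<^bsub>M\<^esub>} \<subseteq> P i" "\<forall>i<n. P i \<subset> P (Suc i)"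
    unfolding prime_chain_def annihilator_restrict by blast
  have mono: "P 0 \<subseteq> P i" if "i \<le> n" for i
    using that
  proof (induction i)
    case (Suc i)
    then show ?case using P(2) by (metis Suc_leD Suc_le_lessD order.trans psubset_imp_subset)
  qed simp
  have "ann_sq R M A B \<subseteq> P 0"
  proof (rule ccontr)
    assume "\<not> ann_sq R M A B \<subseteq> P 0"
    then obtain r where r: "r \<in> ann_sq R M A B" "r \<notin> P 0" by blast
    have "ann_sq R M B {\<zero>\<^bsub>M\<^esub>} \<subseteq> P 0"
    proof
      fix u assume u: "u \<in> ann_sq R M B {\<zero>\<^bsub>M\<^esub>}"
      have "u \<otimes> r \<in> ann_sq R M A {\<zero>\<^bsub>M\<^esub>}"
        using u r(1) subm_carrier[OF s(1)] by (auto simp: ann_sq_def smult_assoc1)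
      then have "u \<otimes> r \<in> P 0" using P(1) by blast
      then show "u \<in> P 0" using primeideal.I_prime[of "P 0" R u r] P(1) u r by (auto simp: ann_sq_def)
    qed
    then have "prime_chain R (ann_sq R M B {\<zero>\<^bsub>M\<^esub>}) n"
      unfolding prime_chain_def using P mono by (meson order.trans)
    then have "ereal (real n) \<le> module_dim R (M\<lparr>carrier := B\<rparr>)"
      by (intro prime_chain_le_dim) (simp add: annihilator_restrict)
    then show False using less dA(1) by simp
  qed
  then have "prime_chain R (ann_sq R M A B) n"
    unfolding prime_chain_def using P mono by (meson order.trans)
  then show "ereal (real n) \<le> module_dim R (quotient_module (M\<lparr>carrier := A\<rparr>) B)"
    by (intro prime_chain_le_dim) (simp add: annihilator_restrict_quotient[OF s])
qed

section \<open>The invariant of a filtration\<close>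

locale gcm_filtered = lmod R \<mm> M for R (structure) and \<mm> and M (structure) +
  fixes t :: nat and F :: "nat \<Rightarrow> 'c set" and xs :: "'a list"
  assumes fin_gen: "fin_gen_module R M"
    and gcm: "gcm_filtration R \<mm> M t F"
    and good_sop: "good_system_of_parameters R \<mm> M t F xs"
begin

text \<open>If \<open>F 0\<close> is zero, its dimension \<open>-1\<close> becomes \<open>0\<close>
  here. So \<open>take (fdim 0)\<close> is always empty, and the summand for \<open>i = 0\<close> is
  the length of \<open>F 0\<close>.\<close>

definition fdim :: "nat \<Rightarrow> nat" where
  "fdim i = nat_dim R (M\<lparr>carrier := F i\<rparr>)"

lemma F_sub: "i \<le> t \<Longrightarrow> subm (F i)" "i < t \<Longrightarrow> F i \<subseteq> F (Suc i)" "F t = carrier M"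
  using gcm unfolding gcm_filtration_def filtration_def by auto

lemma sop: "set xs \<subseteq> \<mm>" "ereal (real (length xs)) = module_dim R M"
  "module_length R (quotient_module M (seq_smult R M xs)) < \<infinity>"
  using good_sop unfolding good_system_of_parameters_def system_of_parameters_def by auto

lemma dim_F_le: "i \<le> t \<Longrightarrow> module_dim R (M\<lparr>carrier := F i\<rparr>) \<le> ereal (real (length xs))"
  unfolding sop(2) using subm_sub[OF F_sub(1)]
  by (intro module_dim_mono) (auto simp: annihilator_restrict annihilator_eq ann_sq_def)

lemma dim_F_pos: "1 \<le> i \<Longrightarrow> i \<le> t \<Longrightarrow> 0 < module_dim R (M\<lparr>carrier := F i\<rparr>)"
proof (induction i rule: dec_induct)
  case base
  then show ?case using gcm unfolding gcm_filtration_def by simp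
next
  case (step i)
  then show ?case using gcm unfolding gcm_filtration_def dimension_condition_def
    by (metis Suc_leD Suc_le_lessD order.strict_trans)
qed

lemma dim_F_eq:
  assumes "1 \<le> i" "i \<le> t"
  shows "module_dim R (M\<lparr>carrier := F i\<rparr>) = ereal (real (fdim i))"
    "prime_chain R (annihilator R (M\<lparr>carrier := F i\<rparr>)) (fdim i)" "0 < fdim i"
proof -
  from dim_F_le[OF assms(2)]
  have *: "module_dim R (M\<lparr>carrier := F i\<rparr>) = ereal (real (fdim i)) \<and>
    prime_chain R (annihilator R (M\<lparr>carrier := F i\<rparr>)) (fdim i)"
  proof (cases rule: module_dim_cases)
    case neg
    then show ?thesis using dim_F_pos[OF assms] by simp
  next
    case nat
    then show ?thesis by (simp add: fdim_def)
  qed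
  then show "module_dim R (M\<lparr>carrier := F i\<rparr>) = ereal (real (fdim i))"
    "prime_chain R (annihilator R (M\<lparr>carrier := F i\<rparr>)) (fdim i)" by auto
  then show "0 < fdim i" using dim_F_pos[OF assms] by simp
qed

lemma fdim_0: "fdim 0 = 0"
proof -
  have 0: "module_dim R (M\<lparr>carrier := F 0\<rparr>) \<le> 0" using gcm unfolding gcm_filtration_def by simp
  then have "module_dim R (M\<lparr>carrier := F 0\<rparr>) \<le> ereal (real 0)" by (simp add: zero_ereal_def)
  then show ?thesis
  proof (cases rule: module_dim_cases)
    case nat
    then have "ereal (real (fdim 0)) \<le> 0" using 0 by (simp add: fdim_def)
    then show ?thesis by simp
  qed (simp add: fdim_def)
qed

text \<open>At the bottom the strict inequality of dimensions could be \<open>-1 < 0\<close>, which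
  natural numbers do not see. There the convention \<open>dim M_1 > 0\<close> gives the
  claim.\<close>

lemma fdim_Suc: "i < t \<Longrightarrow> fdim i < fdim (Suc i)"
proof (cases "i = 0")
  case False
  assume i: "i < t"
  then have "module_dim R (M\<lparr>carrier := F i\<rparr>) < module_dim R (M\<lparr>carrier := F (Suc i)\<rparr>)"
    using gcm unfolding gcm_filtration_def dimension_condition_def by simp
  then show ?thesis using dim_F_eq(1)[of i] dim_F_eq(1)[of "Suc i"] False i by simp
qed (use fdim_0 dim_F_eq(3)[of "Suc i"] in simp)

lemma fdim_less: "i < k \<Longrightarrow> k \<le> t \<Longrightarrow> fdim i < fdim k"
proof (induction k)
  case (Suc k)
  then show ?case using fdim_Suc[of k] by (cases "i = k") auto
qed simp

lemma fdim_t: "fdim t = length xs"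
proof -
  have "module_dim R (M\<lparr>carrier := F t\<rparr>) = module_dim R M"
    unfolding module_dim_def annihilator_restrict annihilator_eq F_sub(3) ..
  then show ?thesis unfolding fdim_def nat_dim_def by (simp add: sop(2)[symmetric])
qed

lemma fdim_le: "i \<le> t \<Longrightarrow> fdim i \<le> length xs"
  using fdim_less[of i t] fdim_t by (cases "i = t") auto

text \<open>Goodness in the form that is used for \<open>xs\<close> and for all its powers: the
  finite length of the quotient is expressed through \<open>good\<close>, and the dimension of
  \<open>M\<close> through the length of the list.\<close>

definition gsop :: "'a list \<Rightarrow> bool" where
  "gsop ys \<longleftrightarrow> set ys \<subseteq> \<mm> \<and> length ys = length xs \<and> good R \<mm> M ys (carrier M) {\<zero>\<^bsub>M\<^esub>} \<and>
     (\<forall>i<t. F i \<inter> lin M (drop (fdim i) ys) (carrier M) {\<zero>\<^bsub>M\<^esub>} = {\<zero>\<^bsub>M\<^esub>})"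

lemma gsop_xs: "gsop xs"
proof -
  have xs: "set xs \<subseteq> carrier R" using sop(1) m_carrier by blast
  obtain gs where gs: "set gs \<subseteq> carrier M" "carrier M = span_over R M gs {\<zero>\<^bsub>M\<^esub>}"
    by (rule fin_gen_span[OF fin_gen])
  have "len R M (carrier M) (lin M xs (carrier M) {\<zero>\<^bsub>M\<^esub>}) \<noteq> \<infinity>"
    using sop(3) module_length_seq_smult_carrier[OF xs] by simp
  then have "good R \<mm> M xs (carrier M) {\<zero>\<^bsub>M\<^esub>}" by (rule good_if_finite_len[OF subm_zero_set gs xs])
  moreover have "F i \<inter> lin M (drop (fdim i) xs) (carrier M) {\<zero>\<^bsub>M\<^esub>} = {\<zero>\<^bsub>M\<^esub>}" if "i < t" for i
  proof -
    have "set (drop (fdim i) xs) \<subseteq> carrier R" using xs set_drop_subset[of "fdim i" xs] by blast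
    note eq = seq_smult_eq_lin[OF this]
    have "F i \<inter> seq_smult R M (drop (fdim i) xs) = {\<zero>\<^bsub>M\<^esub>}"
      using good_sop that unfolding good_system_of_parameters_def fdim_def[symmetric] by blast
    then show ?thesis unfolding eq .
  qed
  ultimately show ?thesis unfolding gsop_def using sop(1) by blast
qed

context
  fixes ys assumes ys: "gsop ys"
begin

lemma gsop_basic: "set ys \<subseteq> \<mm>" "length ys = length xs" "good R \<mm> M ys (carrier M) {\<zero>\<^bsub>M\<^esub>}"
    "set ys \<subseteq> carrier R" "set (take k ys) \<subseteq> carrier R" "set (drop k ys) \<subseteq> carrier R"
  using ys m_carrier set_take_subset[of k ys] set_drop_subset[of k ys] unfolding gsop_def by auto

text \<open>\<open>y F_i\<close> lies in \<open>F_i\<close> and in the submodule that meets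
  \<open>F_i\<close> only in zero.\<close>

lemma gsop_kill: "i < t \<Longrightarrow> y \<in> set (drop (fdim i) ys) \<Longrightarrow> scale M y (F i) \<subseteq> {\<zero>\<^bsub>M\<^esub>}"
proof -
  assume i: "i < t" and y: "y \<in> set (drop (fdim i) ys)"
  have s: "subm (F i)" using F_sub i by simp
  have yc: "y \<in> carrier R" using y gsop_basic(6) by blast
  have "scale M y (F i) \<subseteq> F i" by (rule scale_subset[OF yc s])
  moreover have "scale M y (F i) \<subseteq> lin M (drop (fdim i) ys) (carrier M) {\<zero>\<^bsub>M\<^esub>}"
    using lin_upper[OF gsop_basic(6) carrier_is_submodule subm_zero_set] y scale_mono[OF subm_sub[OF s], of M y] by blast
  ultimately show ?thesis using ys i unfolding gsop_def by blast
qed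

text \<open>The parameters beyond the first \<open>fdim i\<close> kill \<open>F i\<close>, so the
  first ones suffice. For \<open>i = t\<close>, where no intersection condition is imposed, no
  parameter lies beyond.\<close>

lemma gsop_good_F: "i \<le> t \<Longrightarrow> good R \<mm> M (take (fdim i) ys) (F i) {\<zero>\<^bsub>M\<^esub>}"
proof (rule good_change[OF gsop_basic(3)])
  assume i: "i \<le> t"
  show "subm (F i)" "subm {\<zero>\<^bsub>M\<^esub>}" "{\<zero>\<^bsub>M\<^esub>} \<subseteq> F i" "F i \<subseteq> carrier M"
    using F_sub(1)[OF i] subm_zero_set subm_zero subm_sub by auto
  fix y assume "y \<in> set ys"
  then have "y \<in> set (take (fdim i) ys) \<or> y \<in> set (drop (fdim i) ys)"
    by (metis UnE append_take_drop_id set_append)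
  moreover have "drop (fdim i) ys = []" if "i = t" using that fdim_t gsop_basic(2) by simp
  moreover have "set (take (fdim i) ys) \<subseteq> Idl (set (take (fdim i) ys))" by (rule genideal_self[OF gsop_basic(5)])
  ultimately show "y \<in> Idl (set (take (fdim i) ys)) \<or> scale M y (F i) \<subseteq> {\<zero>\<^bsub>M\<^esub>}"
    using gsop_kill[of i y] i by (cases "i = t") (auto simp del: subset_singleton_iff)
qed (use gsop_basic(5) in auto)

lemma good_Nil_lin:
  assumes g: "good R \<mm> M zs A B"
  shows "good R \<mm> M [] A (lin M zs A B)"
proof (rule good_change[OF g goodD(1)[OF g]])
  note D = goodD[OF g]
  show "subm (lin M zs A B)" by (rule subm_lin[OF D(4,1,2)])
  show "B \<subseteq> lin M zs A B" using lin_upper[OF D(4,1,2)] by blast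
  show "lin M zs A B \<subseteq> A" by (rule lin_subset[OF D(4,1,3)])
  show "x \<in> Idl (set []) \<or> scale M x A \<subseteq> lin M zs A B" if "x \<in> set zs" for x
    using lin_upper[OF D(4,1,2)] that by blast
qed auto

lemma filtration_invariant_eq:
  "filtration_invariant R M t F ys = emult R M [] (carrier M) (lin M ys (carrier M) {\<zero>\<^bsub>M\<^esub>}) -
     (\<Sum>i\<le>t. emult R M (take (fdim i) ys) (F i) {\<zero>\<^bsub>M\<^esub>})"
proof -
  have "serre_mult R (M\<lparr>carrier := F i\<rparr>) (take (fdim i) ys) = emult R M (take (fdim i) ys) (F i) {\<zero>\<^bsub>M\<^esub>}" if "i \<le> t" for i
    by (rule serre_mult_restrict[OF F_sub(1)[OF that] gsop_good_F[OF that]])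
  then show ?thesis
    unfolding filtration_invariant_def int_length_def fdim_def[symmetric] module_length_seq_smult_carrier[OF gsop_basic(4)]
    by simp
qed

end

lemma emult_Nil_mono:
  assumes g: "good R \<mm> M [] A B" and s: "subm C" "subm D" "B \<subseteq> D" "D \<subseteq> C" "C \<subseteq> A"
  shows "emult R M [] C D \<le> emult R M [] A B"
proof -
  have g1: "good R \<mm> M [] A D" using good_sub[OF g goodD(1)[OF g] s(2,3) _ order.refl] s by auto
  have "emult R M [] A B = emult R M [] A D + emult R M [] D B"
    by (rule emult_add[OF g s(2,3)]) (use s in auto)
  moreover have "emult R M [] A D = emult R M [] A C + emult R M [] C D" by (rule emult_add[OF g1 s(1,4,5)])
  moreover have "0 \<le> emult R M [] E G" for E G by simp
  ultimately show ?thesis by (metis add_increasing add_increasing2 order.refl)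
qed

text \<open>The truncated sequence is a system of parameters of the generalized Cohen-Macaulay
  module \<open>F (Suc i) / F i\<close>, so length minus multiplicity is bounded there. The
  multiplicity is then rewritten for \<open>F (Suc i)\<close>, as \<open>F i\<close> contributes
  nothing to it.\<close>

lemma gcm_bound:
  assumes i: "i < t"
  shows "\<exists>c::int. \<forall>ys. gsop ys \<longrightarrow>
    emult R M [] (F (Suc i)) (lin M (take (fdim (Suc i)) ys) (F (Suc i)) (F i)) \<le>
    c + emult R M (take (fdim (Suc i)) ys) (F (Suc i)) {\<zero>\<^bsub>M\<^esub>}"
proof -
  have s: "subm (F (Suc i))" "subm (F i)" "F i \<subseteq> F (Suc i)" using F_sub i by auto
  let ?Q = "quotient_module (M\<lparr>carrier := F (Suc i)\<rparr>) (F i)"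
  note Q = restrict_quotient[OF s]
  have "generalized_CM R \<mm> ?Q" using gcm i unfolding gcm_filtration_def by simp
  then have "gcm_invariant R \<mm> ?Q \<noteq> \<infinity>" unfolding generalized_CM_def by simp
  \<comment> \<open>The invariant is a supremum over all systems of parameters, so this bound does
    not depend on \<open>ys\<close>.\<close>
  then obtain c :: nat where c: "gcm_invariant R \<mm> ?Q < ereal (real c)"
    using less_PInf_Ex_of_nat by blast
  have "emult R M [] (F (Suc i)) (lin M (take (fdim (Suc i)) ys) (F (Suc i)) (F i)) \<le>
    int c + emult R M (take (fdim (Suc i)) ys) (F (Suc i)) {\<zero>\<^bsub>M\<^esub>}" if ys: "gsop ys" for ys
  proof -
    let ?z = "take (fdim (Suc i)) ys"
    note g0 = gsop_good_F[OF ys, of "Suc i"]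
    have g: "good R \<mm> M ?z (F (Suc i)) (F i)"
      using good_sub[OF g0 s(1,2) _ s(3) order.refl] i subm_zero[OF s(2)] by auto
    note z = goodD(4)[OF g]
    have len: "module_length R (quotient_module ?Q (seq_smult R ?Q ?z)) = len R M (F (Suc i)) (lin M ?z (F (Suc i)) (F i))"
      by (rule module_length_seq_smult[OF Q z])
    have "system_of_parameters R \<mm> ?Q ?z"
      unfolding system_of_parameters_def len
    proof (intro conjI)
      show "set ?z \<subseteq> \<mm>" using gsop_basic(1)[OF ys] set_take_subset by fast
      have "module_dim R ?Q = ereal (real (fdim (Suc i)))"
      proof (rule module_dim_quotient[OF s dim_F_eq(1,2)])
        show "module_dim R (M\<lparr>carrier := F i\<rparr>) < module_dim R (M\<lparr>carrier := F (Suc i)\<rparr>)"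
          using gcm i unfolding gcm_filtration_def dimension_condition_def by simp
      qed (use i in auto)
      moreover have "length ?z = fdim (Suc i)" using gsop_basic(2)[OF ys] fdim_le[of "Suc i"] i by simp
      ultimately show "ereal (real (length ?z)) = module_dim R ?Q" by simp
      show "len R M (F (Suc i)) (lin M ?z (F (Suc i)) (F i)) < \<infinity>"
        using good_Nil_finite[OF good_Nil_lin[OF ys g]] by simp
    qed
    then have "ereal (of_int (int_length R (quotient_module ?Q (seq_smult R ?Q ?z)) - serre_mult R ?Q ?z)) \<le> gcm_invariant R \<mm> ?Q"
      unfolding gcm_invariant_def by (intro SUP_upper) simp
    then have "ereal (of_int (int_length R (quotient_module ?Q (seq_smult R ?Q ?z)) - serre_mult R ?Q ?z)) < ereal (real c)"
      using c by (rule order.strict_trans1)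
    then have "int_length R (quotient_module ?Q (seq_smult R ?Q ?z)) - serre_mult R ?Q ?z \<le> int c"
      unfolding less_ereal.simps by linarith
    then have "emult R M [] (F (Suc i)) (lin M ?z (F (Suc i)) (F i)) \<le> int c + emult R M ?z (F (Suc i)) (F i)"
      unfolding serre_mult_iso[OF Q g] int_length_def len by simp
    moreover have "emult R M ?z (F (Suc i)) {\<zero>\<^bsub>M\<^esub>} = emult R M ?z (F (Suc i)) (F i) + emult R M ?z (F i) {\<zero>\<^bsub>M\<^esub>}"
      by (rule emult_add) (use g0 i s subm_zero in auto)
    moreover have "emult R M ?z (F i) {\<zero>\<^bsub>M\<^esub>} = 0"
    proof (rule emult_kill)
      \<comment> \<open>The entry with index \<open>fdim i\<close> is the first one beyond the
        parameters of \<open>F i\<close>, hence kills \<open>F i\<close>; by strict growth of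
        \<open>fdim\<close> it is still among the parameters of \<open>F (Suc i)\<close>.\<close>
      have lt: "fdim i < fdim (Suc i)" "fdim (Suc i) \<le> length ys" 
        using fdim_Suc[OF i] fdim_le[of "Suc i"] i gsop_basic(2)[OF ys] by auto
      have "?z ! fdim i \<in> set ?z" using lt by (intro nth_mem) simp
      then show "ys ! fdim i \<in> set ?z" using lt by simp
      have "drop (fdim i) ys ! 0 \<in> set (drop (fdim i) ys)" using lt by (intro nth_mem) simp
      then have "ys ! fdim i \<in> set (drop (fdim i) ys)" using lt by simp
      then show "scale M (ys ! fdim i) (F i) \<subseteq> {\<zero>\<^bsub>M\<^esub>}" by (rule gsop_kill[OF ys i])
    qed (use z s subm_zero_set subm_zero in auto)
    ultimately show ?thesis by simp
  qed
  then show ?thesis by blast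
qed

lemma invariant_bounded: "\<exists>C. \<forall>ys. gsop ys \<longrightarrow> filtration_invariant R M t F ys \<le> C"
proof -
  have "\<exists>c::nat \<Rightarrow> int. \<forall>i<t. \<forall>ys. gsop ys \<longrightarrow>
    emult R M [] (F (Suc i)) (lin M (take (fdim (Suc i)) ys) (F (Suc i)) (F i)) \<le>
    c i + emult R M (take (fdim (Suc i)) ys) (F (Suc i)) {\<zero>\<^bsub>M\<^esub>}"
    using gcm_bound by metis
  then obtain c :: "nat \<Rightarrow> int" where c: "\<And>i ys. i < t \<Longrightarrow> gsop ys \<Longrightarrow>
    emult R M [] (F (Suc i)) (lin M (take (fdim (Suc i)) ys) (F (Suc i)) (F i)) \<le>
    c i + emult R M (take (fdim (Suc i)) ys) (F (Suc i)) {\<zero>\<^bsub>M\<^esub>}" by blast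
  have "filtration_invariant R M t F ys \<le> (\<Sum>i<t. c i)" if ys: "gsop ys" for ys
  proof -
    note b = gsop_basic[OF ys]
    let ?L = "lin M ys (carrier M) {\<zero>\<^bsub>M\<^esub>}"
    have L: "subm ?L" by (rule subm_lin[OF b(4) carrier_is_submodule subm_zero_set])
    have gL: "good R \<mm> M [] (carrier M) ?L" by (rule good_Nil_lin[OF ys b(3)])
    let ?e = "\<lambda>i. emult R M (take (fdim i) ys) (F i) {\<zero>\<^bsub>M\<^esub>}"
    \<comment> \<open>The images of the \<open>F j\<close> filter \<open>M / ?L\<close>, and the
      length is bounded factor by factor along this filtration.\<close>
    have "emult R M [] (F j <+>\<^bsub>M\<^esub> ?L) ?L \<le> (\<Sum>i<j. c i) + (\<Sum>i\<le>j. ?e i)" if "j \<le> t" for j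
      using that
    proof (induction j)
      case 0
      have s: "subm (F 0)" using F_sub by simp
      have "emult R M [] (F 0 <+>\<^bsub>M\<^esub> ?L) ?L = emult R M [] (F 0) (F 0 \<inter> ?L)" by (rule emult_id[OF s L]) simp
      also have "\<dots> \<le> emult R M [] (F 0) {\<zero>\<^bsub>M\<^esub>}"
        using gsop_good_F[OF ys, of 0] fdim_0 s L subm_zero[OF s] subm_zero[OF L]
        by (intro emult_Nil_mono[of _ "{\<zero>\<^bsub>M\<^esub>}"] subm_intros) auto
      finally show ?case by (simp add: fdim_0)
    next
      case (Suc j)
      have j: "j < t" using Suc.prems by simp
      have s: "subm (F (Suc j))" "subm (F j)" "F j \<subseteq> F (Suc j)" using F_sub j by auto
      let ?z = "take (fdim (Suc j)) ys"
      have sJ: "subm (F j <+>\<^bsub>M\<^esub> ?L)" "subm (F (Suc j) <+>\<^bsub>M\<^esub> ?L)" using s L by (auto intro!: subm_intros)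
      have le: "?L \<subseteq> F j <+>\<^bsub>M\<^esub> ?L" "F j <+>\<^bsub>M\<^esub> ?L \<subseteq> F (Suc j) <+>\<^bsub>M\<^esub> ?L" "F j \<subseteq> F j <+>\<^bsub>M\<^esub> ?L"
        using set_add_upper2[OF s(2) L] set_add_mono[OF s(3) order.refl] set_add_upper1[OF s(2) L] by blast+
      have gJ: "good R \<mm> M [] (F (Suc j) <+>\<^bsub>M\<^esub> ?L) ?L"
        by (rule good_sub[OF gL sJ(2) L order.refl set_add_upper2[OF s(1) L] subm_sub[OF sJ(2)]])
      have "F (Suc j) <+>\<^bsub>M\<^esub> (F j <+>\<^bsub>M\<^esub> ?L) = F (Suc j) <+>\<^bsub>M\<^esub> ?L"
        using set_add_assoc[OF s(1,2) L] set_add_absorb2[OF s] by simp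
      then have "emult R M [] (F (Suc j) <+>\<^bsub>M\<^esub> ?L) (F j <+>\<^bsub>M\<^esub> ?L) =
          emult R M [] (F (Suc j)) (F (Suc j) \<inter> (F j <+>\<^bsub>M\<^esub> ?L))"
        using emult_id[OF s(1) sJ(1), of "[]"] by simp
      \<comment> \<open>The factor is a quotient of \<open>D / ?z D\<close> with
        \<open>D = F (Suc j) / F j\<close>, because \<open>?L\<close> contains all multiples of
        elements of \<open>M\<close> by parameters in \<open>?z\<close>.\<close>
      also have "\<dots> \<le> emult R M [] (F (Suc j)) (lin M ?z (F (Suc j)) (F j))"
      proof (rule emult_Nil_mono)
        have "good R \<mm> M ?z (F (Suc j)) (F j)"
          using good_sub[OF gsop_good_F[OF ys, of "Suc j"] s(1,2) _ s(3) order.refl] j subm_zero[OF s(2)] by auto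
        then show "good R \<mm> M [] (F (Suc j)) (lin M ?z (F (Suc j)) (F j))" by (rule good_Nil_lin[OF ys])
        have "lin M ?z (F (Suc j)) (F j) \<subseteq> F j <+>\<^bsub>M\<^esub> ?L"
        proof (rule lin_least[OF sJ(1) le(3)])
          fix x assume "x \<in> set ?z"
          then have "x \<in> set ys" by (rule in_set_takeD)
          then have "scale M x (carrier M) \<subseteq> ?L" using lin_upper[OF b(4) carrier_is_submodule subm_zero_set] by blast
          then show "scale M x (F (Suc j)) \<subseteq> F j <+>\<^bsub>M\<^esub> ?L"
            using scale_mono[OF subm_sub[OF s(1)], of M x] le(1) by blast
        qed
        then show "lin M ?z (F (Suc j)) (F j) \<subseteq> F (Suc j) \<inter> (F j <+>\<^bsub>M\<^esub> ?L)"
          using lin_subset[OF b(5) s(1,3)] by blast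
      qed (use s sJ in \<open>auto intro: subm_intros\<close>)
      also have "\<dots> \<le> c j + ?e (Suc j)" by (rule c[OF j ys])
      finally show ?case
        using Suc.IH Suc.prems emult_add[OF gJ sJ(1) le(1,2)] by simp
    qed
    from this[of t] have "emult R M [] (carrier M) ?L \<le> (\<Sum>i<t. c i) + (\<Sum>i\<le>t. ?e i)"
      unfolding F_sub(3) using set_add_absorb2[OF carrier_is_submodule L subm_sub[OF L]] by simp
    then show ?thesis unfolding filtration_invariant_eq[OF ys] by simp
  qed
  then show ?thesis by blast
qed

section \<open>Monotonicity\<close>

text \<open>Dividing out \<open>y\<close> instead of counting it in the multiplicity omits the
  negative contribution of the kernel of \<open>y\<close>. The quotients accumulate in a different
  order, which \<open>lin_cong_set\<close> repairs.\<close>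

lemma emult_snoc_le:
  "good R \<mm> M (ys @ [x]) A C \<Longrightarrow> emult R M (ys @ [x]) A C \<le> emult R M [x] A (lin M ys A C)"
proof (induction ys arbitrary: C)
  case (Cons y ys)
  then have g: "good R \<mm> M (y # ys @ [x]) A C" by simp
  note D = goodD[OF g]
  have y: "y \<in> carrier R" "set ys \<subseteq> carrier R" using D(4) by auto
  have "emult R M (y # ys @ [x]) A C \<le> emult R M (ys @ [x]) A (C <+>\<^bsub>M\<^esub> scale M y A)"
    using emult_nonneg[OF good_scale_colon(2)[OF g]] by simp
  also have "\<dots> \<le> emult R M [x] A (lin M ys A (C <+>\<^bsub>M\<^esub> scale M y A))"
    by (rule Cons.IH[OF good_scale_colon(1)[OF g]])
  also have "lin M ys A (C <+>\<^bsub>M\<^esub> scale M y A) = lin M (ys @ [y]) A C"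
    using set_add_comm[OF D(2) subm_scale[OF y(1) D(1)]] by (simp add: lin_append)
  also have "\<dots> = lin M (y # ys) A C" by (rule lin_cong_set) (use y D in auto)
  finally show ?case by simp
qed simp

text \<open>The entries of \<open>ws\<close> kill \<open>M / ws M\<close>, so those of
  \<open>zs\<close> suffice there.\<close>

lemma good_take_lin:
  assumes ys: "gsop ys" and zs: "set zs \<subseteq> carrier R" "set ys \<subseteq> set zs \<union> set ws" "set ws \<subseteq> carrier R"
  shows "good R \<mm> M zs (carrier M) (lin M ws (carrier M) {\<zero>\<^bsub>M\<^esub>})"
proof (rule good_change[OF gsop_basic(3)[OF ys] carrier_is_submodule _ _ _ order.refl zs(1)])
  note up = lin_upper[OF zs(3) carrier_is_submodule subm_zero_set]
  show "subm (lin M ws (carrier M) {\<zero>\<^bsub>M\<^esub>})" by (rule subm_lin[OF zs(3) carrier_is_submodule subm_zero_set])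
  then show "lin M ws (carrier M) {\<zero>\<^bsub>M\<^esub>} \<subseteq> carrier M" by (rule subm_sub)
  show "{\<zero>\<^bsub>M\<^esub>} \<subseteq> lin M ws (carrier M) {\<zero>\<^bsub>M\<^esub>}" using up by blast
  show "x \<in> Idl (set zs) \<or> scale M x (carrier M) \<subseteq> lin M ws (carrier M) {\<zero>\<^bsub>M\<^esub>}" if "x \<in> set ys" for x
    using that zs(2) up genideal_self[OF zs(1)] by blast
qed

text \<open>The induction runs downwards from \<open>length xs\<close>, where \<open>t\<close> is
  the only index of the sum and both sides coincide. Lowering the bound to \<open>n\<close> rotates
  the parameter \<open>y\<close> of index \<open>n\<close> to the front and divides it out; the
  recursion then adds the multiplicity of the kernel \<open>K / B\<close>, which has to cover the
  new summands.\<close>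

lemma emult_take_ge:
  assumes ys: "gsop ys" and k: "k \<le> length xs"
  shows "(\<Sum>i\<in>{i. i \<le> t \<and> k \<le> fdim i}. emult R M (take (fdim i) ys) (F i) {\<zero>\<^bsub>M\<^esub>}) \<le>
    emult R M (take k ys) (carrier M) (lin M (drop k ys) (carrier M) {\<zero>\<^bsub>M\<^esub>})"
  using k
proof (induction k rule: inc_induct)
  case base
  have "i = t" if "i \<le> t" "length xs \<le> fdim i" for i
    using that fdim_less[of i t] fdim_t by (cases "i = t") auto
  then have "{i. i \<le> t \<and> length xs \<le> fdim i} = {t}" using fdim_t by auto
  then show ?case using gsop_basic(2)[OF ys] by (simp add: fdim_t F_sub(3))
next
  case (step n)
  note b = gsop_basic[OF ys]
  let ?e = "\<lambda>i. emult R M (take (fdim i) ys) (F i) {\<zero>\<^bsub>M\<^esub>}"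
  define y where "y = ys ! n"
  define B where "B = lin M (drop (Suc n) ys) (carrier M) {\<zero>\<^bsub>M\<^esub>}"
  define K where "K = colon M y (carrier M) B"
  have n: "n < length ys" using step b(2) by simp
  have ys_n: "drop n ys = y # drop (Suc n) ys" "take (Suc n) ys = take n ys @ [y]"
    using n by (auto simp: y_def Cons_nth_drop_Suc take_Suc_conv_app_nth)
  have yc: "y \<in> carrier R" using n b(4) by (auto simp: y_def)
  have set_ys: "set ys = set (take n ys) \<union> set (drop n ys)" by (metis append_take_drop_id set_append)
  have g: "good R \<mm> M (y # take n ys) (carrier M) B"
    unfolding B_def by (rule good_take_lin[OF ys]) (use yc b(5,6) set_ys ys_n in auto)
  note D = goodD[OF g]
  have lin_n: "lin M (drop n ys) (carrier M) {\<zero>\<^bsub>M\<^esub>} = B <+>\<^bsub>M\<^esub> scale M y (carrier M)"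
    using set_add_comm[OF D(2) subm_scale[OF yc carrier_is_submodule]] by (simp add: ys_n(1) B_def)
  have gK: "good R \<mm> M (take n ys) K B" unfolding K_def by (rule good_scale_colon(2)[OF g])
  \<comment> \<open>Since \<open>fdim\<close> is strictly increasing, at most one summand is new; if
    there is none, nonnegativity suffices.\<close>
  have K_ge: "(\<Sum>i\<in>{i. i \<le> t \<and> fdim i = n}. ?e i) \<le> emult R M (take n ys) K B"
  proof (cases "\<exists>i\<le>t. fdim i = n")
    case False
    then have "{i. i \<le> t \<and> fdim i = n} = {}" by auto
    then show ?thesis using emult_nonneg[OF gK] by (simp only: sum.empty)
  next
    case True
    then obtain i where i: "i \<le> t" "fdim i = n" by blast
    have uniq: "k = i" if "k \<le> t" "fdim k = n" for k
      using that i fdim_less[of k i] fdim_less[of i k] by (cases k i rule: linorder_cases) auto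
    have "k \<le> t \<and> fdim k = n \<longleftrightarrow> k = i" for k using uniq[of k] i by blast
    then have single: "{i. i \<le> t \<and> fdim i = n} = {i}" by simp
    have it: "i < t" using i step fdim_t by (cases "i = t") auto
    have s: "subm (F i)" by (rule F_sub(1)[OF i(1)])
    have disj: "F i \<inter> lin M (drop n ys) (carrier M) {\<zero>\<^bsub>M\<^esub>} = {\<zero>\<^bsub>M\<^esub>}" using ys it i unfolding gsop_def by auto
    have "B \<subseteq> lin M (drop n ys) (carrier M) {\<zero>\<^bsub>M\<^esub>}"
      unfolding lin_n by (rule set_add_upper1[OF D(2) subm_scale[OF yc carrier_is_submodule]])
    \<comment> \<open>\<open>F i\<close> meets even the larger submodule \<open>B + y M\<close> only
      in zero. So it embeds into \<open>M / B\<close>, and by \<open>FK\<close> its image lies in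
      the kernel of \<open>y\<close>.\<close>
    then have FB: "F i \<inter> B = {\<zero>\<^bsub>M\<^esub>}" using disj subm_zero[OF s] subm_zero[OF D(2)] by blast
    have "scale M y (F i) \<subseteq> {\<zero>\<^bsub>M\<^esub>}" by (rule gsop_kill[OF ys it]) (simp add: i ys_n)
    then have FK: "F i \<subseteq> K"
      unfolding K_def using subm_zero[OF D(2)] subm_sub[OF s] by (auto simp: colon_def scale_def)
    have sB: "subm (F i <+>\<^bsub>M\<^esub> B)" by (rule subm_set_add[OF s D(2)])
    have gFK: "good R \<mm> M (take n ys) K (F i <+>\<^bsub>M\<^esub> B)"
      using good_sub[OF gK goodD(1)[OF gK] sB set_add_upper2[OF s D(2)] _ order.refl]
        set_add_least[OF goodD(1)[OF gK] FK goodD(3)[OF gK]] by blast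
    have "emult R M (take n ys) K B = emult R M (take n ys) K (F i <+>\<^bsub>M\<^esub> B) + emult R M (take n ys) (F i <+>\<^bsub>M\<^esub> B) B"
      by (rule emult_add[OF gK sB set_add_upper2[OF s D(2)] goodD(3)[OF gFK]])
    also have "emult R M (take n ys) (F i <+>\<^bsub>M\<^esub> B) B = emult R M (take n ys) (F i) {\<zero>\<^bsub>M\<^esub>}"
      using emult_id[OF s D(2) b(5)] FB by simp
    finally show ?thesis using emult_nonneg[OF gFK] single i by simp
  qed
  have "{i. i \<le> t \<and> n \<le> fdim i} = {i. i \<le> t \<and> Suc n \<le> fdim i} \<union> {i. i \<le> t \<and> fdim i = n}" by auto
  then have "(\<Sum>i\<in>{i. i \<le> t \<and> n \<le> fdim i}. ?e i) =
      (\<Sum>i\<in>{i. i \<le> t \<and> Suc n \<le> fdim i}. ?e i) + (\<Sum>i\<in>{i. i \<le> t \<and> fdim i = n}. ?e i)"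
    by (simp add: sum.union_disjoint disjoint_iff)
  also have "\<dots> \<le> emult R M (take (Suc n) ys) (carrier M) B + emult R M (take n ys) K B"
    using step.IH K_ge by (simp add: B_def)
  also have "emult R M (take (Suc n) ys) (carrier M) B = emult R M (y # take n ys) (carrier M) B"
    unfolding ys_n(2) by (rule emult_rotate[OF g, symmetric])
  also have "\<dots> + emult R M (take n ys) K B = emult R M (take n ys) (carrier M) (lin M (drop n ys) (carrier M) {\<zero>\<^bsub>M\<^esub>})"
    by (simp add: lin_n K_def)
  finally show ?case .
qed

lemma invariant_step:
  assumes j: "j < length xs" and ys: "gsop ys" and x: "x = ys ! j" and n: "0 < n"
    and gn: "gsop (ys[j := x [^] n])" and gn1: "gsop (ys[j := x [^] Suc n])"
  shows "filtration_invariant R M t F (ys[j := x [^] n]) \<le> filtration_invariant R M t F (ys[j := x [^] Suc n])"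
proof -
  note b = gsop_basic[OF ys]
  have jl: "j < length ys" using j b(2) by simp
  have xc: "x \<in> carrier R" using x b(4) jl by auto
  let ?ws = "take j ys @ drop (Suc j) ys"
  let ?L = "lin M ?ws (carrier M) {\<zero>\<^bsub>M\<^esub>}"
  let ?e = "\<lambda>i. emult R M (take (fdim i) ys) (F i) {\<zero>\<^bsub>M\<^esub>}"
  let ?S = "{i. i \<le> t \<and> Suc j \<le> fdim i}"
  have ws: "set ?ws \<subseteq> carrier R" using b(5,6) by auto
  have sL: "subm ?L" by (rule subm_lin[OF ws carrier_is_submodule subm_zero_set])
  \<comment> \<open>The parameters after \<open>x\<close> have been divided out in
    \<open>emult_take_ge\<close>; \<open>emult_snoc_le\<close> divides out those before
    \<open>x\<close> as well, which turns the bound into one over \<open>M / ?L\<close>.\<close>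
  have main: "(\<Sum>i\<in>?S. ?e i) \<le> emult R M [x] (carrier M) ?L"
  proof -
    have t: "take (Suc j) ys = take j ys @ [x]" using jl x by (simp add: take_Suc_conv_app_nth)
    have "set ys = set (take (Suc j) ys) \<union> set (drop (Suc j) ys)" by (metis append_take_drop_id set_append)
    then have "good R \<mm> M (take j ys @ [x]) (carrier M) (lin M (drop (Suc j) ys) (carrier M) {\<zero>\<^bsub>M\<^esub>})"
      unfolding t[symmetric] by (intro good_take_lin[OF ys b(5) _ b(6)]) simp
    from emult_snoc_le[OF this] emult_take_ge[OF ys, of "Suc j"] show ?thesis
      using j unfolding t lin_append by simp
  qed
  \<comment> \<open>Up to the length of the kernel of \<open>x^m\<close> on \<open>M / ?L\<close>,
    the invariant is affine in the exponent \<open>m\<close>, with a slope that is nonnegative by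
    \<open>main\<close>. The constant collects those \<open>F i\<close> whose parameters do not
    include the one at \<open>j\<close>. Goodness of the kernel is carried along for the comparison
    of lengths.\<close>
  have formula: "filtration_invariant R M t F (ys[j := x [^] m]) =
      int m * (emult R M [x] (carrier M) ?L - (\<Sum>i\<in>?S. ?e i)) +
      (emult R M [] (colon M (x [^] m) (carrier M) ?L) ?L - (\<Sum>i\<in>{..t} - ?S. ?e i)) \<and>
      good R \<mm> M [] (colon M (x [^] m) (carrier M) ?L) ?L"
    if gm: "gsop (ys[j := x [^] m])" for m
  proof -
    have xm: "x [^] m \<in> carrier R" using xc by simp
    have upd: "ys[j := x [^] m] = take j ys @ x [^] m # drop (Suc j) ys" by (rule upd_conv_take_nth_drop[OF jl])
    have g: "good R \<mm> M [x [^] m] (carrier M) ?L"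
      by (rule good_take_lin[OF gm]) (use xm ws upd in auto)
    have "lin M (ys[j := x [^] m]) (carrier M) {\<zero>\<^bsub>M\<^esub>} = lin M (x [^] m # ?ws) (carrier M) {\<zero>\<^bsub>M\<^esub>}"
      unfolding upd by (rule lin_cong_set) (use xm ws carrier_is_submodule subm_zero_set in auto)
    also have "\<dots> = ?L <+>\<^bsub>M\<^esub> scale M (x [^] m) (carrier M)"
      using set_add_comm[OF sL subm_scale[OF xm carrier_is_submodule]] by simp
    finally have "emult R M [] (carrier M) (lin M (ys[j := x [^] m]) (carrier M) {\<zero>\<^bsub>M\<^esub>}) =
        emult R M [x [^] m] (carrier M) ?L + emult R M [] (colon M (x [^] m) (carrier M) ?L) ?L" by simp
    also have "emult R M [x [^] m] (carrier M) ?L = int m * emult R M [x] (carrier M) ?L"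
      by (rule emult_pow[OF g xc])
    finally have len: "emult R M [] (carrier M) (lin M (ys[j := x [^] m]) (carrier M) {\<zero>\<^bsub>M\<^esub>}) =
        int m * emult R M [x] (carrier M) ?L + emult R M [] (colon M (x [^] m) (carrier M) ?L) ?L" .
    have e_in: "emult R M (take (fdim i) (ys[j := x [^] m])) (F i) {\<zero>\<^bsub>M\<^esub>} = int m * ?e i" if "i \<in> ?S" for i
    proof -
      have ji: "j < length (take (fdim i) ys)" using that jl by auto
      have eq: "take (fdim i) (ys[j := z]) = take j ys @ z # drop (Suc j) (take (fdim i) ys)" for z
        using upd_conv_take_nth_drop[OF ji, of z] that by (simp add: take_update_swap min_def)
      have "emult R M (take (fdim i) (ys[j := x [^] m])) (F i) {\<zero>\<^bsub>M\<^esub>} =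
          int m * emult R M (take (fdim i) (ys[j := x])) (F i) {\<zero>\<^bsub>M\<^esub>}"
        unfolding eq by (rule emult_pow_mid[OF _ xc]) (use gsop_good_F[OF gm, of i] that eq in auto)
      then show ?thesis using x by simp
    qed
    have e_out: "emult R M (take (fdim i) (ys[j := x [^] m])) (F i) {\<zero>\<^bsub>M\<^esub>} = ?e i" if "i \<in> {..t} - ?S" for i
      using that by (auto simp: take_update_cancel)
    have "(\<Sum>i\<le>t. emult R M (take (fdim i) (ys[j := x [^] m])) (F i) {\<zero>\<^bsub>M\<^esub>}) =
        (\<Sum>i\<in>{..t} - ?S. emult R M (take (fdim i) (ys[j := x [^] m])) (F i) {\<zero>\<^bsub>M\<^esub>}) +
        (\<Sum>i\<in>?S. emult R M (take (fdim i) (ys[j := x [^] m])) (F i) {\<zero>\<^bsub>M\<^esub>})"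
      by (rule sum.subset_diff) auto
    also have "\<dots> = (\<Sum>i\<in>{..t} - ?S. ?e i) + int m * (\<Sum>i\<in>?S. ?e i)"
      using e_in e_out by (simp add: sum_distrib_left)
    finally show ?thesis
      unfolding filtration_invariant_eq[OF gm] len using good_scale_colon(2)[OF g] by (simp add: algebra_simps)
  qed
  have xn: "x [^] n \<in> carrier R" "x [^] Suc n \<in> carrier R" using xc by auto
  \<comment> \<open>The kernel of \<open>x^n\<close> grows with \<open>n\<close>, and so does its
    length.\<close>
  have "colon M (x [^] n) (carrier M) ?L \<subseteq> colon M (x [^] Suc n) (carrier M) ?L"
    using xc subm_smult[OF sL xc] by (auto simp: colon_def smult_assoc1 smult_swap[of "x [^] n" x])
  then have "emult R M [] (colon M (x [^] n) (carrier M) ?L) ?L \<le> emult R M [] (colon M (x [^] Suc n) (carrier M) ?L) ?L"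
    using formula[OF gn1] xn sL subset_colon[OF xn(1) sL subm_sub[OF sL]]
    by (intro emult_Nil_mono[OF conjunct2[OF formula[OF gn1]]]) (auto intro!: subm_intros)
  moreover have "int n * (emult R M [x] (carrier M) ?L - (\<Sum>i\<in>?S. ?e i)) \<le> int (Suc n) * (emult R M [x] (carrier M) ?L - (\<Sum>i\<in>?S. ?e i))"
    using main by (intro mult_right_mono) auto
  ultimately show ?thesis using formula[OF gn] formula[OF gn1] by linarith
qed

section \<open>Powers of the parameters and the final comparison\<close>

lemma good_pow:
  assumes "good R \<mm> M (x # zs) A B" "0 < n"
  shows "good R \<mm> M (x [^] (n::nat) # zs) A B"
  using assms(2)
proof (induction n rule: nat_induct_non_zero)
  case 1
  have "x \<in> carrier R" using goodD(4)[OF assms(1)] by auto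
  then show ?case using assms(1) by simp
next
  case (Suc n)
  then show ?case using good_mult[OF Suc.IH assms(1) m_carrier] by simp
qed

text \<open>Each parameter is raised to its power at the head of the list and then moved into the
  accumulator \<open>zs\<close>; \<open>good_set\<close> permits this reordering.\<close>

lemma good_power_seq:
  "length ys = length ns \<Longrightarrow> good R \<mm> M (ys @ zs) A B \<Longrightarrow> (\<forall>n\<in>set ns. 0 < n) \<Longrightarrow>
    good R \<mm> M (power_seq R ys ns @ zs) A B"
proof (induction ys ns arbitrary: zs rule: list_induct2)
  case (Cons y ys n ns)
  have c: "set (y # ys @ zs) \<subseteq> carrier R" using goodD(4)[OF Cons.prems(1)] by simp
  have "good R \<mm> M (y [^] n # ys @ zs) A B" using good_pow[of y "ys @ zs" A B n] Cons.prems by simp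
  then have "good R \<mm> M (ys @ y [^] n # zs) A B" by (rule good_set) (use c in auto)
  then have g: "good R \<mm> M (power_seq R ys ns @ y [^] n # zs) A B" using Cons by simp
  have "good R \<mm> M (y [^] n # power_seq R ys ns @ zs) A B" by (rule good_set[OF g]) (use goodD(4)[OF g] in auto)
  then show ?case by (simp add: power_seq_def)
qed (simp add: power_seq_def)

lemma power_seq_nth:
  "length ns = length ys \<Longrightarrow> k < length ys \<Longrightarrow> power_seq R ys ns ! k = (ys ! k) [^] (ns ! k)"
  by (simp add: power_seq_def)

lemma length_power_seq: "length ns = length ys \<Longrightarrow> length (power_seq R ys ns) = length ys"
  by (simp add: power_seq_def)

text \<open>A power with positive exponent is a multiple of its parameter. Hence the powers stay in
  \<open>\<mm>\<close> and generate a smaller submodule, which still meets \<open>F i\<close> only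
  in zero.\<close>

lemma gsop_power_seq:
  assumes ns: "length ns = length xs" "\<forall>n\<in>set ns. 0 < n"
  shows "gsop (power_seq R xs ns)"
proof -
  let ?p = "power_seq R xs ns"
  note b = gsop_basic[OF gsop_xs]
  have g: "good R \<mm> M ?p (carrier M) {\<zero>\<^bsub>M\<^esub>}" using good_power_seq[of xs ns "[]"] b(3) ns by simp
  have div: "\<exists>r\<in>carrier R. ?p ! k = r \<otimes> xs ! k" and x: "xs ! k \<in> \<mm>" "xs ! k \<in> carrier R" if k: "k < length xs" for k
  proof -
    show "xs ! k \<in> \<mm>" "xs ! k \<in> carrier R" using b(1,4) k by auto
    have "0 < ns ! k" using ns k by simp
    then obtain m where m: "ns ! k = Suc m" using gr0_implies_Suc by blast
    show "\<exists>r\<in>carrier R. ?p ! k = r \<otimes> xs ! k"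
      using \<open>xs ! k \<in> carrier R\<close> power_seq_nth[OF ns(1) k] by (intro bexI[of _ "xs ! k [^] m"]) (auto simp: m)
  qed
  have pm: "set ?p \<subseteq> \<mm>"
  proof
    fix z assume "z \<in> set ?p"
    then obtain k where k: "k < length xs" "z = ?p ! k" using length_power_seq[OF ns(1)] by (metis in_set_conv_nth)
    then show "z \<in> \<mm>" using div[OF k(1)] ideal_mult(1)[OF ideal_m x(1)[OF k(1)]] by auto
  qed
  have "F i \<inter> lin M (drop (fdim i) ?p) (carrier M) {\<zero>\<^bsub>M\<^esub>} = {\<zero>\<^bsub>M\<^esub>}" if i: "i < t" for i
  proof -
    note up = lin_upper[OF b(6) carrier_is_submodule subm_zero_set, of "fdim i"]
    have sL: "subm (lin M (drop (fdim i) xs) (carrier M) {\<zero>\<^bsub>M\<^esub>})" by (rule subm_lin[OF b(6) carrier_is_submodule subm_zero_set])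
    have "lin M (drop (fdim i) ?p) (carrier M) {\<zero>\<^bsub>M\<^esub>} \<subseteq> lin M (drop (fdim i) xs) (carrier M) {\<zero>\<^bsub>M\<^esub>}"
    proof (rule lin_least[OF sL])
      show "{\<zero>\<^bsub>M\<^esub>} \<subseteq> lin M (drop (fdim i) xs) (carrier M) {\<zero>\<^bsub>M\<^esub>}" using up by blast
      fix z assume "z \<in> set (drop (fdim i) ?p)"
      then obtain l where l: "l < length (drop (fdim i) ?p)" "z = drop (fdim i) ?p ! l" by (metis in_set_conv_nth)
      define k where "k = fdim i + l"
      have k: "k < length xs" "z = ?p ! k" using l length_power_seq[OF ns(1)] by (auto simp: k_def)
      obtain r where r: "r \<in> carrier R" "z = r \<otimes> xs ! k" using div[OF k(1)] k(2) by blast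
      have "drop (fdim i) xs ! l \<in> set (drop (fdim i) xs)" using k(1) by (intro nth_mem) (simp add: k_def)
      then have "xs ! k \<in> set (drop (fdim i) xs)" using k(1) by (simp add: k_def)
      then have "scale M (xs ! k) (carrier M) \<subseteq> lin M (drop (fdim i) xs) (carrier M) {\<zero>\<^bsub>M\<^esub>}" using up by blast
      moreover have "scale M z (carrier M) \<subseteq> scale M (xs ! k) (carrier M)"
        using r scale_scale[OF r(1) x(2)[OF k(1)] carrier_is_submodule]
          scale_subset[OF r(1) subm_scale[OF x(2)[OF k(1)] carrier_is_submodule]] by simp
      ultimately show "scale M z (carrier M) \<subseteq> lin M (drop (fdim i) xs) (carrier M) {\<zero>\<^bsub>M\<^esub>}" by blast
    qed
    moreover have "set (drop (fdim i) ?p) \<subseteq> carrier R" using goodD(4)[OF g] set_drop_subset[of "fdim i" ?p] by blast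
    then have "\<zero>\<^bsub>M\<^esub> \<in> lin M (drop (fdim i) ?p) (carrier M) {\<zero>\<^bsub>M\<^esub>}"
      by (intro subm_zero subm_lin carrier_is_submodule subm_zero_set)
    moreover have "F i \<inter> lin M (drop (fdim i) xs) (carrier M) {\<zero>\<^bsub>M\<^esub>} = {\<zero>\<^bsub>M\<^esub>}" using gsop_xs i unfolding gsop_def by blast
    moreover have "\<zero>\<^bsub>M\<^esub> \<in> F i" using subm_zero F_sub(1) i by simp
    ultimately show ?thesis by blast
  qed
  then show ?thesis unfolding gsop_def using pm g length_power_seq[OF ns(1)] by blast
qed

text \<open>The exponent at \<open>j\<close> is reset to 1, so that varying it amounts to taking
  powers of one entry of a fixed sequence, as \<open>invariant_step\<close> requires.\<close>

lemma power_seq_update: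
  assumes "length ns = length xs" "j < length xs"
  shows "power_seq R xs (ns[j := m]) = (power_seq R xs (ns[j := 1]))[j := (power_seq R xs (ns[j := 1]) ! j) [^] m]"
proof (rule nth_equalityI)
  have xj: "xs ! j \<in> carrier R" using gsop_basic(4)[OF gsop_xs] assms(2) by auto
  show "length (power_seq R xs (ns[j := m])) = length ((power_seq R xs (ns[j := 1]))[j := (power_seq R xs (ns[j := 1]) ! j) [^] m])"
    using assms by (simp add: length_power_seq)
  fix k assume "k < length (power_seq R xs (ns[j := m]))"
  then have k: "k < length xs" using assms by (simp add: length_power_seq)
  show "power_seq R xs (ns[j := m]) ! k = (power_seq R xs (ns[j := 1]))[j := (power_seq R xs (ns[j := 1]) ! j) [^] m] ! k"
    using assms k xj by (cases "k = j") (simp_all add: power_seq_nth length_power_seq)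
qed

lemma invariant_Suc:
  assumes ns: "length ns = length xs" "\<forall>n\<in>set ns. 0 < n" and j: "j < length xs"
  shows "filtration_invariant R M t F (power_seq R xs ns) \<le>
    filtration_invariant R M t F (power_seq R xs (ns[j := Suc (ns ! j)]))"
proof -
  let ?ys = "power_seq R xs (ns[j := 1])"
  have pos: "\<forall>n\<in>set (ns[j := m]). 0 < n" if "0 < m" for m
    using that ns(2) set_update_subset_insert[of ns j m] by auto
  have gs: "gsop (power_seq R xs (ns[j := m]))" if "0 < m" for m
    using gsop_power_seq[OF _ pos[OF that]] ns(1) by simp
  have nj: "0 < ns ! j" using ns j by simp
  have gu: "gsop (?ys[j := (?ys ! j) [^] m])" if "0 < m" for m :: nat
    using gs[OF that] unfolding power_seq_update[OF ns(1) j, of m] .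
  have "filtration_invariant R M t F (?ys[j := (?ys ! j) [^] (ns ! j)]) \<le>
      filtration_invariant R M t F (?ys[j := (?ys ! j) [^] Suc (ns ! j)])"
    by (rule invariant_step[OF j gs[OF zero_less_one] refl nj gu[OF nj] gu[OF zero_less_Suc]])
  then show ?thesis
    unfolding power_seq_update[OF ns(1) j, of "Suc (ns ! j)", symmetric] power_seq_update[OF ns(1) j, of "ns ! j", symmetric]
    by simp
qed

text \<open>Induction on the total excess of \<open>ms\<close> over \<open>ns\<close>: as long as
  they differ, one entry of \<open>ns\<close> can be raised by one without exceeding
  \<open>ms\<close>.\<close>

lemma invariant_mono:
  assumes "length ns = length xs" "\<forall>n\<in>set ns. 0 < n" "length ms = length xs"
    and "\<And>k. k < length xs \<Longrightarrow> ns ! k \<le> ms ! k"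
  shows "filtration_invariant R M t F (power_seq R xs ns) \<le> filtration_invariant R M t F (power_seq R xs ms)"
  using assms
proof (induction "\<Sum>k<length xs. ms ! k - ns ! k" arbitrary: ns rule: less_induct)
  case less
  show ?case
  proof (cases "ns = ms")
    case False
    then obtain j where j: "j < length xs" "ns ! j \<noteq> ms ! j" using less.prems by (metis nth_equalityI)
    let ?ns = "ns[j := Suc (ns ! j)]"
    have lt: "ns ! j < ms ! j" using less.prems(4)[OF j(1)] j(2) by simp
    have "(\<Sum>k<length xs. ms ! k - ?ns ! k) < (\<Sum>k<length xs. ms ! k - ns ! k)"
    proof (rule sum_strict_mono_ex1)
      show "\<forall>k\<in>{..<length xs}. ms ! k - ?ns ! k \<le> ms ! k - ns ! k"
        using less.prems(1) j by (auto simp: nth_list_update)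
      show "\<exists>k\<in>{..<length xs}. ms ! k - ?ns ! k < ms ! k - ns ! k"
        using less.prems(1) j lt by (intro bexI[of _ j]) auto
    qed simp
    moreover have "\<forall>n\<in>set ?ns. 0 < n" using less.prems(2) set_update_subset_insert[of ns j] by fastforce
    moreover have "?ns ! k \<le> ms ! k" if "k < length xs" for k
      using less.prems(1,4) that lt j by (cases "k = j") auto
    ultimately have "filtration_invariant R M t F (power_seq R xs ?ns) \<le> filtration_invariant R M t F (power_seq R xs ms)"
      using less.prems(1,3) by (intro less.hyps) auto
    then show ?thesis using invariant_Suc[OF less.prems(1,2) j(1)] by simp
  qed simp
qed

text \<open>Boundedness makes the invariant attain its maximum over positive exponents at some
  \<open>ms\<close>. Above \<open>ms\<close> it cannot decrease by monotonicity and cannot increase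
  by maximality, so the largest entry of \<open>ms\<close> serves as threshold.\<close>

lemma invariant_eventually_constant:
  "\<exists>c n0. \<forall>ns. length ns = length xs \<and> (\<forall>n \<in> set ns. n \<ge> n0) \<longrightarrow>
     filtration_invariant R M t F (power_seq R xs ns) = c"
proof -
  let ?f = "\<lambda>ns. filtration_invariant R M t F (power_seq R xs ns)"
  define P where "P ns \<longleftrightarrow> length ns = length xs \<and> (\<forall>n\<in>set ns. 0 < n)" for ns :: "nat list"
  obtain C where C: "\<And>ns. P ns \<Longrightarrow> ?f ns \<le> C"
    using invariant_bounded gsop_power_seq unfolding P_def by blast
  have "P (replicate (length xs) 1)" by (simp add: P_def)
  then obtain ms where ms: "P ms" "\<And>ns. P ns \<Longrightarrow> nat (C - ?f ms) \<le> nat (C - ?f ns)"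
    using ex_has_least_nat[of P _ "\<lambda>ns. nat (C - ?f ns)"] by blast
  \<comment> \<open>The inserted \<open>1\<close> keeps the exponents positive and provides a
    maximum when \<open>ms\<close> is empty.\<close>
  define n0 where "n0 = Max (insert 1 (set ms))"
  have n0: "1 \<le> n0" "\<And>n. n \<in> set ms \<Longrightarrow> n \<le> n0" unfolding n0_def by auto
  have "?f ns = ?f ms" if ns: "length ns = length xs" "\<forall>n\<in>set ns. n \<ge> n0" for ns
  proof (rule antisym)
    have Pns: "P ns" using ns n0(1) unfolding P_def by force
    show "?f ns \<le> ?f ms" using ms(2)[OF Pns] C[OF Pns] C[OF ms(1)] by linarith
    have l: "length ms = length xs" using ms(1) by (simp add: P_def)
    have "ms ! k \<le> ns ! k" if "k < length xs" for k
      using n0(2)[of "ms ! k"] ns that l by (metis nth_mem order.trans)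
    then show "?f ms \<le> ?f ns" using ms(1) ns(1) unfolding P_def by (intro invariant_mono) auto
  qed
  then show ?thesis by blast
qed

end

theorem theorem3p8:
  fixes R :: "('a, 'r) ring_scheme" and \<mm> :: "'a set"
    and M :: "('a, 'b, 'm) module_scheme"
    and t :: nat and F :: "nat \<Rightarrow> 'b set" and xs :: "'a list"
  assumes "noetherian_local_ring R \<mm>"
    and "fin_gen_module R M"
    and "sequentially_generalized_CM R \<mm> M"
    and "gcm_filtration R \<mm> M t F"
    and "good_system_of_parameters R \<mm> M t F xs"
  shows "\<exists>c n0. \<forall>ns. length ns = length xs \<and> (\<forall>n \<in> set ns. n \<ge> n0) \<longrightarrow>
           filtration_invariant R M t F (power_seq R xs ns) = c"
proof -
  have "module R M" using assms(2) unfolding fin_gen_module_def by blast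
  then interpret gcm_filtered R \<mm> M t F xs
    using assms by (intro gcm_filtered.intro lmod.intro gcm_filtered_axioms.intro)
  show ?thesis by (rule invariant_eventually_constant)
qed

end
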